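(* For each $p$ with $1\le p\le\infty$: (1) $L^p[\mathbb{R}_I^\infty]\subset SD^2[\mathbb{R}_I^\infty]$ as a continuous, dense and compact embedding. (2) $\mathfrak{M}[\mathbb{R}_I^\infty]\subset SD^2[\mathbb{R}_I^\infty]$ as a continuous, dense and compact embedding, where $\mathfrak{M}[\mathbb{R}_I^\infty]$ is the space of finitely additive measures on $\mathbb{R}_I^\infty$.
   Context: Let $I=[-\tfrac12,\tfrac12]$, $I_n=\prod_{i=n+1}^{\infty}I$, and $\mathbb{R}_I^n=\mathbb{R}^n\times I_n\subset\mathbb{R}^\infty$, with topology $\{U\times I_n: U\subset\mathbb{R}^n\text{ open}\}$, the corresponding Borel $\sigma$-algebra, and the measure $\lambda_\infty(A\times I_n)=\lambda_n(A)$, where $\lambda_n$ is Lebesgue measure on $\mathbb{R}^n$. Then $\mathbb{R}_I^n\subset\mathbb{R}_I^{n+1}$. Put $X_1=\bigcup_n\mathbb{R}_I^n$, with the topology $\tau_1$ induced by the class of sets $\bigcup_n (U\times I_n)$ with $U$ open in $\mathbb{R}^n$, and $X_2=\mathbb{R}^\infty\setminus X_1$ with the discrete topology. $\mathbb{R}_I^\infty$ is the set $\mathbb{R}^\infty$ with the disjoint-union topology of $X_1$ and $X_2$. The measure $\lambda_\infty$ on its Borel $\sigma$-algebra is concentrated on $X_1$: $\lambda_\infty(A)=\lambda_\infty(A\cap X_1)$, and it agrees with $\lambda_\infty$ on each $\mathbb{R}_I^n$. $L^p[\mathbb{R}_I^n]$ is the (complex) $L^p$ space of $(\mathbb{R}_I^n,\lambda_\infty)$;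 extending by $0$, $L^p[\mathbb{R}_I^n]\subset L^p[\mathbb{R}_I^{n+1}]$. $L^p[\mathbb{R}_I^\infty]$ consists of the measurable $f$ for which there is an $L^p$-Cauchy sequence $f_n\in L^p[\mathbb{R}_I^n]$ with $f_n\to f$ $\lambda_\infty$-a.e. Jones functions: $\{\mathcal{E}_k\}_{k\ge1}$ is a fixed sequence of (complex-valued) functions on $\mathbb{R}_I^\infty$; each $\mathcal{E}_k$ is built from functions of the individual coordinates $x_1,\dots,x_n$ (for some $n$), satisfies $|\mathcal{E}_k|<1$ on a cube $\prod_{j=1}^n I_k^j$ (times $I_n$) and $\mathcal{E}_k=0$ off that cube, and lies in $L^p[\mathbb{R}_I^\infty]$ for all $1\le p\le\infty$. The functionals $F_k(f)=\int_{\mathbb{R}_I^\infty}\mathcal{E}_k f\,d\lambda_\infty$ on $L^p[\mathbb{R}_I^\infty]$ are bounded with norm at most $1$ and are fundamental: $F_k(f)=0$ for all $k$ implies $f=0$. With $t_k=2^{-k}$, $SD^2[\mathbb{R}_I^\infty]$ is the completion of $L^1[\mathbb{R}_I^\infty]$ with respect to the inner product $\langle f,g\rangle=\sum_{k=1}^\infty t_kF_k(f)\overline{F_k(g)}$. Objects on which the $F_k$ act are identified with elements of the completion through the sequence $(F_k(\cdot))_k$. The space $\mathfrak{M}[\mathbb{R}_I^\infty]$ is identified with the bidual $(L^1[\mathbb{R}_I^\infty])^{**}$, so that $F_k(\mu)=\mu(\mathcal{E}_k)$.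
   Formalization: In (2) the embedding is injective only after identifying finitely additive measures with equal values F_k(μ) for all k; injectivity on the full bidual fails, since by Hahn–Banach some nonzero μ vanishes at every E_k. *)

theory Defs
  imports "HOL-Probability.Essential_Supremum"
begin

text \<open>
  Points of \<open>\<real>\<^sup>\<infinity>\<close> are functions \<open>nat \<Rightarrow> real\<close>, with coordinates numbered from 0. The space
  \<open>\<real>\<^sup>n\<close> is the space of functions that are undefined outside \<open>{..<n}\<close>, with the library's
  topology \<open>powertop_real {..<n}\<close> and Lebesgue measure \<open>lborel_n n\<close>.
\<close>

definition lborel_n :: "nat \<Rightarrow> (nat \<Rightarrow> real) measure" where
  "lborel_n n = (\<Pi>\<^sub>M i\<in>{..<n}. lborel)"

definition cyl :: "nat \<Rightarrow> (nat \<Rightarrow> real) set \<Rightarrow> (nat \<Rightarrow> real) set" where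
  \<comment> \<open>\<open>A \<times> I\<^sub>n\<close> for a subset \<open>A\<close> of \<open>\<real>\<^sup>n\<close>\<close>
  "cyl n A = {x. restrict x {..<n} \<in> A \<and> (\<forall>i\<ge>n. x i \<in> {-1/2..1/2})}"

definition RI :: "nat \<Rightarrow> (nat \<Rightarrow> real) set" where
  "RI n = cyl n ({..<n} \<rightarrow>\<^sub>E UNIV)"

definition RI_top :: "nat \<Rightarrow> (nat \<Rightarrow> real) topology" where
  \<comment> \<open>the open sets are exactly the sets \<open>cyl n U\<close> with \<open>U\<close> open in \<open>\<real>\<^sup>n\<close>\<close>
  "RI_top n = pullback_topology (RI n) (\<lambda>x. restrict x {..<n}) (powertop_real {..<n})"

definition X1 :: "(nat \<Rightarrow> real) set" where
  "X1 = (\<Union>n\<in>{1..}. RI n)"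

definition X2 :: "(nat \<Rightarrow> real) set" where
  "X2 = UNIV - X1"

text \<open>
  The sets \<open>\<Union>\<^sub>n (U\<^sub>n \<times> I\<^sub>n)\<close> are not closed under intersection, since \<open>I\<close> is not open;
  so they are taken as a subbase.
\<close>

definition X1_top :: "(nat \<Rightarrow> real) topology" where
  "X1_top = topology_generated_by
     {(\<Union>n\<in>{1..}. cyl n (U n)) | U. \<forall>n\<ge>1. openin (powertop_real {..<n}) (U n)}"

definition RI_inf_top :: "(nat \<Rightarrow> real) topology" where
  "RI_inf_top = topology (\<lambda>U. openin X1_top (U \<inter> X1) \<and> openin (discrete_topology X2) (U \<inter> X2))"

definition borel_of :: "'a topology \<Rightarrow> 'a measure" where
  "borel_of T = sigma (topspace T) {U. openin T U}"

text \<open>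
  The conditions determine \<open>\<lambda>\<^sub>\<infinity>\<close> uniquely: the sets \<open>A \<times> I\<^sub>n\<close> form a generator of the Borel
  sets of \<open>X1\<close> that is closed under intersection, and \<open>X1\<close> is a countable union of such sets
  of finite measure.
\<close>

definition is_lambda_inf :: "(nat \<Rightarrow> real) measure \<Rightarrow> bool" where
  "is_lambda_inf L \<longleftrightarrow>
     sets L = sets (borel_of RI_inf_top) \<and>
     (\<forall>A\<in>sets L. emeasure L A = emeasure L (A \<inter> X1)) \<and>
     (\<forall>n\<ge>1. \<forall>A\<in>sets (lborel_n n). emeasure L (cyl n A) = emeasure (lborel_n n) A)"

text \<open>
  Elements of \<open>L\<^sup>p\<close> spaces are represented by functions; equality in \<open>L\<^sup>p\<close> is equality almost
  everywhere. The exponent ranges over \<open>ennreal\<close>, so \<open>p = \<infinity>\<close> is included.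
\<close>

definition Lspace :: "'a measure \<Rightarrow> ennreal \<Rightarrow> ('a \<Rightarrow> complex) set" where
  "Lspace M p = {f \<in> borel_measurable M.
     if p = \<infinity> then esssup M (\<lambda>x. ereal (cmod (f x))) < \<infinity>
     else integrable M (\<lambda>x. cmod (f x) powr enn2real p)}"

definition Lnorm :: "'a measure \<Rightarrow> ennreal \<Rightarrow> ('a \<Rightarrow> complex) \<Rightarrow> real" where
  "Lnorm M p f =
     (if p = \<infinity> then real_of_ereal (esssup M (\<lambda>x. ereal (cmod (f x))))
      else (\<integral>x. cmod (f x) powr enn2real p \<partial>M) powr (1 / enn2real p))"

definition Lp_RI :: "(nat \<Rightarrow> real) measure \<Rightarrow> nat \<Rightarrow> ennreal \<Rightarrow> ((nat \<Rightarrow> real) \<Rightarrow> complex) set" where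
  \<comment> \<open>\<open>L\<^sup>p\<close> of \<open>RI n\<close>, with functions extended by 0\<close>
  "Lp_RI L n p = {f \<in> Lspace L p. f \<in> borel_measurable (borel_of (RI_top n)) \<and> (\<forall>x. x \<notin> RI n \<longrightarrow> f x = 0)}"

definition Lp_inf :: "(nat \<Rightarrow> real) measure \<Rightarrow> ennreal \<Rightarrow> ((nat \<Rightarrow> real) \<Rightarrow> complex) set" where
  "Lp_inf L p = {f \<in> borel_measurable L.
     \<exists>g. (\<forall>n\<ge>1. g n \<in> Lp_RI L n p) \<and>
         (\<forall>e>0. \<exists>N\<ge>1. \<forall>m\<ge>N. \<forall>n\<ge>N. Lnorm L p (\<lambda>x. g m x - g n x) < e) \<and>
         (AE x in L. (\<lambda>n. g n x) \<longlonglongrightarrow> f x)}"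

text \<open>
  The functions \<open>\<E>\<^sub>k\<close> are numbered from \<open>k = 0\<close>, so that the weight of index \<open>k\<close> is \<open>2\<^sup>-\<^sup>(\<^sup>k\<^sup>+\<^sup>1\<^sup>)\<close>.
\<close>

definition jones_F :: "(nat \<Rightarrow> real) measure \<Rightarrow> (nat \<Rightarrow> (nat \<Rightarrow> real) \<Rightarrow> complex) \<Rightarrow>
    nat \<Rightarrow> ((nat \<Rightarrow> real) \<Rightarrow> complex) \<Rightarrow> complex" where
  "jones_F L E k f = (\<integral>x. E k x * f x \<partial>L)"

definition jones_shape :: "((nat \<Rightarrow> real) \<Rightarrow> complex) \<Rightarrow> bool" where
  \<comment> \<open>\<open>e\<close> is built, by some combining function \<open>G\<close>, from functions \<open>\<xi> j\<close> of the single coordinates\<close>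
  "jones_shape e \<longleftrightarrow>
     (\<exists>n\<ge>1. \<exists>(J :: nat \<Rightarrow> real set) (\<xi> :: nat \<Rightarrow> real \<Rightarrow> complex) (G :: (nat \<Rightarrow> complex) \<Rightarrow> complex).
        (\<forall>j<n. is_interval (J j) \<and> bounded (J j)) \<and>
        (\<forall>x\<in>cyl n (Pi\<^sub>E {..<n} J). e x = G (\<lambda>j\<in>{..<n}. \<xi> j (x j)) \<and> cmod (e x) < 1) \<and>
        (\<forall>x. x \<notin> cyl n (Pi\<^sub>E {..<n} J) \<longrightarrow> e x = 0))"

definition is_jones_family ::
    "(nat \<Rightarrow> real) measure \<Rightarrow> (nat \<Rightarrow> (nat \<Rightarrow> real) \<Rightarrow> complex) \<Rightarrow> bool" where
  "is_jones_family L E \<longleftrightarrow>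
     (\<forall>k. jones_shape (E k)) \<and>
     (\<forall>p\<ge>1. \<forall>k. E k \<in> Lp_inf L p) \<and>
     (\<forall>p\<ge>1. \<forall>k. \<forall>f\<in>Lp_inf L p. cmod (jones_F L E k f) \<le> Lnorm L p f) \<and>
     (\<forall>p\<ge>1. \<forall>f\<in>Lp_inf L p. (\<forall>k. jones_F L E k f = 0) \<longrightarrow> (AE x in L. f x = 0))"

definition sd_inner :: "(nat \<Rightarrow> real) measure \<Rightarrow> (nat \<Rightarrow> (nat \<Rightarrow> real) \<Rightarrow> complex) \<Rightarrow>
    ((nat \<Rightarrow> real) \<Rightarrow> complex) \<Rightarrow> ((nat \<Rightarrow> real) \<Rightarrow> complex) \<Rightarrow> complex" where
  "sd_inner L E f g = (\<Sum>k. (1/2) ^ Suc k * jones_F L E k f * cnj (jones_F L E k g))"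

definition sd_norm :: "(nat \<Rightarrow> real) measure \<Rightarrow> (nat \<Rightarrow> (nat \<Rightarrow> real) \<Rightarrow> complex) \<Rightarrow>
    ((nat \<Rightarrow> real) \<Rightarrow> complex) \<Rightarrow> real" where
  "sd_norm L E f = sqrt (Re (sd_inner L E f f))"

text \<open>
  The completion of \<open>L\<^sup>1\<close> for this norm consists of the equivalence classes of Cauchy sequences.
  Distance, vector operations and the functionals \<open>F\<^sub>k\<close> are extended to it by limits of
  representatives.
\<close>

type_synonym sd_class = "(nat \<Rightarrow> (nat \<Rightarrow> real) \<Rightarrow> complex) set"

definition sd_cauchy :: "(nat \<Rightarrow> real) measure \<Rightarrow> (nat \<Rightarrow> (nat \<Rightarrow> real) \<Rightarrow> complex) \<Rightarrow> sd_class" where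
  "sd_cauchy L E = {u. (\<forall>n. u n \<in> Lp_inf L 1) \<and>
     (\<forall>e>0. \<exists>N. \<forall>m\<ge>N. \<forall>n\<ge>N. sd_norm L E (\<lambda>x. u m x - u n x) < e)}"

definition sd_rel :: "(nat \<Rightarrow> real) measure \<Rightarrow> (nat \<Rightarrow> (nat \<Rightarrow> real) \<Rightarrow> complex) \<Rightarrow>
    ((nat \<Rightarrow> (nat \<Rightarrow> real) \<Rightarrow> complex) \<times> (nat \<Rightarrow> (nat \<Rightarrow> real) \<Rightarrow> complex)) set" where
  "sd_rel L E = {(u, v). u \<in> sd_cauchy L E \<and> v \<in> sd_cauchy L E \<and>
     (\<lambda>n. sd_norm L E (\<lambda>x. u n x - v n x)) \<longlonglongrightarrow> 0}"

definition SD2 :: "(nat \<Rightarrow> real) measure \<Rightarrow> (nat \<Rightarrow> (nat \<Rightarrow> real) \<Rightarrow> complex) \<Rightarrow> sd_class set" where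
  "SD2 L E = sd_cauchy L E // sd_rel L E"

text \<open>
  The value 0 outside the carrier is needed because the locale \<open>Metric_space\<close> requires
  nonnegativity and symmetry of the distance for all arguments.
\<close>

definition SD2_dist :: "(nat \<Rightarrow> real) measure \<Rightarrow> (nat \<Rightarrow> (nat \<Rightarrow> real) \<Rightarrow> complex) \<Rightarrow>
    sd_class \<Rightarrow> sd_class \<Rightarrow> real" where
  "SD2_dist L E A B = (if A \<in> SD2 L E \<and> B \<in> SD2 L E
     then THE d. \<forall>u\<in>A. \<forall>v\<in>B. (\<lambda>n. sd_norm L E (\<lambda>x. u n x - v n x)) \<longlonglongrightarrow> d else 0)"

definition SD2_add :: "(nat \<Rightarrow> real) measure \<Rightarrow> (nat \<Rightarrow> (nat \<Rightarrow> real) \<Rightarrow> complex) \<Rightarrow>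
    sd_class \<Rightarrow> sd_class \<Rightarrow> sd_class" where
  "SD2_add L E A B = (\<Union>u\<in>A. \<Union>v\<in>B. sd_rel L E `` {\<lambda>n x. u n x + v n x})"

definition SD2_scale :: "(nat \<Rightarrow> real) measure \<Rightarrow> (nat \<Rightarrow> (nat \<Rightarrow> real) \<Rightarrow> complex) \<Rightarrow>
    complex \<Rightarrow> sd_class \<Rightarrow> sd_class" where
  "SD2_scale L E c A = (\<Union>u\<in>A. sd_rel L E `` {\<lambda>n x. c * u n x})"

definition SD2_F :: "(nat \<Rightarrow> real) measure \<Rightarrow> (nat \<Rightarrow> (nat \<Rightarrow> real) \<Rightarrow> complex) \<Rightarrow>
    nat \<Rightarrow> sd_class \<Rightarrow> complex" where
  "SD2_F L E k A = (THE c. \<forall>u\<in>A. (\<lambda>n. jones_F L E k (u n)) \<longlonglongrightarrow> c)"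

abbreviation SD2_top :: "(nat \<Rightarrow> real) measure \<Rightarrow> (nat \<Rightarrow> (nat \<Rightarrow> real) \<Rightarrow> complex) \<Rightarrow>
    sd_class topology" where
  "SD2_top L E \<equiv> Metric_space.mtopology (SD2 L E) (SD2_dist L E)"

text \<open>
  Dual of a space \<open>V\<close> of complex functions with seminorm \<open>N\<close>. Functionals vanish outside \<open>V\<close>,
  so that each one is represented once. As functionals are again complex functions, the bidual
  is obtained by applying the construction twice.
\<close>

definition dual_space :: "('a \<Rightarrow> complex) set \<Rightarrow> (('a \<Rightarrow> complex) \<Rightarrow> real) \<Rightarrow>
    (('a \<Rightarrow> complex) \<Rightarrow> complex) set" where
  "dual_space V N = {\<phi>.
     (\<forall>f\<in>V. \<forall>g\<in>V. \<phi> (\<lambda>x. f x + g x) = \<phi> f + \<phi> g) \<and>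
     (\<forall>c. \<forall>f\<in>V. \<phi> (\<lambda>x. c * f x) = c * \<phi> f) \<and>
     (\<exists>C. \<forall>f\<in>V. cmod (\<phi> f) \<le> C * N f) \<and>
     (\<forall>f. f \<notin> V \<longrightarrow> \<phi> f = 0)}"

definition dual_norm :: "('a \<Rightarrow> complex) set \<Rightarrow> (('a \<Rightarrow> complex) \<Rightarrow> real) \<Rightarrow>
    (('a \<Rightarrow> complex) \<Rightarrow> complex) \<Rightarrow> real" where
  "dual_norm V N \<phi> = (SUP f\<in>{f \<in> V. N f \<le> 1}. cmod (\<phi> f))"

definition L1_dual :: "(nat \<Rightarrow> real) measure \<Rightarrow> (((nat \<Rightarrow> real) \<Rightarrow> complex) \<Rightarrow> complex) set" where
  "L1_dual L = dual_space (Lp_inf L 1) (Lnorm L 1)"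

definition L1_dual_norm :: "(nat \<Rightarrow> real) measure \<Rightarrow> (((nat \<Rightarrow> real) \<Rightarrow> complex) \<Rightarrow> complex) \<Rightarrow> real" where
  "L1_dual_norm L = dual_norm (Lp_inf L 1) (Lnorm L 1)"

definition FA_measures :: "(nat \<Rightarrow> real) measure \<Rightarrow>
    ((((nat \<Rightarrow> real) \<Rightarrow> complex) \<Rightarrow> complex) \<Rightarrow> complex) set" where
  \<comment> \<open>finitely additive measures, identified with the bidual of \<open>L\<^sup>1\<close>\<close>
  "FA_measures L = dual_space (L1_dual L) (L1_dual_norm L)"

definition FA_norm :: "(nat \<Rightarrow> real) measure \<Rightarrow>
    ((((nat \<Rightarrow> real) \<Rightarrow> complex) \<Rightarrow> complex) \<Rightarrow> complex) \<Rightarrow> real" where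
  "FA_norm L = dual_norm (L1_dual L) (L1_dual_norm L)"

definition FA_F :: "(nat \<Rightarrow> real) measure \<Rightarrow> (nat \<Rightarrow> (nat \<Rightarrow> real) \<Rightarrow> complex) \<Rightarrow>
    nat \<Rightarrow> ((((nat \<Rightarrow> real) \<Rightarrow> complex) \<Rightarrow> complex) \<Rightarrow> complex) \<Rightarrow> complex" where
  \<comment> \<open>\<open>\<mu>(\<E>\<^sub>k)\<close>, where \<open>\<E>\<^sub>k\<close> acts on \<open>L\<^sup>1\<close> by integration\<close>
  "FA_F L E k \<mu> = \<mu> (\<lambda>f. if f \<in> Lp_inf L 1 then jones_F L E k f else 0)"

text \<open>
  The \<open>\<E>\<^sub>k\<close> span a norm-separable, hence proper, closed subspace of the dual of \<open>L\<^sup>1\<close>, so by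
  Hahn-Banach some nonzero elements of the bidual vanish at every \<open>\<E>\<^sub>k\<close>. Finitely additive
  measures can therefore be told apart in the completion only through the sequence of their
  values \<open>\<mu>(\<E>\<^sub>k)\<close>.
\<close>

definition FA_eq :: "(nat \<Rightarrow> real) measure \<Rightarrow> (nat \<Rightarrow> (nat \<Rightarrow> real) \<Rightarrow> complex) \<Rightarrow>
    ((((nat \<Rightarrow> real) \<Rightarrow> complex) \<Rightarrow> complex) \<Rightarrow> complex) \<Rightarrow>
    ((((nat \<Rightarrow> real) \<Rightarrow> complex) \<Rightarrow> complex) \<Rightarrow> complex) \<Rightarrow> bool" where
  "FA_eq L E \<mu> \<nu> \<longleftrightarrow> (\<forall>k. FA_F L E k \<mu> = FA_F L E k \<nu>)"

text \<open>
  For a space \<open>V\<close> with seminorm \<open>N\<close> on which the functionals \<open>F\<^sub>k\<close> act through \<open>\<Phi> k\<close>, the object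
  \<open>v\<close> is identified with the element of the completion that has the same values under all \<open>F\<^sub>k\<close>.
\<close>

definition SD2_elem :: "(nat \<Rightarrow> real) measure \<Rightarrow> (nat \<Rightarrow> (nat \<Rightarrow> real) \<Rightarrow> complex) \<Rightarrow>
    (nat \<Rightarrow> 'v \<Rightarrow> complex) \<Rightarrow> 'v \<Rightarrow> sd_class" where
  "SD2_elem L E \<Phi> v = (THE A. A \<in> SD2 L E \<and> (\<forall>k. SD2_F L E k A = \<Phi> k v))"

text \<open>
  The relation \<open>eq\<close> says which elements of \<open>V\<close> count as equal. The clauses state, in this order:
  every \<open>v\<close> is identified with exactly one element of the completion; the identification is
  injective up to \<open>eq\<close>, linear and continuous; its image is dense; images of bounded sets are
  relatively compact.
\<close>

definition cdc_embedding :: "(nat \<Rightarrow> real) measure \<Rightarrow> (nat \<Rightarrow> (nat \<Rightarrow> real) \<Rightarrow> complex) \<Rightarrow>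
    ('a \<Rightarrow> complex) set \<Rightarrow> (('a \<Rightarrow> complex) \<Rightarrow> real) \<Rightarrow> (('a \<Rightarrow> complex) \<Rightarrow> ('a \<Rightarrow> complex) \<Rightarrow> bool) \<Rightarrow>
    (nat \<Rightarrow> ('a \<Rightarrow> complex) \<Rightarrow> complex) \<Rightarrow> bool" where
  "cdc_embedding L E V N eq \<Phi> \<longleftrightarrow>
     (let J = SD2_elem L E \<Phi> in
       (\<forall>v\<in>V. \<exists>!A. A \<in> SD2 L E \<and> (\<forall>k. SD2_F L E k A = \<Phi> k v)) \<and>
       (\<forall>v\<in>V. \<forall>w\<in>V. J v = J w \<longleftrightarrow> eq v w) \<and>
       (\<forall>v\<in>V. \<forall>w\<in>V. J (\<lambda>x. v x + w x) = SD2_add L E (J v) (J w)) \<and>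
       (\<forall>c. \<forall>v\<in>V. J (\<lambda>x. c * v x) = SD2_scale L E c (J v)) \<and>
       (\<exists>C. \<forall>v\<in>V. \<forall>w\<in>V. SD2_dist L E (J v) (J w) \<le> C * N (\<lambda>x. v x - w x)) \<and>
       SD2_top L E closure_of (J ` V) = SD2 L E \<and>
       (\<forall>B\<subseteq>V. (\<exists>C. \<forall>v\<in>B. N v \<le> C) \<longrightarrow> compactin (SD2_top L E) (SD2_top L E closure_of (J ` B))))"

end

theory Submission
  imports Defs "HOL-Complex_Analysis.Great_Picard"
begin

text \<open>
  The map \<open>f \<mapsto> (F\<^sub>k f)\<^sub>k\<close> identifies the completion with the closure of the image of \<open>L\<^sup>1\<close>
  in the weighted sequence space with norm \<open>(\<Sum>k. 2\<^sup>-\<^sup>k\<^sup>-\<^sup>1 \<bar>a\<^sub>k\<bar>\<^sup>2)\<^sup>1\<^sup>/\<^sup>2\<close>. On bounded sets of either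
  space all the sequences \<open>(F\<^sub>k v)\<^sub>k\<close> are uniformly bounded, and on uniformly bounded sequences
  convergence in the weighted norm is coordinatewise convergence, which gives compactness by a
  diagonal argument. What remains is that each space and \<open>L\<^sup>1\<close> have sequences approximating one
  another. For \<open>L\<^sup>p\<close>, truncated cylinder functions lie in every \<open>L\<^sup>q\<close> and suffice. For
  a bidual element \<open>\<mu>\<close>, take a near-minimiser \<open>f\<close> of the distance from \<open>a = (\<mu> E\<^sub>k)\<^sub>k\<close>
  to the image of \<open>L\<^sup>1\<close>: the residual \<open>b\<close> is almost orthogonal to this image, so the functional
  \<open>g \<mapsto> \<langle>F g, b\<rangle>\<close> on \<open>L\<^sup>1\<close> has small norm, and applying \<open>\<mu>\<close> to it shows that \<open>\<langle>a, b\<rangle>\<close>, hence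
  \<open>\<parallel>b\<parallel>\<^sup>2 = \<langle>a, b\<rangle> - \<langle>F f, b\<rangle>\<close>, is small.
\<close>

subsection \<open>The weighted sequence space\<close>

text \<open>The value of \<open>suminf\<close> on a divergent series is meaningless, so boundedness
  of the sequences is carried as a hypothesis throughout; the functionals provide it, having norm at
  most 1. Over an infinite measure no inclusion between different \<open>L^p\<close> spaces is
  available, and for \<open>p = \<infinity>\<close> truncations need not converge in norm. Neither
  matters: the weighted norm sees only the values of the \<open>F_k\<close>, so convergence of each
  \<open>F_k\<close> under a uniform bound is enough. For the bidual, Goldstine's theorem would
  provide functions that match \<mu> approximately on finitely many \<open>E_k\<close>; the
  near-minimiser replaces it by a computation with inner products. It also replaces the orthogonal
  projection, because the image of \<open>L^1\<close> need not be closed and the distance need not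
  be attained. As \<open>f\<close> is an actual \<open>L^1\<close> function, the residual
  \<open>b\<close> is a bounded sequence, and the functional it defines is a series in the
  \<open>E_k\<close> with geometric tails in the dual norm. This is what allows \<mu>, which is
  merely linear and bounded, to be applied term by term.\<close>

definition wnorm :: "(nat \<Rightarrow> complex) \<Rightarrow> real" where
  "wnorm a = sqrt (\<Sum>k. (1/2) ^ Suc k * (cmod (a k))\<^sup>2)"

lemma summable_half_powers: "summable (\<lambda>k. c * (1/2::real) ^ Suc k)"
  by (intro summable_mult summable_ignore_initial_segment[of _ 1, simplified]) (simp add: summable_geometric)

lemma suminf_half_powers: "(\<Sum>k. (1/2::real) ^ Suc k) = 1"
  using power_half_series by (simp add: sums_iff)

lemma bounded_range_cmod:
  assumes "bounded (range (a :: nat \<Rightarrow> complex))"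
  obtains C where "C \<ge> 0" "\<And>k. cmod (a k) \<le> C"
  using assms unfolding bounded_iff by (metis norm_ge_zero order_trans rangeI)

lemma bounded_rangeI: "(\<And>k. cmod (a k) \<le> C) \<Longrightarrow> bounded (range (a :: nat \<Rightarrow> complex))"
  unfolding bounded_iff by auto

lemma wsummable:
  assumes "bounded (range a)" "bounded (range b)"
  shows "summable (\<lambda>k. (1/2) ^ Suc k * (cmod (a k) * cmod (b k)))"
proof -
  obtain A B where A: "A \<ge> 0" "\<And>k. cmod (a k) \<le> A" and B: "B \<ge> 0" "\<And>k. cmod (b k) \<le> B"
    using assms by (metis bounded_range_cmod)
  have "cmod (a k) * cmod (b k) \<le> A * B" for k
    using A B by (intro mult_mono) auto
  then have "norm ((1/2) ^ Suc k * (cmod (a k) * cmod (b k))) \<le> (A * B) * (1/2) ^ Suc k" for k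
    by (simp add: field_simps)
  then show ?thesis
    by (intro summable_comparison_test'[OF summable_half_powers[of "A * B"], of 0])
qed

lemma wsummable_sq:
  assumes "bounded (range a)"
  shows "summable (\<lambda>k. (1/2) ^ Suc k * (cmod (a k))\<^sup>2)"
  using wsummable[OF assms assms] by (simp add: power2_eq_square)

lemma wsummable_complex:
  fixes a b :: "nat \<Rightarrow> complex"
  assumes "bounded (range a)" "bounded (range b)"
  shows "summable (\<lambda>k. (1/2) ^ Suc k * a k * b k)"
  using wsummable[OF assms]
  by - (rule summable_norm_cancel, simp only: norm_mult norm_power norm_divide norm_one norm_numeral mult.assoc)

lemma bounded_range_diff:
  "bounded (range (a :: nat \<Rightarrow> complex)) \<Longrightarrow> bounded (range b) \<Longrightarrow> bounded (range (\<lambda>k. a k - b k))"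
  by (rule bounded_minus_comp)

lemma bounded_range_add:
  "bounded (range (a :: nat \<Rightarrow> complex)) \<Longrightarrow> bounded (range b) \<Longrightarrow> bounded (range (\<lambda>k. a k + b k))"
  by (rule bounded_plus_comp)

lemma bounded_range_cmult:
  assumes "bounded (range (a :: nat \<Rightarrow> complex))"
  shows "bounded (range (\<lambda>k. c * a k))"
proof -
  obtain A where "\<And>k. cmod (a k) \<le> A" using assms by (metis bounded_range_cmod)
  then show ?thesis by (intro bounded_rangeI[of _ "cmod c * A"]) (simp add: norm_mult mult_left_mono)
qed

lemma bounded_range_cnj:
  assumes "bounded (range (a :: nat \<Rightarrow> complex))"
  shows "bounded (range (\<lambda>k. cnj (a k)))"
  using assms by (metis bounded_range_cmod bounded_rangeI complex_mod_cnj)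

lemma wnorm_nonneg:
  assumes "bounded (range a)"
  shows "wnorm a \<ge> 0"
  unfolding wnorm_def by (intro real_sqrt_ge_zero suminf_nonneg wsummable_sq assms) auto

lemma wnorm_sq:
  assumes "bounded (range a)"
  shows "(wnorm a)\<^sup>2 = (\<Sum>k. (1/2) ^ Suc k * (cmod (a k))\<^sup>2)"
  unfolding wnorm_def by (rule real_sqrt_pow2) (intro suminf_nonneg wsummable_sq assms, auto)

text \<open>Square roots of the weights are moved into the entries, so that \<open>wnorm\<close>
  becomes a limit of finite Euclidean norms and inherits Minkowski's inequality from
  \<open>L2_set\<close>.\<close>

lemma wnorm_partial:
  assumes "bounded (range a)"
  shows "(\<lambda>n. L2_set (\<lambda>k. sqrt ((1/2) ^ Suc k) * cmod (a k)) {..<n}) \<longlonglongrightarrow> wnorm a"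
  unfolding L2_set_def wnorm_def power_mult_distrib
  using summable_LIMSEQ[OF wsummable_sq[OF assms]]
  by (intro tendsto_real_sqrt) simp

lemma wnorm_triangle:
  assumes "bounded (range a)" "bounded (range b)"
  shows "wnorm (\<lambda>k. a k + b k) \<le> wnorm a + wnorm b"
proof (rule LIMSEQ_le[OF wnorm_partial[OF bounded_range_add[OF assms]]
      tendsto_add[OF wnorm_partial[OF assms(1)] wnorm_partial[OF assms(2)]]])
  have "L2_set (\<lambda>k. sqrt ((1/2) ^ Suc k) * cmod (a k + b k)) {..<n} \<le>
      L2_set (\<lambda>k. sqrt ((1/2) ^ Suc k) * cmod (a k) + sqrt ((1/2) ^ Suc k) * cmod (b k)) {..<n}" for n
    unfolding distrib_left[symmetric]
    by (intro L2_set_mono mult_left_mono norm_triangle_ineq) simp_all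
  then show "\<exists>N. \<forall>n\<ge>N. L2_set (\<lambda>k. sqrt ((1/2) ^ Suc k) * cmod (a k + b k)) {..<n} \<le>
     L2_set (\<lambda>k. sqrt ((1/2) ^ Suc k) * cmod (a k)) {..<n} + L2_set (\<lambda>k. sqrt ((1/2) ^ Suc k) * cmod (b k)) {..<n}"
    by (intro exI[of _ 0] allI impI order_trans[OF _ L2_set_triangle_ineq])
qed

lemma wnorm_minus_commute: "wnorm (\<lambda>k. a k - b k) = wnorm (\<lambda>k. b k - a k)"
  by (simp add: wnorm_def norm_minus_commute)

lemma wnorm_triangle3:
  assumes "bounded (range a)" "bounded (range b)" "bounded (range c)"
  shows "wnorm (\<lambda>k. a k - c k) \<le> wnorm (\<lambda>k. a k - b k) + wnorm (\<lambda>k. b k - c k)"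
  using wnorm_triangle[of "\<lambda>k. a k - b k" "\<lambda>k. b k - c k"] assms by (simp add: bounded_range_diff)

lemma wnorm_cmult:
  assumes "bounded (range a)"
  shows "wnorm (\<lambda>k. c * a k) = cmod c * wnorm a"
proof -
  have "wnorm (\<lambda>k. c * a k) = sqrt (\<Sum>k. (cmod c)\<^sup>2 * ((1/2) ^ Suc k * (cmod (a k))\<^sup>2))"
    unfolding wnorm_def by (simp add: norm_mult power_mult_distrib mult_ac)
  also have "\<dots> = cmod c * wnorm a"
    by (subst suminf_mult[OF wsummable_sq[OF assms]]) (simp add: wnorm_def real_sqrt_mult)
  finally show ?thesis .
qed

text \<open>The weights sum to 1, so the sup norm dominates with constant 1. Functionals bounded by
  a seminorm thus give an embedding with Lipschitz constant 1 for that seminorm.\<close>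

lemma wnorm_le:
  assumes "\<And>k. cmod (a k) \<le> C"
  shows "wnorm a \<le> C"
proof -
  have C: "C \<ge> 0" using assms[of 0] norm_ge_zero order_trans by blast
  have "(\<Sum>k. (1/2) ^ Suc k * (cmod (a k))\<^sup>2) \<le> (\<Sum>k. C\<^sup>2 * (1/2) ^ Suc k)"
  proof (intro suminf_le wsummable_sq bounded_rangeI[OF assms] summable_half_powers)
    show "(1/2) ^ Suc k * (cmod (a k))\<^sup>2 \<le> C\<^sup>2 * (1/2) ^ Suc k" for k
      using power_mono[OF assms, of k 2] by (simp add: field_simps)
  qed
  also have "\<dots> = C\<^sup>2"
    using suminf_mult[OF summable_half_powers[of 1, unfolded mult_1], of "C\<^sup>2"] suminf_half_powers by simp
  finally show ?thesis
    unfolding wnorm_def using C real_le_lsqrt by blast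
qed

text \<open>A single term is at most the whole series. The constant grows with \<open>k\<close>:
  convergence in \<open>wnorm\<close> controls each coordinate, but not uniformly.\<close>

lemma cmod_le_wnorm:
  assumes "bounded (range a)"
  shows "cmod (a k) \<le> sqrt (2 ^ Suc k) * wnorm a"
proof -
  have "(\<Sum>j\<in>{k}. (1/2) ^ Suc j * (cmod (a j))\<^sup>2) \<le> (wnorm a)\<^sup>2"
    unfolding wnorm_sq[OF assms] by (intro sum_le_suminf wsummable_sq assms) auto
  then have "(cmod (a k))\<^sup>2 \<le> 2 ^ Suc k * (wnorm a)\<^sup>2"
    by (simp add: field_simps)
  then have "sqrt ((cmod (a k))\<^sup>2) \<le> sqrt (2 ^ Suc k * (wnorm a)\<^sup>2)"
    by (rule real_sqrt_le_mono)
  then show ?thesis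
    by (simp only: real_sqrt_mult real_sqrt_abs abs_norm_cancel abs_of_nonneg[OF wnorm_nonneg[OF assms]])
qed

text \<open>Dominated convergence for series (Tannery), with majorant
  \<open>C\<^sup>2 * (1/2) ^ Suc k\<close>. All the compactness rests on this fact.\<close>

lemma wnorm_dominated:
  assumes "\<And>n k. cmod (a n k) \<le> C" "\<And>k. (\<lambda>n. a n k) \<longlonglongrightarrow> 0"
  shows "(\<lambda>n. wnorm (a n)) \<longlonglongrightarrow> 0"
proof -
  have "(\<lambda>n. \<Sum>k. (1/2) ^ Suc k * (cmod (a n k))\<^sup>2) \<longlonglongrightarrow> (\<Sum>k. 0)"
  proof (rule conjunct2[OF conjunct2[OF tannerys_theorem]])
    show "(\<lambda>n. (1/2::real) ^ Suc k * (cmod (a n k))\<^sup>2) \<longlonglongrightarrow> 0" for k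
      using tendsto_mult[OF tendsto_const[of "(1/2::real) ^ Suc k"] tendsto_power[OF tendsto_norm[OF assms(2)[of k]], of 2]]
      by simp
    have "norm ((1/2::real) ^ Suc k * (cmod (a n k))\<^sup>2) \<le> C\<^sup>2 * (1/2) ^ Suc k" for n k
      using power_mono[OF assms(1), of n k 2] by (simp add: field_simps)
    then show "\<forall>\<^sub>F (k, n) in sequentially \<times>\<^sub>F sequentially.
        norm ((1/2::real) ^ Suc k * (cmod (a n k))\<^sup>2) \<le> C\<^sup>2 * (1/2) ^ Suc k"
      by (intro always_eventually) auto
  qed (auto intro: summable_half_powers)
  then have "(\<lambda>n. wnorm (a n)) \<longlonglongrightarrow> sqrt (\<Sum>k. 0)"
    unfolding wnorm_def by (rule tendsto_real_sqrt)
  then show ?thesis by simp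
qed

text \<open>Representatives of an element of the completion have no common sup bound, so
  \<open>wnorm_dominated\<close> does not apply to them; the Cauchy property takes the place of the
  bound. In a finite partial sum of the Cauchy estimate first \<open>m\<close> tends to infinity,
  then the number \<open>K\<close> of terms.\<close>

lemma wnorm_cauchy_tendsto_0:
  assumes bdd: "\<And>n. bounded (range (a n))"
    and cauchy: "\<And>e. e > 0 \<Longrightarrow> \<exists>N. \<forall>m\<ge>N. \<forall>n\<ge>N. wnorm (\<lambda>k. a m k - a n k) < e"
    and lim: "\<And>k. (\<lambda>n. a n k) \<longlonglongrightarrow> 0"
  shows "(\<lambda>n. wnorm (a n)) \<longlonglongrightarrow> 0"
proof (rule LIMSEQ_I)
  fix e :: real assume "e > 0"
  then obtain N where N: "\<And>m n. m \<ge> N \<Longrightarrow> n \<ge> N \<Longrightarrow> wnorm (\<lambda>k. a m k - a n k) < e / 2"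
    using cauchy[of "e/2"] by auto
  have "wnorm (a n) \<le> e / 2" if "n \<ge> N" for n
  proof (rule LIMSEQ_le_const2[OF wnorm_partial[OF bdd]])
    have "L2_set (\<lambda>k. sqrt ((1/2) ^ Suc k) * cmod (a n k)) {..<K} \<le> e / 2" for K
    proof (rule LIMSEQ_le_const2)
      show "(\<lambda>m. L2_set (\<lambda>k. sqrt ((1/2) ^ Suc k) * cmod (a n k - a m k)) {..<K})
          \<longlonglongrightarrow> L2_set (\<lambda>k. sqrt ((1/2) ^ Suc k) * cmod (a n k)) {..<K}"
        unfolding L2_set_def by (auto intro!: tendsto_eq_intros lim)
      have "L2_set (\<lambda>k. sqrt ((1/2) ^ Suc k) * cmod (a n k - a m k)) {..<K} \<le> wnorm (\<lambda>k. a n k - a m k)" for m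
      proof -
        have "(\<Sum>k<K. (1/2) ^ Suc k * (cmod (a n k - a m k))\<^sup>2) \<le> (\<Sum>k. (1/2) ^ Suc k * (cmod (a n k - a m k))\<^sup>2)"
          by (intro sum_le_suminf wsummable_sq bounded_range_diff bdd) auto
        then show ?thesis
          unfolding L2_set_def wnorm_def by (simp add: power_mult_distrib)
      qed
      then show "\<exists>M. \<forall>m\<ge>M. L2_set (\<lambda>k. sqrt ((1/2) ^ Suc k) * cmod (a n k - a m k)) {..<K} \<le> e / 2"
        using N \<open>n \<ge> N\<close> by (meson less_imp_le order_trans)
    qed
    then show "\<exists>M. \<forall>K\<ge>M. L2_set (\<lambda>k. sqrt ((1/2) ^ Suc k) * cmod (a n k)) {..<K} \<le> e / 2"
      by blast
  qed
  then have "norm (wnorm (a n) - 0) < e" if "n \<ge> N" for n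
    using \<open>e > 0\<close> that wnorm_nonneg[OF bdd, of n] by fastforce
  then show "\<exists>N. \<forall>n\<ge>N. norm (wnorm (a n) - 0) < e"
    by blast
qed

section \<open>The weighted inner product\<close>

definition wip :: "(nat \<Rightarrow> complex) \<Rightarrow> (nat \<Rightarrow> complex) \<Rightarrow> complex" where
  "wip a b = (\<Sum>k. (1/2) ^ Suc k * a k * cnj (b k))"

lemma wip_summable:
  "bounded (range a) \<Longrightarrow> bounded (range b) \<Longrightarrow> summable (\<lambda>k. (1/2) ^ Suc k * a k * cnj (b k))"
  by (intro wsummable_complex bounded_range_cnj)

lemma wip_self:
  assumes "bounded (range a)"
  shows "wip a a = of_real ((wnorm a)\<^sup>2)"
proof -
  have "wip a a = (\<Sum>k. of_real ((1/2) ^ Suc k * (cmod (a k))\<^sup>2))"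
    unfolding wip_def by (intro suminf_cong) (simp only: of_real_mult complex_norm_square mult.assoc, simp)
  also have "\<dots> = of_real ((wnorm a)\<^sup>2)"
    unfolding wnorm_sq[OF assms] by (rule suminf_of_real[symmetric, OF wsummable_sq[OF assms]])
  finally show ?thesis .
qed

lemma wip_diff_left:
  assumes "bounded (range a)" "bounded (range b)" "bounded (range c)"
  shows "wip (\<lambda>k. a k - b k) c = wip a c - wip b c"
  unfolding wip_def suminf_diff[OF wip_summable[OF assms(1,3)] wip_summable[OF assms(2,3)]]
  by (simp only: left_diff_distrib right_diff_distrib)

text \<open>The quadratic in \<open>s\<close> on which the variational argument rests. A complex
  \<open>s\<close> lets the phase of the inner product be cancelled.\<close>

lemma wnorm_sq_diff:
  assumes "bounded (range b)" "bounded (range c)"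
  shows "(wnorm (\<lambda>k. b k - s * c k))\<^sup>2 = (wnorm b)\<^sup>2 - 2 * Re (s * wip c b) + (cmod s)\<^sup>2 * (wnorm c)\<^sup>2"
proof -
  have pt: "(1/2) ^ Suc k * (cmod (b k - s * c k))\<^sup>2 =
      (1/2) ^ Suc k * (cmod (b k))\<^sup>2 - 2 * Re (s * ((1/2) ^ Suc k * c k * cnj (b k))) +
      (cmod s)\<^sup>2 * ((1/2) ^ Suc k * (cmod (c k))\<^sup>2)" for k
  proof -
    have "(cmod (b k - s * c k))\<^sup>2 = (cmod (b k))\<^sup>2 - 2 * Re (s * (c k * cnj (b k))) + (cmod s)\<^sup>2 * (cmod (c k))\<^sup>2"
      unfolding cmod_power2 by (simp add: algebra_simps power2_eq_square)
    moreover have "Re (s * ((1/2) ^ Suc k * c k * cnj (b k))) = (1/2) ^ Suc k * Re (s * (c k * cnj (b k)))"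
    proof -
      have "s * ((1/2) ^ Suc k * c k * cnj (b k)) = of_real ((1/2) ^ Suc k) * (s * (c k * cnj (b k)))"
        by (simp add: mult_ac)
      then show ?thesis
        by (simp only: Re_complex_of_real times_complex.sel Im_complex_of_real mult_zero_left diff_0_right)
    qed
    ultimately show ?thesis
      by (simp only: distrib_left right_diff_distrib mult.left_commute)
  qed
  have s1: "(\<lambda>k. (1/2) ^ Suc k * (cmod (b k))\<^sup>2) sums (wnorm b)\<^sup>2"
    "(\<lambda>k. (cmod s)\<^sup>2 * ((1/2) ^ Suc k * (cmod (c k))\<^sup>2)) sums ((cmod s)\<^sup>2 * (wnorm c)\<^sup>2)"
    using summable_sums[OF wsummable_sq[OF assms(1)]] sums_mult[OF summable_sums[OF wsummable_sq[OF assms(2)]], of "(cmod s)\<^sup>2"]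
    by (simp_all only: wnorm_sq assms)
  have s2: "(\<lambda>k. 2 * Re (s * ((1/2) ^ Suc k * c k * cnj (b k)))) sums (2 * Re (s * wip c b))"
    unfolding wip_def by (intro sums_mult sums_Re summable_sums wip_summable assms)
  show ?thesis
    using sums_add[OF sums_diff[OF s1(1) s2] s1(2)] wnorm_sq[of "\<lambda>k. b k - s * c k"] assms
    unfolding pt[symmetric] by (simp add: sums_iff bounded_range_diff bounded_range_cmult)
qed

subsection \<open>The completion\<close>

text \<open>These facts about \<open>L^1\<close> and the \<open>F_k\<close> carry the whole
  construction of the completion and the embedding criterion \<open>cdc_embeddingI\<close>, which
  then serves the \<open>L^p\<close> spaces and the bidual alike.\<close>

locale sd_space =
  fixes L :: "(nat \<Rightarrow> real) measure" and E :: "nat \<Rightarrow> (nat \<Rightarrow> real) \<Rightarrow> complex"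
  assumes L1_zero: "(\<lambda>x. 0) \<in> Lp_inf L 1"
    and L1_add: "\<And>f g. f \<in> Lp_inf L 1 \<Longrightarrow> g \<in> Lp_inf L 1 \<Longrightarrow> (\<lambda>x. f x + g x) \<in> Lp_inf L 1"
    and L1_scale: "\<And>c f. f \<in> Lp_inf L 1 \<Longrightarrow> (\<lambda>x. c * f x) \<in> Lp_inf L 1"
    and F_add: "\<And>k f g. f \<in> Lp_inf L 1 \<Longrightarrow> g \<in> Lp_inf L 1 \<Longrightarrow>
      jones_F L E k (\<lambda>x. f x + g x) = jones_F L E k f + jones_F L E k g"
    and F_scale: "\<And>k c f. f \<in> Lp_inf L 1 \<Longrightarrow> jones_F L E k (\<lambda>x. c * f x) = c * jones_F L E k f"
    and F_bounded: "\<And>f. f \<in> Lp_inf L 1 \<Longrightarrow> bounded (range (\<lambda>k. jones_F L E k f))"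
begin

abbreviation W where "W \<equiv> Lp_inf L 1"
abbreviation F where "F f \<equiv> (\<lambda>k. jones_F L E k f)"

definition wd :: "((nat \<Rightarrow> real) \<Rightarrow> complex) \<Rightarrow> ((nat \<Rightarrow> real) \<Rightarrow> complex) \<Rightarrow> real" where
  "wd f g = sd_norm L E (\<lambda>x. f x - g x)"

definition cls :: "(nat \<Rightarrow> (nat \<Rightarrow> real) \<Rightarrow> complex) \<Rightarrow> sd_class" where
  "cls u = sd_rel L E `` {u}"

lemma L1_diff: "f \<in> W \<Longrightarrow> g \<in> W \<Longrightarrow> (\<lambda>x. f x - g x) \<in> W"
  using L1_add[of f "\<lambda>x. -1 * g x"] L1_scale[of g "-1"] by simp

lemma F_diff: "f \<in> W \<Longrightarrow> g \<in> W \<Longrightarrow> jones_F L E k (\<lambda>x. f x - g x) = jones_F L E k f - jones_F L E k g"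
  using F_add[of f "\<lambda>x. -1 * g x" k] L1_scale[of g "-1"] F_scale[of g k "-1"] by simp

lemma sd_norm_eq_wnorm:
  assumes "f \<in> W"
  shows "sd_norm L E f = wnorm (F f)"
proof -
  have "sd_inner L E f f = wip (F f) (F f)"
    by (simp add: sd_inner_def wip_def)
  then show ?thesis
    using F_bounded[OF assms] by (simp add: sd_norm_def wip_self wnorm_nonneg)
qed

lemma wd_eq_wnorm: "f \<in> W \<Longrightarrow> g \<in> W \<Longrightarrow> wd f g = wnorm (\<lambda>k. F f k - F g k)"
  unfolding wd_def by (simp add: sd_norm_eq_wnorm L1_diff F_diff)

lemma wd_nonneg: "f \<in> W \<Longrightarrow> g \<in> W \<Longrightarrow> wd f g \<ge> 0"
  by (simp add: wd_eq_wnorm wnorm_nonneg bounded_range_diff F_bounded)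

lemma wd_self: "f \<in> W \<Longrightarrow> wd f f = 0"
  by (simp add: wd_eq_wnorm) (simp add: wnorm_def)

lemma wd_commute: "f \<in> W \<Longrightarrow> g \<in> W \<Longrightarrow> wd f g = wd g f"
  by (simp only: wd_eq_wnorm) (rule wnorm_minus_commute)

lemma wd_triangle: "f \<in> W \<Longrightarrow> g \<in> W \<Longrightarrow> h \<in> W \<Longrightarrow> wd f h \<le> wd f g + wd g h"
  by (simp add: wd_eq_wnorm wnorm_triangle3 F_bounded)

lemma wd_add:
  assumes "f \<in> W" "g \<in> W" "f' \<in> W" "g' \<in> W"
  shows "wd (\<lambda>x. f x + g x) (\<lambda>x. f' x + g' x) \<le> wd f f' + wd g g'"
  using wnorm_triangle[of "\<lambda>k. F f k - F f' k" "\<lambda>k. F g k - F g' k"] assms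
  by (simp add: wd_eq_wnorm L1_add F_add bounded_range_diff F_bounded algebra_simps)

lemma wd_scale: "f \<in> W \<Longrightarrow> g \<in> W \<Longrightarrow> wd (\<lambda>x. c * f x) (\<lambda>x. c * g x) = cmod c * wd f g"
  using wnorm_cmult[of "\<lambda>k. F f k - F g k" c]
  by (simp add: wd_eq_wnorm L1_scale F_scale bounded_range_diff F_bounded right_diff_distrib)

lemma F_diff_le_wd: "f \<in> W \<Longrightarrow> g \<in> W \<Longrightarrow> cmod (F f k - F g k) \<le> sqrt (2 ^ Suc k) * wd f g"
  using cmod_le_wnorm[of "\<lambda>k. F f k - F g k" k] by (simp add: wd_eq_wnorm bounded_range_diff F_bounded)

lemma sd_cauchy_iff:
  "u \<in> sd_cauchy L E \<longleftrightarrow> (\<forall>n. u n \<in> W) \<and> (\<forall>e>0. \<exists>N. \<forall>m\<ge>N. \<forall>n\<ge>N. wd (u m) (u n) < e)"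
  by (simp add: sd_cauchy_def wd_def)

lemma sd_cauchy_L1: "u \<in> sd_cauchy L E \<Longrightarrow> u n \<in> W"
  by (simp add: sd_cauchy_iff)

lemma sd_rel_iff:
  "(u, v) \<in> sd_rel L E \<longleftrightarrow>
    u \<in> sd_cauchy L E \<and> v \<in> sd_cauchy L E \<and> (\<lambda>n. wd (u n) (v n)) \<longlonglongrightarrow> 0"
  by (simp add: sd_rel_def wd_def)

lemma wd_tendsto_0I:
  assumes "\<And>n. f n \<in> W" "\<And>n. g n \<in> W" "\<And>n. wd (f n) (g n) \<le> b n" "b \<longlonglongrightarrow> 0"
  shows "(\<lambda>n. wd (f n) (g n)) \<longlonglongrightarrow> 0"
  by (rule tendsto_sandwich[OF _ _ tendsto_const assms(4)]) (auto intro!: always_eventually wd_nonneg assms)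

lemma sd_cauchy_const: "f \<in> W \<Longrightarrow> (\<lambda>n. f) \<in> sd_cauchy L E"
  by (simp add: sd_cauchy_iff wd_self)

lemma sd_cauchy_add:
  assumes "u \<in> sd_cauchy L E" "v \<in> sd_cauchy L E"
  shows "(\<lambda>n x. u n x + v n x) \<in> sd_cauchy L E"
  unfolding sd_cauchy_iff
proof (intro conjI allI impI)
  show "(\<lambda>x. u n x + v n x) \<in> W" for n
    using assms by (intro L1_add) (auto simp: sd_cauchy_iff)
  fix e :: real assume e: "e > 0"
  obtain M N where "\<And>m n. m \<ge> M \<Longrightarrow> n \<ge> M \<Longrightarrow> wd (u m) (u n) < e / 2"
    "\<And>m n. m \<ge> N \<Longrightarrow> n \<ge> N \<Longrightarrow> wd (v m) (v n) < e / 2"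
    using assms e unfolding sd_cauchy_iff by (meson half_gt_zero)
  then have "wd (\<lambda>x. u m x + v m x) (\<lambda>x. u n x + v n x) < e" if "m \<ge> max M N" "n \<ge> max M N" for m n
    using wd_add[of "u m" "v m" "u n" "v n"] that sd_cauchy_L1[OF assms(1)] sd_cauchy_L1[OF assms(2)]
    by (smt (verit) field_sum_of_halves max.bounded_iff)
  then show "\<exists>N. \<forall>m\<ge>N. \<forall>n\<ge>N. wd (\<lambda>x. u m x + v m x) (\<lambda>x. u n x + v n x) < e"
    by blast
qed

lemma sd_cauchy_scale:
  assumes "u \<in> sd_cauchy L E"
  shows "(\<lambda>n x. c * u n x) \<in> sd_cauchy L E"
  unfolding sd_cauchy_iff
proof (intro conjI allI impI)
  show "(\<lambda>x. c * u n x) \<in> W" for n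
    using assms by (intro L1_scale) (auto simp: sd_cauchy_iff)
  fix e :: real assume e: "e > 0"
  then obtain N where N: "\<And>m n. m \<ge> N \<Longrightarrow> n \<ge> N \<Longrightarrow> wd (u m) (u n) < e / (cmod c + 1)"
    using assms unfolding sd_cauchy_iff by (metis add_nonneg_pos divide_pos_pos norm_ge_zero zero_less_one)
  have "wd (\<lambda>x. c * u m x) (\<lambda>x. c * u n x) < e" if "m \<ge> N" "n \<ge> N" for m n
  proof -
    have "wd (\<lambda>x. c * u m x) (\<lambda>x. c * u n x) \<le> (cmod c + 1) * wd (u m) (u n)"
      using wd_scale[of "u m" "u n" c] sd_cauchy_L1[OF assms] wd_nonneg[of "u m" "u n"]
      by (simp add: distrib_right)
    also have "\<dots> < e"
      using N[OF that] by (subst mult.commute) (simp add: pos_less_divide_eq add_nonneg_pos)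
    finally show ?thesis .
  qed
  then show "\<exists>N. \<forall>m\<ge>N. \<forall>n\<ge>N. wd (\<lambda>x. c * u m x) (\<lambda>x. c * u n x) < e"
    by blast
qed

lemma equiv_sd_rel: "equiv (sd_cauchy L E) (sd_rel L E)"
proof (rule equivI)
  show "sd_rel L E \<subseteq> sd_cauchy L E \<times> sd_cauchy L E"
    by (auto simp: sd_rel_def)
  show "refl_on (sd_cauchy L E) (sd_rel L E)"
    by (auto simp: refl_on_def sd_rel_iff wd_self sd_cauchy_L1)
  show "sym (sd_rel L E)"
    by (auto simp: sym_def sd_rel_iff wd_commute sd_cauchy_L1)
  show "trans (sd_rel L E)"
  proof (rule transI)
    fix u v w assume uv: "(u, v) \<in> sd_rel L E" and vw: "(v, w) \<in> sd_rel L E"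
    have "(\<lambda>n. wd (u n) (w n)) \<longlonglongrightarrow> 0"
    proof (rule wd_tendsto_0I)
      show "wd (u n) (w n) \<le> wd (u n) (v n) + wd (v n) (w n)" for n
        using uv vw by (auto simp: sd_rel_iff intro!: wd_triangle sd_cauchy_L1)
      show "(\<lambda>n. wd (u n) (v n) + wd (v n) (w n)) \<longlonglongrightarrow> 0"
        using uv vw tendsto_add[of "\<lambda>n. wd (u n) (v n)" 0 sequentially "\<lambda>n. wd (v n) (w n)" 0]
        by (auto simp: sd_rel_iff)
    qed (use uv vw in \<open>auto simp: sd_rel_iff sd_cauchy_L1\<close>)
    then show "(u, w) \<in> sd_rel L E"
      using uv vw by (auto simp: sd_rel_iff)
  qed
qed

lemma cls_in_SD2: "u \<in> sd_cauchy L E \<Longrightarrow> cls u \<in> SD2 L E"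
  by (simp add: cls_def SD2_def quotientI)

lemma SD2_cases:
  assumes "A \<in> SD2 L E"
  obtains u where "u \<in> sd_cauchy L E" "A = cls u"
  using assms unfolding SD2_def cls_def by (rule quotientE)

lemma SD2_cases2:
  assumes "A \<in> SD2 L E" "B \<in> SD2 L E"
  obtains u v where "u \<in> sd_cauchy L E" "A = cls u" "v \<in> sd_cauchy L E" "B = cls v"
  by (rule SD2_cases[OF assms(1)], rule SD2_cases[OF assms(2)])

lemma mem_cls_iff: "u \<in> sd_cauchy L E \<Longrightarrow> v \<in> cls u \<longleftrightarrow> v \<in> sd_cauchy L E \<and> (\<lambda>n. wd (u n) (v n)) \<longlonglongrightarrow> 0"
  by (auto simp: cls_def sd_rel_iff)

lemma self_in_cls: "u \<in> sd_cauchy L E \<Longrightarrow> u \<in> cls u"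
  by (simp add: mem_cls_iff wd_self sd_cauchy_L1)

lemma cls_eq_iff:
  "u \<in> sd_cauchy L E \<Longrightarrow> v \<in> sd_cauchy L E \<Longrightarrow> cls u = cls v \<longleftrightarrow> (\<lambda>n. wd (u n) (v n)) \<longlonglongrightarrow> 0"
  unfolding cls_def by (subst eq_equiv_class_iff[OF equiv_sd_rel]) (auto simp: sd_rel_iff)

lemma wd_diff_le:
  assumes "a \<in> W" "b \<in> W" "c \<in> W" "d \<in> W"
  shows "\<bar>wd a b - wd c d\<bar> \<le> wd a c + wd b d"
  using wd_triangle[of a c b] wd_triangle[of c d b] wd_triangle[of c a d] wd_triangle[of a b d]
    wd_commute[of c a] wd_commute[of d b] assms by fastforce

text \<open>This resolves the \<open>THE\<close> in \<open>SD2_dist\<close>. By the quadrangle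
  inequality \<open>wd_diff_le\<close> the distances of representatives form a Cauchy sequence, and
  other representatives change them by a null sequence.\<close>

lemma SD2_dist_cls:
  assumes u: "u \<in> sd_cauchy L E" and v: "v \<in> sd_cauchy L E"
  shows "(\<lambda>n. wd (u n) (v n)) \<longlonglongrightarrow> SD2_dist L E (cls u) (cls v)"
proof -
  note W = sd_cauchy_L1[OF u] sd_cauchy_L1[OF v]
  have "Cauchy (\<lambda>n. wd (u n) (v n))"
  proof (rule CauchyI)
    fix e :: real assume e: "e > 0"
    obtain M N where "\<And>m n. m \<ge> M \<Longrightarrow> n \<ge> M \<Longrightarrow> wd (u m) (u n) < e / 2"
      "\<And>m n. m \<ge> N \<Longrightarrow> n \<ge> N \<Longrightarrow> wd (v m) (v n) < e / 2"
      using u v e unfolding sd_cauchy_iff by (meson half_gt_zero)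
    then have "norm (wd (u m) (v m) - wd (u n) (v n)) < e" if "m \<ge> max M N" "n \<ge> max M N" for m n
      using wd_diff_le[of "u m" "v m" "u n" "v n"] that W
      by (smt (verit) field_sum_of_halves max.bounded_iff real_norm_def)
    then show "\<exists>M. \<forall>m\<ge>M. \<forall>n\<ge>M. norm (wd (u m) (v m) - wd (u n) (v n)) < e"
      by blast
  qed
  then obtain d where d: "(\<lambda>n. wd (u n) (v n)) \<longlonglongrightarrow> d"
    using Cauchy_convergent convergent_def by blast
  have lim: "(\<lambda>n. wd (u' n) (v' n)) \<longlonglongrightarrow> d" if "u' \<in> cls u" "v' \<in> cls v" for u' v'
  proof (rule LIM_zero_cancel, rule Lim_null_comparison)
    have uv': "u' \<in> sd_cauchy L E" "v' \<in> sd_cauchy L E"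
      "(\<lambda>n. wd (u n) (u' n)) \<longlonglongrightarrow> 0" "(\<lambda>n. wd (v n) (v' n)) \<longlonglongrightarrow> 0"
      using that mem_cls_iff u v by auto
    then have "\<bar>wd (u n) (v n) - wd (u' n) (v' n)\<bar> \<le> wd (u n) (u' n) + wd (v n) (v' n)" for n
      by (intro wd_diff_le W sd_cauchy_L1)
    then have "\<bar>wd (u' n) (v' n) - d\<bar> \<le> wd (u n) (u' n) + wd (v n) (v' n) + \<bar>wd (u n) (v n) - d\<bar>" for n
      by (smt (verit))
    then show "\<forall>\<^sub>F n in sequentially. norm (wd (u' n) (v' n) - d) \<le> wd (u n) (u' n) + wd (v n) (v' n) + \<bar>wd (u n) (v n) - d\<bar>"
      by simp
    show "(\<lambda>n. wd (u n) (u' n) + wd (v n) (v' n) + \<bar>wd (u n) (v n) - d\<bar>) \<longlonglongrightarrow> 0"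
      using tendsto_add[OF tendsto_add[OF uv'(3,4)] tendsto_rabs_zero[OF LIM_zero[OF d]]] by simp
  qed
  have "(THE d. \<forall>u'\<in>cls u. \<forall>v'\<in>cls v. (\<lambda>n. sd_norm L E (\<lambda>x. u' n x - v' n x)) \<longlonglongrightarrow> d) = d"
  proof (rule the_equality)
    show "\<forall>u'\<in>cls u. \<forall>v'\<in>cls v. (\<lambda>n. sd_norm L E (\<lambda>x. u' n x - v' n x)) \<longlonglongrightarrow> d"
      using lim by (simp add: wd_def)
  next
    fix d' assume "\<forall>u'\<in>cls u. \<forall>v'\<in>cls v. (\<lambda>n. sd_norm L E (\<lambda>x. u' n x - v' n x)) \<longlonglongrightarrow> d'"
    then have "(\<lambda>n. wd (u n) (v n)) \<longlonglongrightarrow> d'"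
      using self_in_cls u v by (simp add: wd_def)
    then show "d' = d"
      using d LIMSEQ_unique by blast
  qed
  then show ?thesis
    using d by (simp add: SD2_dist_def cls_in_SD2 u v)
qed

text \<open>Likewise for the \<open>THE\<close> in \<open>SD2_F\<close>: each \<open>F_k\<close> is
  Lipschitz for \<open>wd\<close>, so its values along a representative converge, to a limit that
  depends only on the class.\<close>

lemma SD2_F_cls:
  assumes u: "u \<in> sd_cauchy L E"
  shows "(\<lambda>n. F (u n) k) \<longlonglongrightarrow> SD2_F L E k (cls u)"
proof -
  note W = sd_cauchy_L1[OF u]
  have "Cauchy (\<lambda>n. F (u n) k)"
  proof (rule CauchyI)
    fix e :: real assume e: "e > 0"
    obtain N where N: "\<And>m n. m \<ge> N \<Longrightarrow> n \<ge> N \<Longrightarrow> wd (u m) (u n) < e / sqrt (2 ^ Suc k)"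
      using u e unfolding sd_cauchy_iff by (metis divide_pos_pos real_sqrt_gt_0_iff zero_less_numeral zero_less_power)
    have "norm (F (u m) k - F (u n) k) < e" if "m \<ge> N" "n \<ge> N" for m n
      using N[OF that] order_le_less_trans[OF F_diff_le_wd[OF W[of m] W[of n], of k], of e]
      by (simp add: pos_less_divide_eq mult.commute)
    then show "\<exists>M. \<forall>m\<ge>M. \<forall>n\<ge>M. norm (F (u m) k - F (u n) k) < e"
      by blast
  qed
  then obtain c where c: "(\<lambda>n. F (u n) k) \<longlonglongrightarrow> c"
    using Cauchy_convergent convergent_def by blast
  have "(THE c. \<forall>u'\<in>cls u. (\<lambda>n. jones_F L E k (u' n)) \<longlonglongrightarrow> c) = c"
  proof (rule the_equality)
    show "\<forall>u'\<in>cls u. (\<lambda>n. jones_F L E k (u' n)) \<longlonglongrightarrow> c"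
    proof
      fix u' assume "u' \<in> cls u"
      then have u': "u' \<in> sd_cauchy L E" "(\<lambda>n. wd (u n) (u' n)) \<longlonglongrightarrow> 0"
        using mem_cls_iff u by auto
      have "(\<lambda>n. F (u n) k - F (u' n) k) \<longlonglongrightarrow> 0"
      proof (rule Lim_null_comparison)
        show "\<forall>\<^sub>F n in sequentially. norm (F (u n) k - F (u' n) k) \<le> sqrt (2 ^ Suc k) * wd (u n) (u' n)"
          by (intro always_eventually allI F_diff_le_wd W sd_cauchy_L1[OF u'(1)])
        show "(\<lambda>n. sqrt (2 ^ Suc k) * wd (u n) (u' n)) \<longlonglongrightarrow> 0"
          using tendsto_mult_right_zero[OF u'(2)] by blast
      qed
      then show "(\<lambda>n. F (u' n) k) \<longlonglongrightarrow> c"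
        using tendsto_diff[OF c, of "\<lambda>n. F (u n) k - F (u' n) k" 0] by simp
    qed
  qed (use self_in_cls[OF u] c LIMSEQ_unique in blast)
  then show ?thesis
    using c by (simp add: SD2_F_def)
qed

text \<open>The union over all pairs of representatives collapses, since every pair produces the
  same class.\<close>

lemma SD2_add_cls:
  assumes "u \<in> sd_cauchy L E" "v \<in> sd_cauchy L E"
  shows "SD2_add L E (cls u) (cls v) = cls (\<lambda>n x. u n x + v n x)"
proof -
  have "cls (\<lambda>n x. u' n x + v' n x) = cls (\<lambda>n x. u n x + v n x)" if "u' \<in> cls u" "v' \<in> cls v" for u' v'
  proof -
    have uv': "u' \<in> sd_cauchy L E" "v' \<in> sd_cauchy L E"
      "(\<lambda>n. wd (u n) (u' n)) \<longlonglongrightarrow> 0" "(\<lambda>n. wd (v n) (v' n)) \<longlonglongrightarrow> 0"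
      using that mem_cls_iff assms by auto
    have "(\<lambda>n. wd (\<lambda>x. u n x + v n x) (\<lambda>x. u' n x + v' n x)) \<longlonglongrightarrow> 0"
    proof (rule wd_tendsto_0I)
      show "wd (\<lambda>x. u n x + v n x) (\<lambda>x. u' n x + v' n x) \<le> wd (u n) (u' n) + wd (v n) (v' n)" for n
        by (intro wd_add sd_cauchy_L1 assms uv')
      show "(\<lambda>n. wd (u n) (u' n) + wd (v n) (v' n)) \<longlonglongrightarrow> 0"
        using tendsto_add[OF uv'(3,4)] by simp
    qed (intro L1_add sd_cauchy_L1 assms uv')+
    then show ?thesis
      using assms uv' by (subst eq_commute, simp add: cls_eq_iff sd_cauchy_add)
  qed
  then have "SD2_add L E (cls u) (cls v) = (\<Union>u'\<in>cls u. \<Union>v'\<in>cls v. cls (\<lambda>n x. u n x + v n x))"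
    unfolding SD2_add_def cls_def[symmetric] by (intro SUP_cong refl)
  also have "\<dots> = cls (\<lambda>n x. u n x + v n x)"
    using self_in_cls[OF assms(1)] self_in_cls[OF assms(2)] by auto
  finally show ?thesis .
qed

lemma SD2_scale_cls:
  assumes "u \<in> sd_cauchy L E"
  shows "SD2_scale L E c (cls u) = cls (\<lambda>n x. c * u n x)"
proof -
  have "cls (\<lambda>n x. c * u' n x) = cls (\<lambda>n x. c * u n x)" if "u' \<in> cls u" for u'
  proof -
    have u': "u' \<in> sd_cauchy L E" "(\<lambda>n. wd (u n) (u' n)) \<longlonglongrightarrow> 0"
      using that mem_cls_iff assms by auto
    have "(\<lambda>n. wd (\<lambda>x. c * u n x) (\<lambda>x. c * u' n x)) \<longlonglongrightarrow> 0"
      using tendsto_mult_right_zero[OF u'(2), of "cmod c"]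
      by (simp add: wd_scale sd_cauchy_L1 assms u')
    then show ?thesis
      using assms u' by (subst eq_commute, simp add: cls_eq_iff sd_cauchy_scale)
  qed
  then have "SD2_scale L E c (cls u) = (\<Union>u'\<in>cls u. cls (\<lambda>n x. c * u n x))"
    unfolding SD2_scale_def cls_def[symmetric] by (intro SUP_cong refl)
  also have "\<dots> = cls (\<lambda>n x. c * u n x)"
    using self_in_cls[OF assms] by auto
  finally show ?thesis .
qed

text \<open>Coordinatewise limits become limits in \<open>wnorm\<close> because the representative
  is Cauchy. Elements of the completion can therefore be handled through their coordinates whenever
  these are bounded.\<close>

lemma SD2_representative_tendsto:
  assumes u: "u \<in> sd_cauchy L E" and a: "bounded (range a)" and F: "\<And>k. SD2_F L E k (cls u) = a k"
  shows "(\<lambda>n. wnorm (\<lambda>k. F (u n) k - a k)) \<longlonglongrightarrow> 0"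
proof (rule wnorm_cauchy_tendsto_0)
  show "bounded (range (\<lambda>k. F (u n) k - a k))" for n
    by (intro bounded_range_diff F_bounded sd_cauchy_L1[OF u] a)
  show "(\<lambda>n. F (u n) k - a k) \<longlonglongrightarrow> 0" for k
    using SD2_F_cls[OF u, of k] unfolding F by (rule LIM_zero)
  show "\<exists>N. \<forall>m\<ge>N. \<forall>n\<ge>N. wnorm (\<lambda>k. F (u m) k - a k - (F (u n) k - a k)) < e" if "e > 0" for e
    using u that by (simp add: wd_eq_wnorm[OF sd_cauchy_L1[OF u] sd_cauchy_L1[OF u], symmetric] sd_cauchy_iff)
qed

lemma SD2_dist_eq_wnorm:
  assumes A: "A \<in> SD2 L E" "\<And>k. SD2_F L E k A = a k" "bounded (range a)"
    and B: "B \<in> SD2 L E" "\<And>k. SD2_F L E k B = b k" "bounded (range b)"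
  shows "SD2_dist L E A B = wnorm (\<lambda>k. a k - b k)"
proof -
  obtain u v where u: "u \<in> sd_cauchy L E" "A = cls u" and v: "v \<in> sd_cauchy L E" "B = cls v"
    by (rule SD2_cases2[OF A(1) B(1)])
  have lu: "(\<lambda>n. wnorm (\<lambda>k. F (u n) k - a k)) \<longlonglongrightarrow> 0" and lv: "(\<lambda>n. wnorm (\<lambda>k. F (v n) k - b k)) \<longlonglongrightarrow> 0"
    using A(2) B(2) unfolding u v by (intro SD2_representative_tendsto u v A(3) B(3); blast)+
  have "(\<lambda>n. wd (u n) (v n)) \<longlonglongrightarrow> wnorm (\<lambda>k. a k - b k)"
  proof (rule LIM_zero_cancel, rule Lim_null_comparison)
    show "(\<lambda>n. wnorm (\<lambda>k. F (u n) k - a k) + wnorm (\<lambda>k. F (v n) k - b k)) \<longlonglongrightarrow> 0"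
      using tendsto_add[OF lu lv] by simp
    have "\<bar>wd (u n) (v n) - wnorm (\<lambda>k. a k - b k)\<bar> \<le> wnorm (\<lambda>k. F (u n) k - a k) + wnorm (\<lambda>k. F (v n) k - b k)" for n
    proof -
      note W = sd_cauchy_L1[OF u(1), of n] sd_cauchy_L1[OF v(1), of n]
      note bd = F_bounded[OF W(1)] F_bounded[OF W(2)] A(3) B(3)
      have "wnorm (\<lambda>k. F (u n) k - F (v n) k) \<le> wnorm (\<lambda>k. F (u n) k - a k) + wnorm (\<lambda>k. a k - F (v n) k)"
        "wnorm (\<lambda>k. a k - F (v n) k) \<le> wnorm (\<lambda>k. a k - b k) + wnorm (\<lambda>k. b k - F (v n) k)"
        "wnorm (\<lambda>k. a k - b k) \<le> wnorm (\<lambda>k. a k - F (u n) k) + wnorm (\<lambda>k. F (u n) k - b k)"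
        "wnorm (\<lambda>k. F (u n) k - b k) \<le> wnorm (\<lambda>k. F (u n) k - F (v n) k) + wnorm (\<lambda>k. F (v n) k - b k)"
        using bd by (auto intro: wnorm_triangle3)
      then show ?thesis
        unfolding wd_eq_wnorm[OF W]
        using wnorm_minus_commute[of "F (u n)" a] wnorm_minus_commute[of "F (v n)" b] by linarith
    qed
    then show "\<forall>\<^sub>F n in sequentially. norm (wd (u n) (v n) - wnorm (\<lambda>k. a k - b k)) \<le>
        wnorm (\<lambda>k. F (u n) k - a k) + wnorm (\<lambda>k. F (v n) k - b k)"
      by simp
  qed
  then show ?thesis
    using SD2_dist_cls[OF u(1) v(1)] u v LIMSEQ_unique by blast
qed

lemma SD2_dist_commute:
  assumes "A \<in> SD2 L E" "B \<in> SD2 L E"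
  shows "SD2_dist L E A B = SD2_dist L E B A"
proof -
  obtain u v where u: "u \<in> sd_cauchy L E" "A = cls u" and v: "v \<in> sd_cauchy L E" "B = cls v"
    by (rule SD2_cases2[OF assms])
  have "(\<lambda>n. wd (u n) (v n)) = (\<lambda>n. wd (v n) (u n))"
    using u v by (intro ext wd_commute sd_cauchy_L1)
  then show ?thesis
    using SD2_dist_cls[OF u(1) v(1)] SD2_dist_cls[OF v(1) u(1)] unfolding u(2) v(2) by (auto intro: LIMSEQ_unique)
qed

sublocale M: Metric_space "SD2 L E" "SD2_dist L E"
proof
  fix A B C
  show "SD2_dist L E A B \<ge> 0"
  proof (cases "A \<in> SD2 L E \<and> B \<in> SD2 L E")
    case True
    obtain u v where u: "u \<in> sd_cauchy L E" "A = cls u" and v: "v \<in> sd_cauchy L E" "B = cls v"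
      by (rule SD2_cases2[OF conjunct1[OF True] conjunct2[OF True]])
    show ?thesis
      unfolding u v
      by (rule LIMSEQ_le_const[OF SD2_dist_cls[OF u(1) v(1)]]) (auto intro!: wd_nonneg sd_cauchy_L1 u v)
  next
    case False
    then show ?thesis by (auto simp: SD2_dist_def)
  qed
  show "SD2_dist L E A B = SD2_dist L E B A"
    using SD2_dist_commute by (cases "A \<in> SD2 L E \<and> B \<in> SD2 L E") (auto simp: SD2_dist_def)
  show "SD2_dist L E A B = 0 \<longleftrightarrow> A = B" if AB: "A \<in> SD2 L E" "B \<in> SD2 L E"
  proof -
    obtain u v where u: "u \<in> sd_cauchy L E" "A = cls u" and v: "v \<in> sd_cauchy L E" "B = cls v"
      by (rule SD2_cases2[OF AB])
    show ?thesis
      unfolding u v cls_eq_iff[OF u(1) v(1)] using SD2_dist_cls[OF u(1) v(1)] LIMSEQ_unique by auto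
  qed
  show "SD2_dist L E A C \<le> SD2_dist L E A B + SD2_dist L E B C"
    if AB: "A \<in> SD2 L E" "B \<in> SD2 L E" "C \<in> SD2 L E"
  proof -
    obtain u v where u: "u \<in> sd_cauchy L E" "A = cls u" and v: "v \<in> sd_cauchy L E" "B = cls v"
      by (rule SD2_cases2[OF AB(1,2)])
    obtain w where w: "w \<in> sd_cauchy L E" "C = cls w"
      by (rule SD2_cases[OF AB(3)])
    have "\<exists>N. \<forall>n\<ge>N. wd (u n) (w n) \<le> wd (u n) (v n) + wd (v n) (w n)"
      by (auto intro!: wd_triangle sd_cauchy_L1 u v w)
    then show ?thesis
      unfolding u v w
      using LIMSEQ_le[OF SD2_dist_cls[OF u(1) w(1)] tendsto_add[OF SD2_dist_cls[OF u(1) v(1)] SD2_dist_cls[OF v(1) w(1)]]]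
      by blast
  qed
qed

text \<open>Uniqueness in the identification through the \<open>F_k\<close>: equal coordinates give
  distance \<open>wnorm\<close> of the zero sequence, and the distance separates points.\<close>

lemma SD2_unique:
  assumes "A \<in> SD2 L E" "B \<in> SD2 L E" "\<And>k. SD2_F L E k A = a k" "\<And>k. SD2_F L E k B = a k" "bounded (range a)"
  shows "A = B"
proof -
  have "SD2_dist L E A B = wnorm (\<lambda>k. a k - a k)"
    by (intro SD2_dist_eq_wnorm assms)
  then show ?thesis
    using M.zero assms(1,2) by (simp add: wnorm_def)
qed

text \<open>Existence in the identification: functions within \<open>1 / Suc n\<close> of
  \<open>a\<close> form a Cauchy sequence by the triangle inequality through \<open>a\<close>, and
  their class has the coordinates \<open>a k\<close>.\<close>

lemma SD2_exists:
  assumes a: "bounded (range a)" and approx: "\<And>e. e > 0 \<Longrightarrow> \<exists>f\<in>W. wnorm (\<lambda>k. F f k - a k) < e"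
  shows "\<exists>A\<in>SD2 L E. \<forall>k. SD2_F L E k A = a k"
proof -
  obtain u where u: "\<And>n. u n \<in> W" "\<And>n. wnorm (\<lambda>k. F (u n) k - a k) < 1 / real (Suc n)"
    using approx[of "1 / real (Suc n)" for n] by (metis of_nat_0_less_iff zero_less_Suc zero_less_divide_1_iff)
  have bd: "bounded (range (\<lambda>k. F (u n) k - a k))" for n
    by (intro bounded_range_diff F_bounded u a)
  have wd: "wd (u m) (u n) < 1 / real (Suc m) + 1 / real (Suc n)" for m n
    using wnorm_triangle3[OF F_bounded[OF u(1)] a F_bounded[OF u(1)], of m n]
      u(2)[of m] u(2)[of n] wnorm_minus_commute[of a "F (u n)"]
    by (simp add: wd_eq_wnorm u)
  have cauchy: "u \<in> sd_cauchy L E"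
    unfolding sd_cauchy_iff
  proof (intro conjI allI impI u)
    fix e :: real assume "e > 0"
    then obtain N where N: "1 / real (Suc N) < e / 2"
      using reals_Archimedean[of "e/2"] by (auto simp: inverse_eq_divide)
    have "wd (u m) (u n) < e" if "m \<ge> N" "n \<ge> N" for m n
    proof -
      have "1 / real (Suc m) \<le> 1 / real (Suc N)" "1 / real (Suc n) \<le> 1 / real (Suc N)"
        using that by (simp_all add: frac_le)
      then show ?thesis using N wd[of m n] by linarith
    qed
    then show "\<exists>N. \<forall>m\<ge>N. \<forall>n\<ge>N. wd (u m) (u n) < e" by blast
  qed
  have "SD2_F L E k (cls u) = a k" for k
  proof (rule LIMSEQ_unique[OF SD2_F_cls[OF cauchy]], rule LIM_zero_cancel, rule Lim_null_comparison)
    have "cmod (F (u n) k - a k) \<le> sqrt (2 ^ Suc k) * (1 / real (Suc n))" for n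
      by (rule order_trans[OF cmod_le_wnorm[OF bd] mult_left_mono]) (use u(2)[of n] in auto)
    then show "\<forall>\<^sub>F n in sequentially. norm (F (u n) k - a k) \<le> sqrt (2 ^ Suc k) * (1 / real (Suc n))"
      by simp
    show "(\<lambda>n. sqrt (2 ^ Suc k) * (1 / real (Suc n))) \<longlonglongrightarrow> 0"
      by (intro tendsto_mult_right_zero LIMSEQ_inverse_real_of_nat[unfolded inverse_eq_divide])
  qed
  then show ?thesis
    using cls_in_SD2[OF cauchy] by blast
qed

lemma SD2_const_dense:
  assumes "A \<in> SD2 L E" "e > 0"
  obtains f where "f \<in> W" "SD2_dist L E A (cls (\<lambda>n. f)) < e"
proof -
  obtain u where u: "u \<in> sd_cauchy L E" "A = cls u"
    by (rule SD2_cases[OF assms(1)])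
  obtain N where N: "\<And>m n. m \<ge> N \<Longrightarrow> n \<ge> N \<Longrightarrow> wd (u m) (u n) < e / 2"
    using u assms(2) unfolding sd_cauchy_iff by (meson half_gt_zero)
  note uN = sd_cauchy_L1[OF u(1), of N]
  have "SD2_dist L E A (cls (\<lambda>n. u N)) \<le> e / 2"
    unfolding u(2)
    by (rule LIMSEQ_le_const2[OF SD2_dist_cls[OF u(1) sd_cauchy_const[OF uN]]])
      (intro exI[of _ N] allI impI less_imp_le[OF N], simp_all)
  then show ?thesis
    using that[OF uN] assms(2) by linarith
qed

text \<open>Each class is replaced by the class of one function at distance below
  \<open>1 / Suc n\<close>. These functions form a Cauchy sequence, and its class is the limit.
  Completeness is what turns total boundedness into relative compactness later.\<close>

lemma SD2_mcomplete: "M.mcomplete"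
  unfolding M.mcomplete_def
proof (intro allI impI)
  fix \<sigma> assume \<sigma>: "M.MCauchy \<sigma>"
  then have \<sigma>_in: "\<sigma> n \<in> SD2 L E" for n
    by (auto simp: M.MCauchy_def)
  obtain f where f: "\<And>n. f n \<in> W" "\<And>n. SD2_dist L E (\<sigma> n) (cls (\<lambda>_. f n)) < 1 / real (Suc n)"
  proof -
    have "\<exists>g\<in>W. SD2_dist L E (\<sigma> n) (cls (\<lambda>_. g)) < 1 / real (Suc n)" for n
      by (rule SD2_const_dense[OF \<sigma>_in, of "1 / real (Suc n)" n]) auto
    then show ?thesis using that by metis
  qed
  have c_in: "cls (\<lambda>_. f n) \<in> SD2 L E" for n
    by (intro cls_in_SD2 sd_cauchy_const f)
  \<comment> \<open>For constant representatives the limit that defines the distance is attained at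
    once.\<close>
  have wd: "wd (f m) (f n) = SD2_dist L E (cls (\<lambda>_. f m)) (cls (\<lambda>_. f n))" for m n
    using SD2_dist_cls[OF sd_cauchy_const sd_cauchy_const, OF f(1) f(1), of m n] LIMSEQ_const_iff by blast
  have small: "\<exists>N. \<forall>n\<ge>N. 1 / real (Suc n) < e" if e: "e > 0" for e :: real
  proof -
    obtain N where N: "1 / real (Suc N) < e"
      using reals_Archimedean[OF e] by (auto simp: inverse_eq_divide)
    have "1 / real (Suc n) \<le> 1 / real (Suc N)" if "n \<ge> N" for n
      using that by (simp add: frac_le)
    then show ?thesis using N by (meson order_le_less_trans)
  qed
  have cauchy: "f \<in> sd_cauchy L E"
    unfolding sd_cauchy_iff
  proof (intro conjI allI impI f)
    fix e :: real assume "e > 0"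
    then obtain N1 N2 where N: "\<And>m n. m \<ge> N1 \<Longrightarrow> n \<ge> N1 \<Longrightarrow> SD2_dist L E (\<sigma> m) (\<sigma> n) < e / 3"
      "\<And>n. n \<ge> N2 \<Longrightarrow> 1 / real (Suc n) < e / 3"
      using \<sigma> small[of "e/3"] unfolding M.MCauchy_def by (metis divide_pos_pos zero_less_numeral)
    have "wd (f m) (f n) < e" if "m \<ge> max N1 N2" "n \<ge> max N1 N2" for m n
    proof -
      have "wd (f m) (f n) \<le> SD2_dist L E (\<sigma> m) (cls (\<lambda>_. f m)) + SD2_dist L E (\<sigma> m) (\<sigma> n) + SD2_dist L E (\<sigma> n) (cls (\<lambda>_. f n))"
        unfolding wd
        using M.triangle[OF c_in[of m] \<sigma>_in[of m] c_in[of n]] M.triangle[OF \<sigma>_in[of m] \<sigma>_in[of n] c_in[of n]]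
          M.commute[of "cls (\<lambda>_. f m)" "\<sigma> m"] by linarith
      then show ?thesis
        using f(2)[of m] f(2)[of n] N(1)[of m n] N(2)[of m] N(2)[of n] that by simp
    qed
    then show "\<exists>N. \<forall>m\<ge>N. \<forall>n\<ge>N. wd (f m) (f n) < e" by blast
  qed
  have "(\<lambda>n. SD2_dist L E (\<sigma> n) (cls f)) \<longlonglongrightarrow> 0"
  proof (rule LIMSEQ_I)
    fix e :: real assume "e > 0"
    then obtain N1 N2 where N: "\<And>m n. m \<ge> N1 \<Longrightarrow> n \<ge> N1 \<Longrightarrow> wd (f m) (f n) < e / 2"
      "\<And>n. n \<ge> N2 \<Longrightarrow> 1 / real (Suc n) < e / 2"
      using cauchy small[of "e/2"] unfolding sd_cauchy_iff by (meson half_gt_zero)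
    have "norm (SD2_dist L E (\<sigma> n) (cls f) - 0) < e" if "n \<ge> max N1 N2" for n
    proof -
      have "SD2_dist L E (cls (\<lambda>_. f n)) (cls f) \<le> e / 2"
        by (rule LIMSEQ_le_const2[OF SD2_dist_cls[OF sd_cauchy_const[OF f(1)] cauchy]])
          (intro exI[of _ N1] allI impI less_imp_le[OF N(1)], use that in auto)
      then show ?thesis
        using M.triangle[OF \<sigma>_in c_in cls_in_SD2[OF cauchy], of n n] f(2)[of n] N(2)[of n] that by simp
    qed
    then show "\<exists>N. \<forall>n\<ge>N. norm (SD2_dist L E (\<sigma> n) (cls f) - 0) < e" by blast
  qed
  then show "\<exists>A. limitin M.mtopology \<sigma> A sequentially"
    unfolding M.limitin_metric_dist_null using \<sigma>_in cls_in_SD2[OF cauchy] by (intro exI[of _ "cls f"]) simp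
qed

section \<open>Linear operations in coordinates, and a criterion for compact dense
  embeddings\<close>

lemma SD2_elem_add:
  assumes A: "A \<in> SD2 L E" "\<And>k. SD2_F L E k A = a k" and B: "B \<in> SD2 L E" "\<And>k. SD2_F L E k B = b k"
  shows "SD2_add L E A B \<in> SD2 L E" "SD2_F L E k (SD2_add L E A B) = a k + b k"
proof -
  obtain u v where u: "u \<in> sd_cauchy L E" "A = cls u" and v: "v \<in> sd_cauchy L E" "B = cls v"
    by (rule SD2_cases2[OF A(1) B(1)])
  note uv = sd_cauchy_add[OF u(1) v(1)]
  show "SD2_add L E A B \<in> SD2 L E"
    unfolding u v SD2_add_cls[OF u(1) v(1)] by (rule cls_in_SD2[OF uv])
  have "(\<lambda>n. F (u n) k + F (v n) k) \<longlonglongrightarrow> SD2_F L E k (cls (\<lambda>n x. u n x + v n x))"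
    using SD2_F_cls[OF uv, of k] by (simp add: F_add sd_cauchy_L1 u v)
  moreover have "(\<lambda>n. F (u n) k + F (v n) k) \<longlonglongrightarrow> a k + b k"
    using tendsto_add[OF SD2_F_cls[OF u(1), of k] SD2_F_cls[OF v(1), of k]] A(2) B(2) u v by simp
  ultimately show "SD2_F L E k (SD2_add L E A B) = a k + b k"
    unfolding u v SD2_add_cls[OF u(1) v(1)] using LIMSEQ_unique by blast
qed

lemma SD2_elem_scale:
  assumes A: "A \<in> SD2 L E" "\<And>k. SD2_F L E k A = a k"
  shows "SD2_scale L E c A \<in> SD2 L E" "SD2_F L E k (SD2_scale L E c A) = c * a k"
proof -
  obtain u where u: "u \<in> sd_cauchy L E" "A = cls u"
    by (rule SD2_cases[OF A(1)])
  note cu = sd_cauchy_scale[OF u(1), of c]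
  show "SD2_scale L E c A \<in> SD2 L E"
    unfolding u SD2_scale_cls[OF u(1)] by (rule cls_in_SD2[OF cu])
  have "(\<lambda>n. c * F (u n) k) \<longlonglongrightarrow> SD2_F L E k (cls (\<lambda>n x. c * u n x))"
    using SD2_F_cls[OF cu, of k] by (simp add: F_scale sd_cauchy_L1 u)
  moreover have "(\<lambda>n. c * F (u n) k) \<longlonglongrightarrow> c * a k"
    using tendsto_mult_left[OF SD2_F_cls[OF u(1), of k], of c] A(2) u by simp
  ultimately show "SD2_F L E k (SD2_scale L E c A) = c * a k"
    unfolding u SD2_scale_cls[OF u(1)] using LIMSEQ_unique by blast
qed

text \<open>The two approximation hypotheses do separate work: \<open>approx\<close> places each
  \<open>v\<close> in the completion, \<open>dense\<close> makes the image dense. The bound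
  \<open>\<Phi>_le\<close> yields continuity and, on sets bounded for \<open>N\<close>, the uniform
  bound on coordinates from which compactness follows.\<close>

theorem cdc_embeddingI:
  fixes V :: "('b \<Rightarrow> complex) set" and N :: "('b \<Rightarrow> complex) \<Rightarrow> real"
    and \<Phi> :: "nat \<Rightarrow> ('b \<Rightarrow> complex) \<Rightarrow> complex"
  assumes add: "\<And>v w. v \<in> V \<Longrightarrow> w \<in> V \<Longrightarrow> (\<lambda>x. v x + w x) \<in> V"
    and scale: "\<And>c v. v \<in> V \<Longrightarrow> (\<lambda>x. c * v x) \<in> V"
    and \<Phi>_add: "\<And>k v w. v \<in> V \<Longrightarrow> w \<in> V \<Longrightarrow> \<Phi> k (\<lambda>x. v x + w x) = \<Phi> k v + \<Phi> k w"
    and \<Phi>_scale: "\<And>k c v. v \<in> V \<Longrightarrow> \<Phi> k (\<lambda>x. c * v x) = c * \<Phi> k v"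
    and \<Phi>_le: "\<And>k v. v \<in> V \<Longrightarrow> cmod (\<Phi> k v) \<le> N v"
    and eq: "\<And>v w. v \<in> V \<Longrightarrow> w \<in> V \<Longrightarrow> eq v w \<longleftrightarrow> (\<forall>k. \<Phi> k v = \<Phi> k w)"
    and approx: "\<And>v e. v \<in> V \<Longrightarrow> e > 0 \<Longrightarrow> \<exists>f\<in>W. wnorm (\<lambda>k. F f k - \<Phi> k v) < e"
    and dense: "\<And>f e. f \<in> W \<Longrightarrow> e > 0 \<Longrightarrow> \<exists>v\<in>V. wnorm (\<lambda>k. F f k - \<Phi> k v) < e"
  shows "cdc_embedding L E V N eq \<Phi>"
proof -
  define J where "J = SD2_elem L E \<Phi>"
  have bdd: "bounded (range (\<lambda>k. \<Phi> k v))" if "v \<in> V" for v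
    using \<Phi>_le[OF that] by (rule bounded_rangeI)
  have ex1: "\<exists>!A. A \<in> SD2 L E \<and> (\<forall>k. SD2_F L E k A = \<Phi> k v)" if v: "v \<in> V" for v
  proof (rule ex_ex1I)
    show "\<exists>A. A \<in> SD2 L E \<and> (\<forall>k. SD2_F L E k A = \<Phi> k v)"
      using SD2_exists[OF bdd[OF v] approx[OF v]] by blast
  next
    fix A B
    assume "A \<in> SD2 L E \<and> (\<forall>k. SD2_F L E k A = \<Phi> k v)" "B \<in> SD2 L E \<and> (\<forall>k. SD2_F L E k B = \<Phi> k v)"
    then show "A = B"
      by (intro SD2_unique[OF _ _ _ _ bdd[OF v]]) auto
  qed
  have J: "J v \<in> SD2 L E" "SD2_F L E k (J v) = \<Phi> k v" if "v \<in> V" for v k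
    using theI'[OF ex1[OF that]] unfolding J_def SD2_elem_def by auto
  have J_eqI: "J v = A" if "v \<in> V" "A \<in> SD2 L E" "\<And>k. SD2_F L E k A = \<Phi> k v" for v A
    using SD2_unique[OF J(1)[OF that(1)] that(2) J(2)[OF that(1)] that(3) bdd[OF that(1)]] .
  have dist: "SD2_dist L E (J v) (J w) = wnorm (\<lambda>k. \<Phi> k v - \<Phi> k w)" if "v \<in> V" "w \<in> V" for v w
    by (intro SD2_dist_eq_wnorm J bdd that)
  have inj: "J v = J w \<longleftrightarrow> eq v w" if "v \<in> V" "w \<in> V" for v w
    unfolding eq[OF that] using J_eqI[OF that(1) J(1)[OF that(2)]] J(2) that by metis
  have J_add: "J (\<lambda>x. v x + w x) = SD2_add L E (J v) (J w)" if "v \<in> V" "w \<in> V" for v w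
    using that by (intro J_eqI add SD2_elem_add(1)[OF J J])
      (auto simp: \<Phi>_add SD2_elem_add(2)[OF J J])
  have J_scale: "J (\<lambda>x. c * v x) = SD2_scale L E c (J v)" if "v \<in> V" for c v
    using that by (intro J_eqI scale SD2_elem_scale(1)[OF J])
      (auto simp: \<Phi>_scale SD2_elem_scale(2)[OF J])
  have cont: "SD2_dist L E (J v) (J w) \<le> 1 * N (\<lambda>x. v x - w x)" if "v \<in> V" "w \<in> V" for v w
  proof -
    have w: "(\<lambda>x. -1 * w x) \<in> V"
      using scale[OF that(2)] .
    have "cmod (\<Phi> k v - \<Phi> k w) \<le> N (\<lambda>x. v x - w x)" for k
      using \<Phi>_le[OF add[OF that(1) w], of k] \<Phi>_add[OF that(1) w, of k] \<Phi>_scale[OF that(2), of k "-1"] by simp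
    then show ?thesis
      unfolding dist[OF that] by (simp add: wnorm_le)
  qed
  have J_dense: "M.mtopology closure_of (J ` V) = SD2 L E"
    unfolding M.metric_closure_of
  proof (intro equalityI subsetI CollectI conjI allI impI)
    fix A r assume A: "A \<in> SD2 L E" and r: "(r::real) > 0"
    obtain f where f: "f \<in> W" "SD2_dist L E A (cls (\<lambda>n. f)) < r / 2"
      by (rule SD2_const_dense[OF A half_gt_zero[OF r]])
    obtain v where v: "v \<in> V" "wnorm (\<lambda>k. F f k - \<Phi> k v) < r / 2"
      using dense[OF f(1) half_gt_zero[OF r]] by blast
    have c: "cls (\<lambda>n. f) \<in> SD2 L E"
      by (intro cls_in_SD2 sd_cauchy_const f)
    have "SD2_F L E k (cls (\<lambda>n. f)) = F f k" for k
      using SD2_F_cls[OF sd_cauchy_const[OF f(1)], of k] LIMSEQ_const_iff by metis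
    then have "SD2_dist L E (cls (\<lambda>n. f)) (J v) = wnorm (\<lambda>k. F f k - \<Phi> k v)"
      by (intro SD2_dist_eq_wnorm c J v bdd F_bounded f)
    then have "SD2_dist L E A (J v) < r"
      using M.triangle[OF A c J(1)[OF v(1)]] f(2) v(2) by linarith
    then show "\<exists>B\<in>J ` V. B \<in> M.mball A r"
      using A J(1)[OF v(1)] v(1) by auto
  qed auto
  have J_compact: "compactin M.mtopology (M.mtopology closure_of (J ` B))"
    if B: "B \<subseteq> V" and C: "\<And>v. v \<in> B \<Longrightarrow> N v \<le> C" for B C
  proof -
    have "M.mtotally_bounded (J ` B)"
      unfolding M.mtotally_bounded_sequentially
    proof (intro conjI allI impI)
      show "J ` B \<subseteq> SD2 L E" using J B by auto
      fix \<sigma> :: "nat \<Rightarrow> sd_class" assume "range \<sigma> \<subseteq> J ` B"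
      then have "\<forall>n. \<exists>v. v \<in> B \<and> \<sigma> n = J v" by auto
      then obtain v where v: "\<And>n. v n \<in> B" "\<And>n. \<sigma> n = J (v n)" by metis
      have vV: "v n \<in> V" for n using v B by auto
      have le: "cmod (\<Phi> k (v n)) \<le> C" for n k
        using \<Phi>_le[OF vV] C[OF v(1)] order_trans by blast
      \<comment> \<open>The diagonal argument: each \<open>v n\<close> is read as the bounded
        function \<open>k \<mapsto> \<Phi> k (v n)\<close> on the countable set of indices.\<close>
      obtain r where r: "strict_mono (r :: nat \<Rightarrow> nat)" "\<And>k. k \<in> UNIV \<Longrightarrow> \<exists>l. (\<lambda>n. \<Phi> k (v (r n))) \<longlonglongrightarrow> l"
        by (rule function_convergent_subsequence[of "UNIV :: nat set" "\<lambda>n k. \<Phi> k (v n)" C])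
          (simp_all add: le)
      then obtain l where l: "\<And>k. (\<lambda>n. \<Phi> k (v (r n))) \<longlonglongrightarrow> l k"
        by (metis UNIV_I)
      have l_le: "cmod (l k) \<le> C" for k
        by (rule LIMSEQ_le_const2[OF tendsto_norm[OF l]]) (auto simp: le)
      have lim: "(\<lambda>n. wnorm (\<lambda>k. \<Phi> k (v (r n)) - l k)) \<longlonglongrightarrow> 0"
      proof (rule wnorm_dominated)
        show "cmod (\<Phi> k (v (r n)) - l k) \<le> C + C" for n k
          by (rule order_trans[OF norm_triangle_ineq4 add_mono[OF le l_le]])
        show "(\<lambda>n. \<Phi> k (v (r n)) - l k) \<longlonglongrightarrow> 0" for k
          by (rule LIM_zero[OF l])
      qed
      \<comment> \<open>The limit \<open>l\<close> need not be the coordinate sequence of any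
        element of \<open>V\<close>; total boundedness asks only for a Cauchy subsequence.\<close>
      have "M.MCauchy (\<sigma> \<circ> r)"
        unfolding M.MCauchy_def
      proof (intro conjI allI impI)
        show "range (\<sigma> \<circ> r) \<subseteq> SD2 L E" using v J vV by auto
        fix e :: real assume "e > 0"
        then obtain K where K: "\<And>n. n \<ge> K \<Longrightarrow> wnorm (\<lambda>k. \<Phi> k (v (r n)) - l k) < e / 2"
          using order_tendstoD(2)[OF lim, of "e/2"] by (auto simp: eventually_sequentially)
        have "SD2_dist L E ((\<sigma> \<circ> r) m) ((\<sigma> \<circ> r) n) < e" if "m \<ge> K" "n \<ge> K" for m n
        proof -
          have "SD2_dist L E ((\<sigma> \<circ> r) m) ((\<sigma> \<circ> r) n) = wnorm (\<lambda>k. \<Phi> k (v (r m)) - \<Phi> k (v (r n)))"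
            by (simp add: v dist vV)
          also have "\<dots> \<le> wnorm (\<lambda>k. \<Phi> k (v (r m)) - l k) + wnorm (\<lambda>k. l k - \<Phi> k (v (r n)))"
            by (intro wnorm_triangle3 bdd vV bounded_rangeI[OF l_le])
          also have "\<dots> < e"
            using K[OF that(1)] K[OF that(2)] wnorm_minus_commute[of l "\<lambda>k. \<Phi> k (v (r n))"] by linarith
          finally show ?thesis .
        qed
        then show "\<exists>K. \<forall>m n. K \<le> m \<longrightarrow> K \<le> n \<longrightarrow> SD2_dist L E ((\<sigma> \<circ> r) m) ((\<sigma> \<circ> r) n) < e"
          by blast
      qed
      then show "\<exists>r. strict_mono r \<and> M.MCauchy (\<sigma> \<circ> r)"
        using r(1) by blast
    qed
    then show ?thesis
      using M.mtotally_bounded_eq_compact_closure_of[OF SD2_mcomplete] by blast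
  qed
  show ?thesis
    unfolding cdc_embedding_def Let_def J_def[symmetric]
  proof (intro conjI ballI allI impI)
    show "\<exists>C. \<forall>v\<in>V. \<forall>w\<in>V. SD2_dist L E (J v) (J w) \<le> C * N (\<lambda>x. v x - w x)"
      using cont by blast
    show "compactin M.mtopology (M.mtopology closure_of (J ` B))" if "B \<subseteq> V" "\<exists>C. \<forall>v\<in>B. N v \<le> C" for B
      using J_compact[OF that(1)] that(2) by blast
  qed (fact ex1 inj J_add J_scale J_dense)+
qed

end

subsection \<open>Bounds on \<open>L\<^sup>p\<close> norms\<close>

text \<open>
  Unlike a bound on \<open>Lnorm\<close>, the predicate \<open>Lp_le\<close> implies membership in \<open>L\<^sup>p\<close>: for a function
  that is not in \<open>L\<^sup>p\<close> the integral in \<open>Lnorm\<close> takes the junk value 0.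
\<close>

definition Lp_le :: "'a measure \<Rightarrow> ennreal \<Rightarrow> real \<Rightarrow> ('a \<Rightarrow> complex) \<Rightarrow> bool" where
  "Lp_le M p e f \<longleftrightarrow> f \<in> borel_measurable M \<and>
     (if p = \<infinity> then AE x in M. cmod (f x) \<le> e
      else (\<integral>\<^sup>+x. ennreal (cmod (f x) powr enn2real p) \<partial>M) \<le> ennreal (e powr enn2real p))"

lemma one_le_enn2real: "1 \<le> p \<Longrightarrow> p \<noteq> \<infinity> \<Longrightarrow> 1 \<le> enn2real p"
  by (cases p) (auto simp: ennreal_ge_1)

lemma esssup_cmod_finite:
  assumes f: "f \<in> borel_measurable M" and fin: "esssup M (\<lambda>x. ereal (cmod (f x))) < \<infinity>"
  shows "AE x in M. cmod (f x) \<le> real_of_ereal (esssup M (\<lambda>x. ereal (cmod (f x))))"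
  using esssup_AE[of "\<lambda>x. ereal (cmod (f x))" M] fin
  by (cases "esssup M (\<lambda>x. ereal (cmod (f x)))") auto

lemma Lp_le_Lspace:
  assumes "Lp_le M p e f"
  shows "f \<in> Lspace M p"
proof (cases "p = \<infinity>")
  case True
  then have [measurable]: "f \<in> borel_measurable M" and "AE x in M. cmod (f x) \<le> e"
    using assms by (auto simp: Lp_le_def)
  then have "esssup M (\<lambda>x. ereal (cmod (f x))) \<le> ereal e"
    by (intro esssup_I) auto
  then show ?thesis
    using True by (auto simp: Lspace_def)
next
  case False
  then have [measurable]: "f \<in> borel_measurable M"
    and le: "(\<integral>\<^sup>+x. ennreal (cmod (f x) powr enn2real p) \<partial>M) \<le> ennreal (e powr enn2real p)"
    using assms by (auto simp: Lp_le_def)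
  have "integrable M (\<lambda>x. cmod (f x) powr enn2real p)"
    using le by (intro integrableI_bounded) (auto simp: le_less_trans[OF _ ennreal_less_top])
  then show ?thesis
    using False by (simp add: Lspace_def)
qed

lemma Lnorm_le:
  assumes "Lp_le M p e f" "1 \<le> p" "0 \<le> e"
  shows "Lnorm M p f \<le> e"
proof (cases "p = \<infinity>")
  case True
  then have [measurable]: "f \<in> borel_measurable M" and "AE x in M. cmod (f x) \<le> e"
    using assms by (auto simp: Lp_le_def)
  then have "esssup M (\<lambda>x. ereal (cmod (f x))) \<le> ereal e"
    by (intro esssup_I) auto
  then show ?thesis
    using True assms(3) by (cases "esssup M (\<lambda>x. ereal (cmod (f x)))") (auto simp: Lnorm_def)
next
  case False
  then have P: "1 \<le> enn2real p" using one_le_enn2real assms(2) by blast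
  have [measurable]: "f \<in> borel_measurable M"
    and le: "(\<integral>\<^sup>+x. ennreal (cmod (f x) powr enn2real p) \<partial>M) \<le> ennreal (e powr enn2real p)"
    using assms False by (auto simp: Lp_le_def)
  have "(\<integral>x. cmod (f x) powr enn2real p \<partial>M) \<le> e powr enn2real p"
    using le by (subst integral_eq_nn_integral) (auto intro: enn2real_leI)
  then have "(\<integral>x. cmod (f x) powr enn2real p \<partial>M) powr (1 / enn2real p) \<le> (e powr enn2real p) powr (1 / enn2real p)"
    using P by (intro powr_mono2) auto
  also have "\<dots> = e"
    using P assms(3) by (simp add: powr_powr)
  finally show ?thesis
    using False by (simp add: Lnorm_def)
qed

lemma Lnorm_nonneg:
  assumes "f \<in> borel_measurable M"
  shows "0 \<le> Lnorm M p f"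
\<comment> \<open>Over a null measure the essential supremum is \<open>- \<infinity>\<close>, which
  \<open>real_of_ereal\<close> sends to 0. A negative essential supremum is possible only there,
  because moduli are nonnegative.\<close>
proof (cases "p = \<infinity> \<and> esssup M (\<lambda>x. ereal (cmod (f x))) \<noteq> - \<infinity>")
  case True
  have "0 \<le> esssup M (\<lambda>x. ereal (cmod (f x)))"
  proof (rule ccontr)
    assume neg: "\<not> 0 \<le> esssup M (\<lambda>x. ereal (cmod (f x)))"
    have "AE x in M. False"
      using esssup_AE[of "\<lambda>x. ereal (cmod (f x))" M]
    proof eventually_elim
      case (elim x)
      have "0 \<le> ereal (cmod (f x))" by simp
      then show ?case using elim neg order_trans by blast
    qed
    then have "AE x in M. ereal (cmod (f x)) \<le> - \<infinity>"
      by simp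
    then have "esssup M (\<lambda>x. ereal (cmod (f x))) \<le> - \<infinity>"
      using assms by (intro esssup_I) auto
    then show False using True by simp
  qed
  then show ?thesis
    using True by (simp add: Lnorm_def real_of_ereal_pos)
next
  case False
  then show ?thesis by (auto simp: Lnorm_def)
qed

text \<open>The converse of \<open>Lnorm_le\<close> for members of \<open>L^p\<close>; together they
  allow passing freely between \<open>Lnorm\<close> and \<open>Lp_le\<close> there.\<close>

lemma Lp_le_Lnorm:
  assumes f: "f \<in> Lspace M p" and p: "1 \<le> p"
  shows "Lp_le M p (Lnorm M p f) f"
proof (cases "p = \<infinity>")
  case True
  then show ?thesis
    using f esssup_cmod_finite[of f M] by (auto simp: Lp_le_def Lspace_def Lnorm_def)
next
  case False
  then have P: "1 \<le> enn2real p" using one_le_enn2real p by blast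
  have int: "integrable M (\<lambda>x. cmod (f x) powr enn2real p)" and f': "f \<in> borel_measurable M"
    using f False by (auto simp: Lspace_def)
  have nn: "0 \<le> (\<integral>x. cmod (f x) powr enn2real p \<partial>M)"
    by (rule integral_nonneg_AE) simp
  have "(\<integral>\<^sup>+x. ennreal (cmod (f x) powr enn2real p) \<partial>M) = ennreal (\<integral>x. cmod (f x) powr enn2real p \<partial>M)"
    by (intro nn_integral_eq_integral int) simp
  also have "(\<integral>x. cmod (f x) powr enn2real p \<partial>M) = Lnorm M p f powr enn2real p"
    using False P nn by (simp add: Lnorm_def powr_powr)
  finally show ?thesis
    using False f' by (simp add: Lp_le_def)
qed

lemma Lp_le_mono:
  assumes f: "Lp_le M p e f" and g: "g \<in> borel_measurable M" and le: "AE x in M. cmod (g x) \<le> cmod (f x)"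
  shows "Lp_le M p e g"
proof (cases "p = \<infinity>")
  case True
  then show ?thesis
    using f g le by (auto simp: Lp_le_def)
next
  case False
  have "(\<integral>\<^sup>+x. ennreal (cmod (g x) powr enn2real p) \<partial>M) \<le> (\<integral>\<^sup>+x. ennreal (cmod (f x) powr enn2real p) \<partial>M)"
    using le by (intro nn_integral_mono_AE) (auto intro!: ennreal_leI powr_mono2 elim: AE_mp)
  then show ?thesis
    using f g False by (auto simp: Lp_le_def)
qed

lemma Lp_le_weaken:
  assumes "Lp_le M p e f" "0 \<le> e" "e \<le> e'"
  shows "Lp_le M p e' f"
proof -
  have "ennreal (e powr enn2real p) \<le> ennreal (e' powr enn2real p)"
    using assms by (intro ennreal_leI powr_mono2) auto
  then show ?thesis
    using assms unfolding Lp_le_def by (auto elim: eventually_mono intro: order_trans)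
qed

lemma Lp_le_scale:
  assumes f: "Lp_le M p e f" and e: "0 \<le> e"
  shows "Lp_le M p (cmod c * e) (\<lambda>x. c * f x)"
proof (cases "p = \<infinity>")
  case True
  then show ?thesis
    using f by (auto simp: Lp_le_def norm_mult intro!: mult_left_mono elim!: eventually_mono)
next
  case False
  have [measurable]: "f \<in> borel_measurable M" using f by (simp add: Lp_le_def)
  have "(\<integral>\<^sup>+x. ennreal (cmod (c * f x) powr enn2real p) \<partial>M) =
      (\<integral>\<^sup>+x. ennreal (cmod c powr enn2real p) * ennreal (cmod (f x) powr enn2real p) \<partial>M)"
    by (simp add: norm_mult powr_mult ennreal_mult)
  also have "\<dots> = ennreal (cmod c powr enn2real p) * (\<integral>\<^sup>+x. ennreal (cmod (f x) powr enn2real p) \<partial>M)"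
    by (rule nn_integral_cmult) measurable
  also have "\<dots> \<le> ennreal (cmod c powr enn2real p) * ennreal (e powr enn2real p)"
    using f False by (intro mult_left_mono) (auto simp: Lp_le_def)
  also have "\<dots> = ennreal ((cmod c * e) powr enn2real p)"
    using e by (simp add: powr_mult ennreal_mult)
  finally show ?thesis
    using False by (simp add: Lp_le_def)
qed

text \<open>The factor 4 replaces Minkowski's inequality.\<close>

lemma Lp_le_add:
  assumes f: "Lp_le M p e f" and g: "Lp_le M p e g" and p: "1 \<le> p" and e: "0 \<le> e"
  shows "Lp_le M p (4 * e) (\<lambda>x. f x + g x)"
proof (cases "p = \<infinity>")
  case True
  then have "AE x in M. cmod (f x) \<le> e" "AE x in M. cmod (g x) \<le> e"
    using f g by (auto simp: Lp_le_def)
  then have "AE x in M. cmod (f x + g x) \<le> 4 * e"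
    by eventually_elim (use e norm_triangle_ineq in \<open>smt (verit)\<close>)
  then show ?thesis
    using f g True by (auto simp: Lp_le_def)
next
  case False
  define P where "P = enn2real p"
  have P: "1 \<le> P" using one_le_enn2real p False by (auto simp: P_def)
  have [measurable]: "f \<in> borel_measurable M" "g \<in> borel_measurable M"
    using f g by (simp_all add: Lp_le_def)
  have pt: "cmod (f x + g x) powr P \<le> 2 powr P * (cmod (f x) powr P + cmod (g x) powr P)" for x
  proof -
    have "cmod (f x + g x) powr P \<le> (2 * max (cmod (f x)) (cmod (g x))) powr P"
      using P norm_triangle_ineq[of "f x" "g x"] by (intro powr_mono2) auto
    also have "\<dots> = 2 powr P * max (cmod (f x)) (cmod (g x)) powr P"
      by (simp add: powr_mult)
    also have "max (cmod (f x)) (cmod (g x)) powr P \<le> cmod (f x) powr P + cmod (g x) powr P"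
      by (simp add: max_def)
    finally show ?thesis by simp
  qed
  have "(\<integral>\<^sup>+x. ennreal (cmod (f x + g x) powr P) \<partial>M) \<le>
      (\<integral>\<^sup>+x. ennreal (2 powr P) * (ennreal (cmod (f x) powr P) + ennreal (cmod (g x) powr P)) \<partial>M)"
    by (intro nn_integral_mono) (use pt in \<open>simp add: ennreal_leI flip: ennreal_plus ennreal_mult\<close>)
  also have "\<dots> = ennreal (2 powr P) * ((\<integral>\<^sup>+x. ennreal (cmod (f x) powr P) \<partial>M) + (\<integral>\<^sup>+x. ennreal (cmod (g x) powr P) \<partial>M))"
    by (subst nn_integral_cmult, measurable) (subst nn_integral_add, measurable)
  also have "\<dots> \<le> ennreal (2 powr P) * (ennreal (e powr P) + ennreal (e powr P))"
    using f g False by (intro mult_left_mono add_mono) (auto simp: Lp_le_def P_def)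
  also have "\<dots> = ennreal (2 powr P * 2 * e powr P)"
    by (simp flip: ennreal_plus ennreal_mult)
  also have "\<dots> \<le> ennreal ((4 * e) powr P)"
  proof (rule ennreal_leI)
    \<comment> \<open>One factor \<open>2 powr P\<close> comes from
      \<open>\<bar>f + g\<bar> \<le> 2 * max \<bar>f\<bar> \<bar>g\<bar>\<close>; the other absorbs
      the factor 2 from the two integrals, as \<open>P \<ge> 1\<close>. Together they are
      \<open>4 powr P\<close>.\<close>
    have "2 powr P * 2 \<le> 2 powr P * 2 powr P"
      using powr_mono[OF P, of 2] by simp
    also have "\<dots> = 4 powr P" by (simp flip: powr_mult)
    finally show "2 powr P * 2 * e powr P \<le> (4 * e) powr P"
      using e by (simp add: powr_mult mult_right_mono)
  qed
  finally show ?thesis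
    using False by (simp add: Lp_le_def P_def)
qed

text \<open>Fatou's lemma for finite \<open>p\<close>. For \<open>p = \<infinity>\<close> the
  countably many exceptional null sets are united.\<close>

lemma Lp_le_lim:
  assumes g: "\<And>n. n \<ge> N \<Longrightarrow> Lp_le M p e (g n)" and f: "f \<in> borel_measurable M"
    and lim: "AE x in M. (\<lambda>n. g n x) \<longlonglongrightarrow> f x"
  shows "Lp_le M p e f"
proof (cases "p = \<infinity>")
  case True
  have "AE x in M. \<forall>n\<in>{N..}. cmod (g n x) \<le> e"
    using g True by (subst AE_ball_countable) (auto simp: Lp_le_def)
  then have "AE x in M. cmod (f x) \<le> e"
    using lim
  proof eventually_elim
    case (elim x)
    show ?case
      by (rule LIMSEQ_le_const2[OF tendsto_norm[OF elim(2)]]) (use elim(1) in auto)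
  qed
  then show ?thesis using True f by (simp add: Lp_le_def)
next
  case False
  define P where "P = enn2real p"
  have meas: "g (n + N) \<in> borel_measurable M" for n
    using g[of "n + N"] by (simp add: Lp_le_def)
  have "AE x in M. ennreal (cmod (f x) powr P) \<le> liminf (\<lambda>n. ennreal (cmod (g (n + N) x) powr P))"
    using lim
  proof eventually_elim
    case (elim x)
    then have l: "(\<lambda>n. cmod (g (n + N) x)) \<longlonglongrightarrow> cmod (f x)"
      by (intro tendsto_norm LIMSEQ_ignore_initial_segment)
    show ?case
    \<comment> \<open>\<open>tendsto_powr\<close> excludes the base limit 0; there the left side is
      0 and the claim is trivial.\<close>
    proof (cases "f x = 0")
      case False
      then have "(\<lambda>n. ennreal (cmod (g (n + N) x) powr P)) \<longlonglongrightarrow> ennreal (cmod (f x) powr P)"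
        by (intro tendsto_ennrealI tendsto_powr l tendsto_const) auto
      then show ?thesis
        by (simp only: lim_imp_Liminf[OF sequentially_bot])
    qed simp
  qed
  then have "(\<integral>\<^sup>+x. ennreal (cmod (f x) powr P) \<partial>M) \<le> (\<integral>\<^sup>+x. liminf (\<lambda>n. ennreal (cmod (g (n + N) x) powr P)) \<partial>M)"
    by (rule nn_integral_mono_AE)
  also have "\<dots> \<le> liminf (\<lambda>n. \<integral>\<^sup>+x. ennreal (cmod (g (n + N) x) powr P) \<partial>M)"
    by (rule nn_integral_liminf) (use meas in measurable)
  also have "\<dots> \<le> liminf (\<lambda>n. ennreal (e powr P))"
    using g False by (intro Liminf_mono always_eventually) (auto simp: Lp_le_def P_def)
  finally show ?thesis
    using False f by (simp add: Lp_le_def P_def Liminf_const)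
qed

lemma Lp_le_zero: "1 \<le> p \<Longrightarrow> 0 \<le> e \<Longrightarrow> Lp_le M p e (\<lambda>x. 0)"
  by (simp add: Lp_le_def)

lemma Lspace_measurable: "f \<in> Lspace M p \<Longrightarrow> f \<in> borel_measurable M"
  by (simp add: Lspace_def)

lemma Lspace_iff: "1 \<le> p \<Longrightarrow> f \<in> Lspace M p \<longleftrightarrow> (\<exists>e\<ge>0. Lp_le M p e f)"
  using Lp_le_Lspace[of M p _ f] Lp_le_Lnorm[of f M p] Lnorm_nonneg[of f M p] Lspace_measurable[of f M p]
  by blast

lemma Lspace_add:
  assumes "f \<in> Lspace M p" "g \<in> Lspace M p" "1 \<le> p"
  shows "(\<lambda>x. f x + g x) \<in> Lspace M p"
proof -
  obtain a b where "0 \<le> a" "Lp_le M p a f" "0 \<le> b" "Lp_le M p b g"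
    using assms(1,2) unfolding Lspace_iff[OF assms(3)] by blast
  then have "Lp_le M p (4 * max a b) (\<lambda>x. f x + g x)"
    by (intro Lp_le_add assms) (auto intro: Lp_le_weaken)
  then show ?thesis by (rule Lp_le_Lspace)
qed

lemma Lspace_scale: "f \<in> Lspace M p \<Longrightarrow> 1 \<le> p \<Longrightarrow> (\<lambda>x. c * f x) \<in> Lspace M p"
  using Lp_le_Lspace[OF Lp_le_scale[OF Lp_le_Lnorm Lnorm_nonneg]] Lspace_measurable by blast

lemma Lspace_1_iff: "f \<in> Lspace M 1 \<longleftrightarrow> integrable M f"
  by (auto simp: Lspace_def integrable_norm_iff)

lemma Lnorm_1: "Lnorm M 1 f = (\<integral>x. cmod (f x) \<partial>M)"
  by (simp add: Lnorm_def)

text \<open>A substitute for Hoelder's inequality that treats all finite exponents at once: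
  \<open>\<bar>e f\<bar> \<le> \<bar>e\<bar> + \<bar>f\<bar> powr p\<close>, by the first summand
  where \<open>\<bar>f\<bar> \<le> 1\<close> and by the second elsewhere, since
  \<open>\<bar>e\<bar> \<le> 1\<close> and \<open>p \<ge> 1\<close>.\<close>

lemma Lspace_integrable_mult:
  assumes e: "integrable M e" "\<And>x. cmod (e x) \<le> 1" and f: "f \<in> Lspace M p" and p: "1 \<le> p"
  shows "integrable M (\<lambda>x. e x * f x)"
proof (cases "p = \<infinity>")
  case True
  then have [measurable]: "f \<in> borel_measurable M"
    and le: "AE x in M. cmod (f x) \<le> Lnorm M p f"
    using Lp_le_Lnorm[OF f p] by (auto simp: Lp_le_def)
  show ?thesis
  proof (rule Bochner_Integration.integrable_bound)
    show "integrable M (\<lambda>x. Lnorm M p f * cmod (e x))"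
      using e(1) by (intro integrable_mult_right integrable_norm)
    show "AE x in M. norm (e x * f x) \<le> norm (Lnorm M p f * cmod (e x))"
      using le
    proof eventually_elim
      case (elim x)
      then show ?case
        unfolding norm_mult by (subst mult.commute, intro mult_mono) auto
    qed
  qed (use e in measurable)
next
  case False
  have P: "1 \<le> enn2real p" using one_le_enn2real p False by auto
  have [measurable]: "f \<in> borel_measurable M" and int: "integrable M (\<lambda>x. cmod (f x) powr enn2real p)"
    using f False by (auto simp: Lspace_def)
  show ?thesis
  proof (rule Bochner_Integration.integrable_bound)
    show "integrable M (\<lambda>x. cmod (e x) + cmod (f x) powr enn2real p)"
      using e(1) int by (intro Bochner_Integration.integrable_add integrable_norm)
    have "cmod (e x) * cmod (f x) \<le> cmod (e x) + cmod (f x) powr enn2real p" for x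
    proof (cases "cmod (f x) \<le> 1")
      case True
      then have "cmod (e x) * cmod (f x) \<le> cmod (e x) * 1"
        by (intro mult_left_mono) auto
      then show ?thesis
        by (smt (verit) powr_ge_zero)
    next
      case False
      then have "cmod (e x) * cmod (f x) \<le> 1 * cmod (f x)"
        using e(2) by (intro mult_right_mono) auto
      also have "\<dots> \<le> cmod (f x) powr enn2real p"
        using powr_mono[OF P, of "cmod (f x)"] False by simp
      finally show ?thesis
        by (smt (verit) norm_ge_zero)
    qed
    then show "AE x in M. norm (e x * f x) \<le> norm (cmod (e x) + cmod (f x) powr enn2real p)"
      by (simp add: norm_mult)
  qed (use e in measurable)
qed

text \<open>Off \<open>space N\<close> the function is 0, so a preimage gains all of
  \<open>space M - space N\<close> exactly when \<open>0 \<in> B\<close>.\<close>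

lemma borel_measurable_zero_extension:
  fixes f :: "'a \<Rightarrow> complex"
  assumes f: "f \<in> borel_measurable N" and sets: "sets N \<subseteq> sets M" and zero: "\<And>x. x \<notin> space N \<Longrightarrow> f x = 0"
  shows "f \<in> borel_measurable M"
proof (rule measurableI)
  fix B :: "complex set" assume B: "B \<in> sets borel"
  have "space N \<in> sets M" "f -` B \<inter> space N \<in> sets M"
    using sets measurable_sets[OF f B] by auto
  moreover have "f -` B \<inter> space M = (f -` B \<inter> space N) \<union> (if 0 \<in> B then space M - space N else {})"
    using zero sets.sets_into_space[OF calculation(1)] by (auto split: if_splits; metis)
  ultimately show "f -` B \<inter> space M \<in> sets M"
    by simp
qed simp

lemma sets_Collect_finite_Ball:
  assumes "finite I" "\<And>i. i \<in> I \<Longrightarrow> {x \<in> space M. P i x} \<in> sets M"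
  shows "{x \<in> space M. \<forall>i\<in>I. P i x} \<in> sets M"
  using sets.sets_Collect_finite_All'[of I M P] assms by (cases "I = {}") auto

section \<open>Topologies and Borel sets of the spaces \<open>RI n\<close>\<close>

lemma openin_RI_top:
  "openin (RI_top n) S \<longleftrightarrow> (\<exists>U. openin (powertop_real {..<n}) U \<and> S = {x \<in> RI n. restrict x {..<n} \<in> U})"
  by (auto simp: RI_top_def openin_pullback_topology)

lemma mem_RI_iff: "x \<in> RI n \<longleftrightarrow> (\<forall>i\<ge>n. x i \<in> {-1/2..1/2})"
  by (auto simp: RI_def cyl_def)

lemma RI_mono: "m \<le> n \<Longrightarrow> RI m \<subseteq> RI n"
  by (auto simp: mem_RI_iff)

lemma topspace_RI_top: "topspace (RI_top n) = RI n"
  by (auto simp: RI_top_def topspace_pullback_topology)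

lemma sets_borel_of: "sets (borel_of T) = sigma_sets (topspace T) {U. openin T U}"
  by (auto simp: borel_of_def dest: openin_subset intro!: sets_measure_of)

lemma space_borel_of: "space (borel_of T) = topspace T"
  by (simp add: borel_of_def space_measure_of_conv)

lemma openin_sets_borel_of: "openin T U \<Longrightarrow> U \<in> sets (borel_of T)"
  by (auto simp: sets_borel_of)

text \<open>Complements are taken in \<open>topspace T\<close>, which is itself open, so the
  induction stays inside \<open>sets M\<close> even when the space of \<open>M\<close> is
  larger.\<close>

lemma sets_borel_of_subsetI:
  assumes "\<And>U. openin T U \<Longrightarrow> U \<in> sets M"
  shows "sets (borel_of T) \<subseteq> sets M"
proof -
  have "sigma_sets (topspace T) {U. openin T U} \<subseteq> sets M"
  proof
    fix A assume "A \<in> sigma_sets (topspace T) {U. openin T U}"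
    then show "A \<in> sets M"
      by induction (use assms in \<open>auto intro: sets.Diff\<close>)
  qed
  then show ?thesis by (simp add: sets_borel_of)
qed

text \<open>\<open>openin\<close> inverts \<open>topology\<close> only on predicates that satisfy
  \<open>istopology\<close>, so the definition of \<open>RI_inf_top\<close> can be unfolded only
  after this check.\<close>

lemma openin_RI_inf_top:
  "openin RI_inf_top U \<longleftrightarrow> openin X1_top (U \<inter> X1) \<and> openin (discrete_topology X2) (U \<inter> X2)"
proof -
  have "istopology (\<lambda>U. openin X1_top (U \<inter> X1) \<and> openin (discrete_topology X2) (U \<inter> X2))"
    unfolding istopology_def
  proof (intro conjI allI impI)
    fix S T assume "openin X1_top (S \<inter> X1) \<and> openin (discrete_topology X2) (S \<inter> X2)"
      "openin X1_top (T \<inter> X1) \<and> openin (discrete_topology X2) (T \<inter> X2)"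
    then have "openin X1_top ((S \<inter> X1) \<inter> (T \<inter> X1))"
      by blast
    then show "openin X1_top (S \<inter> T \<inter> X1)" by (simp add: Int_ac)
  next
    fix K assume "\<forall>S\<in>K. openin X1_top (S \<inter> X1) \<and> openin (discrete_topology X2) (S \<inter> X2)"
    then have "openin X1_top (\<Union>S\<in>K. S \<inter> X1)"
      by blast
    then show "openin X1_top (\<Union>K \<inter> X1)" by simp
  qed auto
  then show ?thesis
    unfolding RI_inf_top_def by (simp add: topology_inverse')
qed

lemma openin_RI_inf_top_if_openin_RI_top:
  assumes n: "1 \<le> n" and S: "openin (RI_top n) S"
  shows "openin RI_inf_top S"
proof -
  obtain U where U: "openin (powertop_real {..<n}) U" "S = {x \<in> RI n. restrict x {..<n} \<in> U}"
    using S by (auto simp: openin_RI_top)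
  \<comment> \<open>A generator is a union over all levels; empty sets at the other levels leave a
    single cylinder.\<close>
  have "S = (\<Union>m\<in>{1..}. cyl m (if m = n then U else {}))"
    using n U(2) by (auto simp: cyl_def mem_RI_iff split: if_splits)
  then have "openin X1_top S"
    unfolding X1_top_def using U(1)
    by (intro topology_generated_by_Basis) (auto intro!: exI[of _ "\<lambda>m. if m = n then U else {}"])
  moreover have "S \<subseteq> X1"
    using U(2) n by (auto simp: X1_def)
  then have "S \<inter> X1 = S" "S \<inter> X2 = {}"
    by (auto simp: X2_def)
  ultimately show ?thesis
    by (simp add: openin_RI_inf_top)
qed

lemma RI_coordinate_measurable:
  assumes "i < n"
  shows "(\<lambda>x. x i) \<in> borel_measurable (borel_of (RI_top n))"
proof (rule borel_measurableI)
  fix S :: "real set" assume "open S"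
  then have "openin (powertop_real {..<n}) {y \<in> topspace (powertop_real {..<n}). y i \<in> S}"
    using assms by (intro openin_continuous_map_preimage[OF continuous_map_product_projection]) auto
  then have "openin (RI_top n) {x \<in> RI n. restrict x {..<n} \<in> {y \<in> topspace (powertop_real {..<n}). y i \<in> S}}"
    unfolding openin_RI_top by blast
  moreover have "{x \<in> RI n. restrict x {..<n} \<in> {y \<in> topspace (powertop_real {..<n}). y i \<in> S}} =
      (\<lambda>x. x i) -` S \<inter> space (borel_of (RI_top n))"
    using assms by (auto simp: space_borel_of topspace_RI_top)
  ultimately show "(\<lambda>x. x i) -` S \<inter> space (borel_of (RI_top n)) \<in> sets (borel_of (RI_top n))"
    using openin_sets_borel_of by metis
qed

text \<open>An open set of \<open>RI n\<close> need not be open in \<open>RI m\<close>, because it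
  confines the coordinates from \<open>n\<close> to \<open>m - 1\<close> to a closed interval. It is
  an open set cut by finitely many such conditions, hence still Borel.\<close>

lemma sets_RI_top_mono:
  assumes "n \<le> m"
  shows "sets (borel_of (RI_top n)) \<subseteq> sets (borel_of (RI_top m))"
proof (rule sets_borel_of_subsetI)
  let ?M = "borel_of (RI_top m)"
  fix S assume "openin (RI_top n) S"
  then obtain U where U: "openin (powertop_real {..<n}) U" "S = {x \<in> RI n. restrict x {..<n} \<in> U}"
    by (auto simp: openin_RI_top)
  let ?V = "{y \<in> topspace (powertop_real {..<m}). restrict y {..<n} \<in> U}"
  have "openin (powertop_real {..<m}) ?V"
    using assms by (intro openin_continuous_map_preimage[OF continuous_on_restrict U(1)]) auto
  then have V: "{x \<in> RI m. restrict x {..<m} \<in> ?V} \<in> sets ?M"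
    by (intro openin_sets_borel_of) (unfold openin_RI_top, blast)
  have "{x \<in> space ?M. \<forall>i\<in>{n..<m}. x i \<in> {-1/2..1/2}} \<in> sets ?M"
  proof (rule sets_Collect_finite_Ball[OF finite_atLeastLessThan])
    show "{x \<in> space ?M. x i \<in> {-1/2..1/2}} \<in> sets ?M" if "i \<in> {n..<m}" for i
      using measurable_sets[OF RI_coordinate_measurable[of i m], of "{-1/2..1/2}"] that
      by (simp add: vimage_def Int_def conj_commute)
  qed
  then have "{x \<in> RI m. restrict x {..<m} \<in> ?V} \<inter> {x \<in> space ?M. \<forall>i\<in>{n..<m}. x i \<in> {-1/2..1/2}} \<in> sets ?M"
    using V by blast
  moreover have "restrict (restrict x {..<m}) {..<n} = restrict x {..<n}" for x :: "nat \<Rightarrow> real"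
    using assms by (auto simp: restrict_def)
  then have "S = {x \<in> RI m. restrict x {..<m} \<in> ?V} \<inter> {x \<in> space ?M. \<forall>i\<in>{n..<m}. x i \<in> {-1/2..1/2}}"
    unfolding U(2) space_borel_of topspace_RI_top using assms
    by (auto simp: mem_RI_iff)
  ultimately show "S \<in> sets ?M" by simp
qed

text \<open>For \<open>n \<ge> 1\<close> these are sets of finite measure, and they exhaust
  \<open>RI n\<close> as \<open>m\<close> grows.\<close>

definition RI_box :: "nat \<Rightarrow> nat \<Rightarrow> (nat \<Rightarrow> real) set" where
  "RI_box n m = {x \<in> RI n. \<forall>i<n. \<bar>x i\<bar> \<le> real m}"

lemma RI_box_sets: "RI_box n m \<in> sets (borel_of (RI_top n))"
proof -
  let ?M = "borel_of (RI_top n)"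
  have "{x \<in> space ?M. \<forall>i\<in>{..<n}. x i \<in> {-real m..real m}} \<in> sets ?M"
  proof (rule sets_Collect_finite_Ball[OF finite_lessThan])
    show "{x \<in> space ?M. x i \<in> {-real m..real m}} \<in> sets ?M" if "i \<in> {..<n}" for i
      using measurable_sets[OF RI_coordinate_measurable[of i n], of "{-real m..real m}"] that
      by (simp add: vimage_def Int_def conj_commute)
  qed
  moreover have "{x \<in> space ?M. \<forall>i\<in>{..<n}. x i \<in> {-real m..real m}} = RI_box n m"
    by (auto simp: RI_box_def space_borel_of topspace_RI_top abs_le_iff minus_le_iff)
  ultimately show ?thesis by simp
qed

lemma eventually_RI_box:
  assumes "x \<in> RI n"
  shows "eventually (\<lambda>m. x \<in> RI_box n m) sequentially"
proof -
  have "eventually (\<lambda>m. \<bar>x i\<bar> \<le> real m) sequentially" for i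
    by (rule eventually_sequentiallyI[of "nat \<lceil>\<bar>x i\<bar>\<rceil>"]) linarith
  then have "eventually (\<lambda>m. \<forall>i\<in>{..<n}. \<bar>x i\<bar> \<le> real m) sequentially"
    by (intro eventually_ball_finite) auto
  then show ?thesis
    using assms by (auto simp: RI_box_def elim: eventually_mono)
qed

lemma RI_box_eq_cyl: "RI_box n m = cyl n ({..<n} \<rightarrow>\<^sub>E {-real m..real m})"
  by (auto simp: RI_box_def cyl_def mem_RI_iff abs_le_iff minus_le_iff PiE_iff)

lemma RI_box_lborel_n:
  "({..<n} \<rightarrow>\<^sub>E {-real m..real m}) \<in> sets (lborel_n n)"
  "emeasure (lborel_n n) ({..<n} \<rightarrow>\<^sub>E {-real m..real m}) < \<infinity>"
proof -
  interpret product_sigma_finite "\<lambda>i::nat. lborel :: real measure" ..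
  show "({..<n} \<rightarrow>\<^sub>E {-real m..real m}) \<in> sets (lborel_n n)"
    unfolding lborel_n_def by (intro sets_PiM_I_finite) auto
  show "emeasure (lborel_n n) ({..<n} \<rightarrow>\<^sub>E {-real m..real m}) < \<infinity>"
    unfolding lborel_n_def by (subst emeasure_PiM) (auto simp: power_less_top_ennreal)
qed

subsection \<open>The spaces \<open>L\<^sup>p\<close> over infinitely many coordinates\<close>

locale lambda_inf =
  fixes L :: "(nat \<Rightarrow> real) measure"
  assumes lambda_inf: "is_lambda_inf L"
begin

lemma RI_top_sets:
  assumes "1 \<le> n"
  shows "sets (borel_of (RI_top n)) \<subseteq> sets L"
proof (rule sets_borel_of_subsetI)
  fix U assume "openin (RI_top n) U"
  then have "U \<in> sets (borel_of RI_inf_top)"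
    by (intro openin_sets_borel_of openin_RI_inf_top_if_openin_RI_top[OF assms])
  then show "U \<in> sets L"
    using lambda_inf by (simp add: is_lambda_inf_def)
qed

lemma emeasure_RI_box: "1 \<le> n \<Longrightarrow> emeasure L (RI_box n m) < \<infinity>"
  using lambda_inf RI_box_lborel_n[of n m] by (simp add: is_lambda_inf_def RI_box_eq_cyl)

lemma RI_box_sets_L: "1 \<le> n \<Longrightarrow> RI_box n m \<in> sets L"
  using RI_box_sets RI_top_sets by blast

lemma Lp_RI_Lspace: "f \<in> Lp_RI L n p \<Longrightarrow> f \<in> Lspace L p"
  by (simp add: Lp_RI_def)

lemma Lp_RI_add: "f \<in> Lp_RI L n p \<Longrightarrow> g \<in> Lp_RI L n p \<Longrightarrow> 1 \<le> p \<Longrightarrow> (\<lambda>x. f x + g x) \<in> Lp_RI L n p"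
  by (auto simp: Lp_RI_def Lspace_add)

lemma Lp_RI_scale: "f \<in> Lp_RI L n p \<Longrightarrow> 1 \<le> p \<Longrightarrow> (\<lambda>x. c * f x) \<in> Lp_RI L n p"
  by (auto simp: Lp_RI_def Lspace_scale)

lemma Lp_RI_zero: "1 \<le> p \<Longrightarrow> (\<lambda>x. 0) \<in> Lp_RI L n p"
  using Lp_le_Lspace[OF Lp_le_zero[of p 0 L]] by (auto simp: Lp_RI_def)

lemma Lp_RI_mono:
  assumes "f \<in> Lp_RI L n p" "n \<le> m"
  shows "f \<in> Lp_RI L m p"
proof -
  have "f \<in> borel_measurable (borel_of (RI_top m))"
    by (rule borel_measurable_zero_extension[OF _ sets_RI_top_mono[OF assms(2)]])
      (use assms in \<open>auto simp: Lp_RI_def space_borel_of topspace_RI_top\<close>)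
  then show ?thesis
    using assms RI_mono[OF assms(2)] by (auto simp: Lp_RI_def)
qed

text \<open>The Cauchy condition is restated with \<open>Lp_le\<close>, which passes to limits
  almost everywhere. The two forms agree because differences of the approximating functions lie in
  \<open>L^p\<close>, where \<open>Lnorm\<close> is not a default value.\<close>

lemma Lp_inf_iff:
  assumes p: "1 \<le> p"
  shows "f \<in> Lp_inf L p \<longleftrightarrow> f \<in> borel_measurable L \<and>
     (\<exists>g. (\<forall>n\<ge>1. g n \<in> Lp_RI L n p) \<and>
        (\<forall>e>0. \<exists>N\<ge>1. \<forall>m\<ge>N. \<forall>n\<ge>N. Lp_le L p e (\<lambda>x. g m x - g n x)) \<and>
        (AE x in L. (\<lambda>n. g n x) \<longlonglongrightarrow> f x))"
proof -
  have "(\<forall>e>0. \<exists>N\<ge>1. \<forall>m\<ge>N. \<forall>n\<ge>N. Lnorm L p (\<lambda>x. g m x - g n x) < e) \<longleftrightarrow>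
      (\<forall>e>0. \<exists>N\<ge>1. \<forall>m\<ge>N. \<forall>n\<ge>N. Lp_le L p e (\<lambda>x. g m x - g n x))" (is "?l \<longleftrightarrow> ?r")
    if g: "\<And>n. n \<ge> 1 \<Longrightarrow> g n \<in> Lp_RI L n p" for g
  proof -
    have diff: "(\<lambda>x. g m x - g n x) \<in> Lspace L p" if "m \<ge> 1" "n \<ge> 1" for m n
      using Lspace_add[OF Lp_RI_Lspace[OF g[OF that(1)]] Lspace_scale[OF Lp_RI_Lspace[OF g[OF that(2)]] p, of "-1"] p]
      by simp
    show ?thesis
    proof (intro iffI allI impI)
      fix e :: real assume ?l "e > 0"
      then obtain N where N: "N \<ge> 1" "\<And>m n. m \<ge> N \<Longrightarrow> n \<ge> N \<Longrightarrow> Lnorm L p (\<lambda>x. g m x - g n x) < e"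
        by blast
      have "Lp_le L p e (\<lambda>x. g m x - g n x)" if "m \<ge> N" "n \<ge> N" for m n
      proof -
        have d: "(\<lambda>x. g m x - g n x) \<in> Lspace L p"
          using that N(1) by (intro diff) auto
        show ?thesis
          by (rule Lp_le_weaken[OF Lp_le_Lnorm[OF d p] Lnorm_nonneg[OF Lspace_measurable[OF d]]
                less_imp_le[OF N(2)[OF that]]])
      qed
      then show "\<exists>N\<ge>1. \<forall>m\<ge>N. \<forall>n\<ge>N. Lp_le L p e (\<lambda>x. g m x - g n x)"
        using N(1) by blast
    next
      fix e :: real assume r: ?r and "e > 0"
      \<comment> \<open>Halving recovers the strict inequality, since \<open>Lp_le\<close> bounds
        the norm only weakly.\<close>
      have "\<exists>N\<ge>1. \<forall>m\<ge>N. \<forall>n\<ge>N. Lp_le L p (e / 2) (\<lambda>x. g m x - g n x)"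
        using r[rule_format, of "e / 2"] \<open>e > 0\<close> by simp
      then obtain N where N: "N \<ge> 1" "\<And>m n. m \<ge> N \<Longrightarrow> n \<ge> N \<Longrightarrow> Lp_le L p (e / 2) (\<lambda>x. g m x - g n x)"
        by blast
      have "Lnorm L p (\<lambda>x. g m x - g n x) < e" if "m \<ge> N" "n \<ge> N" for m n
        using Lnorm_le[OF N(2)[OF that] p] \<open>e > 0\<close> by simp
      then show "\<exists>N\<ge>1. \<forall>m\<ge>N. \<forall>n\<ge>N. Lnorm L p (\<lambda>x. g m x - g n x) < e"
        using N(1) by blast
    qed
  qed
  then show ?thesis
    unfolding Lp_inf_def by (simp cong: conj_cong)
qed

text \<open>The definition of \<open>Lp_inf\<close> supplies convergence almost everywhere only.
  Letting \<open>m\<close> tend to infinity in the Cauchy estimate for \<open>g m - g n\<close>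
  turns it into convergence in norm.\<close>

lemma Lp_inf_approx:
  assumes f: "f \<in> Lp_inf L p" and p: "1 \<le> p"
  obtains g where "\<And>n. n \<ge> 1 \<Longrightarrow> g n \<in> Lp_RI L n p"
    and "\<And>e. e > 0 \<Longrightarrow> \<exists>N\<ge>1. \<forall>n\<ge>N. Lp_le L p e (\<lambda>x. f x - g n x)"
proof -
  obtain g where g: "\<And>n. n \<ge> 1 \<Longrightarrow> g n \<in> Lp_RI L n p"
    "\<And>e. e > 0 \<Longrightarrow> \<exists>N\<ge>1. \<forall>m\<ge>N. \<forall>n\<ge>N. Lp_le L p e (\<lambda>x. g m x - g n x)"
    "AE x in L. (\<lambda>n. g n x) \<longlonglongrightarrow> f x" and [measurable]: "f \<in> borel_measurable L"
    using f unfolding Lp_inf_iff[OF p] by blast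
  have "\<exists>N\<ge>1. \<forall>n\<ge>N. Lp_le L p e (\<lambda>x. f x - g n x)" if "e > 0" for e
  proof -
    obtain N where N: "N \<ge> 1" "\<And>m n. m \<ge> N \<Longrightarrow> n \<ge> N \<Longrightarrow> Lp_le L p e (\<lambda>x. g m x - g n x)"
      using g(2)[OF \<open>e > 0\<close>] by blast
    have "Lp_le L p e (\<lambda>x. f x - g n x)" if n: "n \<ge> N" for n
    proof (rule Lp_le_lim)
      have "g n \<in> borel_measurable L"
        using g(1)[of n] n N(1) by (intro Lspace_measurable[OF Lp_RI_Lspace]) auto
      then show "(\<lambda>x. f x - g n x) \<in> borel_measurable L" by measurable
      show "Lp_le L p e (\<lambda>x. g m x - g n x)" if "m \<ge> N" for m
        by (rule N(2)[OF that n])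
      show "AE x in L. (\<lambda>m. g m x - g n x) \<longlonglongrightarrow> f x - g n x"
        using g(3) by eventually_elim (intro tendsto_diff tendsto_const)
    qed
    then show ?thesis using N(1) by blast
  qed
  then show ?thesis using that g(1) by blast
qed

lemma Lp_inf_Lspace:
  assumes f: "f \<in> Lp_inf L p" and p: "1 \<le> p"
  shows "f \<in> Lspace L p"
proof -
  obtain g where g: "\<And>n. n \<ge> 1 \<Longrightarrow> g n \<in> Lp_RI L n p"
    "\<And>e. e > 0 \<Longrightarrow> \<exists>N\<ge>1. \<forall>n\<ge>N. Lp_le L p e (\<lambda>x. f x - g n x)"
    using Lp_inf_approx[OF f p] by metis
  obtain N where N: "N \<ge> 1" "Lp_le L p 1 (\<lambda>x. f x - g N x)"
    using g(2)[of 1] by auto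
  show ?thesis
    using Lspace_add[OF Lp_le_Lspace[OF N(2)] Lp_RI_Lspace[OF g(1)[OF N(1)]] p] by simp
qed

lemma Lp_inf_measurable: "f \<in> Lp_inf L p \<Longrightarrow> f \<in> borel_measurable L"
  by (simp add: Lp_inf_def)

lemma Lp_RI_Lp_inf:
  assumes f: "f \<in> Lp_RI L n p" and p: "1 \<le> p" and n: "1 \<le> n"
  shows "f \<in> Lp_inf L p"
  unfolding Lp_inf_iff[OF p]
\<comment> \<open>At levels below \<open>n\<close> the function \<open>f\<close> may not be
  admissible, so the approximating sequence starts with zeros.\<close>
proof (intro conjI exI[of _ "\<lambda>m x. if m < n then 0 else f x"] allI impI)
  show "f \<in> borel_measurable L"
    using f by (intro Lspace_measurable[OF Lp_RI_Lspace])
  show "(\<lambda>x. if m < n then 0 else f x) \<in> Lp_RI L m p" if "1 \<le> m" for m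
    using Lp_RI_zero[OF p] Lp_RI_mono[OF f] by (cases "m < n") auto
  show "\<exists>N\<ge>1. \<forall>m\<ge>N. \<forall>k\<ge>N. Lp_le L p e (\<lambda>x. (if m < n then 0 else f x) - (if k < n then 0 else f x))"
    if "e > 0" for e
    using n that Lp_le_zero[OF p, of e L] by (intro exI[of _ n]) (auto simp: not_less)
  show "AE x in L. (\<lambda>m. if m < n then 0 else f x) \<longlonglongrightarrow> f x"
    by (intro AE_I2 tendsto_eventually eventually_sequentiallyI[of n]) auto
qed

lemma Lp_inf_add:
  assumes f: "f \<in> Lp_inf L p" and g: "g \<in> Lp_inf L p" and p: "1 \<le> p"
  shows "(\<lambda>x. f x + g x) \<in> Lp_inf L p"
proof -
  obtain u where u: "\<And>n. n \<ge> 1 \<Longrightarrow> u n \<in> Lp_RI L n p"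
    "\<And>e. e > 0 \<Longrightarrow> \<exists>N\<ge>1. \<forall>m\<ge>N. \<forall>n\<ge>N. Lp_le L p e (\<lambda>x. u m x - u n x)"
    "AE x in L. (\<lambda>n. u n x) \<longlonglongrightarrow> f x"
    using f unfolding Lp_inf_iff[OF p] by blast
  obtain v where v: "\<And>n. n \<ge> 1 \<Longrightarrow> v n \<in> Lp_RI L n p"
    "\<And>e. e > 0 \<Longrightarrow> \<exists>N\<ge>1. \<forall>m\<ge>N. \<forall>n\<ge>N. Lp_le L p e (\<lambda>x. v m x - v n x)"
    "AE x in L. (\<lambda>n. v n x) \<longlonglongrightarrow> g x"
    using g unfolding Lp_inf_iff[OF p] by blast
  show ?thesis
    unfolding Lp_inf_iff[OF p]
  proof (intro conjI exI[of _ "\<lambda>n x. u n x + v n x"] allI impI)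
    show "(\<lambda>x. f x + g x) \<in> borel_measurable L"
      using Lp_inf_measurable[OF f] Lp_inf_measurable[OF g] by measurable
    show "(\<lambda>x. u n x + v n x) \<in> Lp_RI L n p" if "1 \<le> n" for n
      using u(1)[OF that] v(1)[OF that] p by (rule Lp_RI_add)
    show "AE x in L. (\<lambda>n. u n x + v n x) \<longlonglongrightarrow> f x + g x"
      using u(3) v(3) by eventually_elim (rule tendsto_add)
    fix e :: real assume e: "e > 0"
    \<comment> \<open>The quarter compensates the factor 4 in \<open>Lp_le_add\<close>.\<close>
    obtain N1 where N1: "N1 \<ge> 1" "\<And>m n. m \<ge> N1 \<Longrightarrow> n \<ge> N1 \<Longrightarrow> Lp_le L p (e/4) (\<lambda>x. u m x - u n x)"
      using u(2)[of "e/4"] e by auto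
    obtain N2 where N2: "N2 \<ge> 1" "\<And>m n. m \<ge> N2 \<Longrightarrow> n \<ge> N2 \<Longrightarrow> Lp_le L p (e/4) (\<lambda>x. v m x - v n x)"
      using v(2)[of "e/4"] e by auto
    have "Lp_le L p e (\<lambda>x. u m x + v m x - (u n x + v n x))" if "m \<ge> max N1 N2" "n \<ge> max N1 N2" for m n
      using Lp_le_add[OF N1(2)[of m n] N2(2)[of m n] p] that e by (simp add: algebra_simps)
    then show "\<exists>N\<ge>1. \<forall>m\<ge>N. \<forall>n\<ge>N. Lp_le L p e (\<lambda>x. u m x + v m x - (u n x + v n x))"
      using N1(1) by (intro exI[of _ "max N1 N2"]) auto
  qed
qed

lemma Lp_inf_scale:
  assumes f: "f \<in> Lp_inf L p" and p: "1 \<le> p"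
  shows "(\<lambda>x. c * f x) \<in> Lp_inf L p"
proof -
  obtain u where u: "\<And>n. n \<ge> 1 \<Longrightarrow> u n \<in> Lp_RI L n p"
    "\<And>e. e > 0 \<Longrightarrow> \<exists>N\<ge>1. \<forall>m\<ge>N. \<forall>n\<ge>N. Lp_le L p e (\<lambda>x. u m x - u n x)"
    "AE x in L. (\<lambda>n. u n x) \<longlonglongrightarrow> f x"
    using f unfolding Lp_inf_iff[OF p] by blast
  show ?thesis
    unfolding Lp_inf_iff[OF p]
  proof (intro conjI exI[of _ "\<lambda>n x. c * u n x"] allI impI)
    show "(\<lambda>x. c * f x) \<in> borel_measurable L"
      using Lp_inf_measurable[OF f] by measurable
    show "(\<lambda>x. c * u n x) \<in> Lp_RI L n p" if "1 \<le> n" for n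
      using u(1)[OF that] p by (rule Lp_RI_scale)
    show "AE x in L. (\<lambda>n. c * u n x) \<longlonglongrightarrow> c * f x"
      using u(3) by eventually_elim (intro tendsto_mult tendsto_const)
    fix e :: real assume e: "e > 0"
    then have e': "e / (cmod c + 1) > 0"
      by (simp add: add_nonneg_pos)
    then obtain N where N: "N \<ge> 1" "\<And>m n. m \<ge> N \<Longrightarrow> n \<ge> N \<Longrightarrow> Lp_le L p (e / (cmod c + 1)) (\<lambda>x. u m x - u n x)"
      using u(2) by blast
    have "cmod c * (e / (cmod c + 1)) \<le> (cmod c + 1) * (e / (cmod c + 1))"
      using e' by (intro mult_right_mono) auto
    also have "\<dots> = e"
      by (rule nonzero_mult_div_cancel_left[of _ e, unfolded times_divide_eq_right[symmetric]])
        (smt (verit) norm_ge_zero)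
    finally have le: "cmod c * (e / (cmod c + 1)) \<le> e" .
    have "Lp_le L p e (\<lambda>x. c * u m x - c * u n x)" if "m \<ge> N" "n \<ge> N" for m n
      using Lp_le_weaken[OF Lp_le_scale[OF N(2)[OF that] less_imp_le[OF e'], of c] _ le] e'
      by (simp add: right_diff_distrib del: times_divide_eq_right)
    then show "\<exists>N\<ge>1. \<forall>m\<ge>N. \<forall>n\<ge>N. Lp_le L p e (\<lambda>x. c * u m x - c * u n x)"
      using N(1) by blast
  qed
qed

lemma Lp_inf_diff:
  assumes "f \<in> Lp_inf L p" "g \<in> Lp_inf L p" "1 \<le> p"
  shows "(\<lambda>x. f x - g x) \<in> Lp_inf L p"
  using Lp_inf_add[OF assms(1) Lp_inf_scale[OF assms(2,3), of "-1"] assms(3)] by simp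

text \<open>Cutting both the domain and the values leaves a bounded function that vanishes off a set
  of finite measure, hence a member of every \<open>L^q\<close>. Large values are set to 0, so at
  each point the truncations of a function in \<open>Lp_RI L n p\<close> eventually equal
  it.\<close>

definition trunc :: "nat \<Rightarrow> nat \<Rightarrow> ((nat \<Rightarrow> real) \<Rightarrow> complex) \<Rightarrow> (nat \<Rightarrow> real) \<Rightarrow> complex" where
  "trunc n m g x = (if x \<in> RI_box n m \<and> cmod (g x) \<le> real m then g x else 0)"

lemma cmod_trunc_le: "cmod (trunc n m g x) \<le> cmod (g x)"
  by (simp add: trunc_def)

lemma trunc_Lp_RI:
  assumes g: "g \<in> Lp_RI L n p" and n: "1 \<le> n" and q: "1 \<le> q"
  shows "trunc n m g \<in> Lp_RI L n q"
proof -
  have [measurable]: "g \<in> borel_measurable (borel_of (RI_top n))" and g_L [measurable]: "g \<in> borel_measurable L"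
    using g Lspace_measurable[OF Lp_RI_Lspace[OF g]] by (auto simp: Lp_RI_def)
  note [measurable] = RI_box_sets RI_box_sets_L[OF n]
  have 1: "trunc n m g \<in> borel_measurable (borel_of (RI_top n))"
    unfolding trunc_def by measurable
  have [measurable]: "trunc n m g \<in> borel_measurable L"
    unfolding trunc_def by measurable
  have le: "cmod (trunc n m g x) \<le> real m" for x
    by (simp add: trunc_def)
  have "trunc n m g \<in> Lspace L q"
  proof (cases "q = \<infinity>")
    case True
    have "Lp_le L q (real m) (trunc n m g)"
      using True le by (simp add: Lp_le_def)
    then show ?thesis by (rule Lp_le_Lspace)
  next
    case False
    have "integrable L (\<lambda>x. cmod (trunc n m g x) powr enn2real q)"
    proof (rule integrableI_bounded_set[where A = "RI_box n m" and B = "real m powr enn2real q"])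
      show "AE x in L. x \<in> RI_box n m \<longrightarrow> norm (cmod (trunc n m g x) powr enn2real q) \<le> real m powr enn2real q"
        using le by (auto intro!: powr_mono2)
      show "AE x in L. x \<notin> RI_box n m \<longrightarrow> cmod (trunc n m g x) powr enn2real q = 0"
        by (simp add: trunc_def)
    qed (use emeasure_RI_box[OF n] in auto)
    then show ?thesis
      using False by (simp add: Lspace_def)
  qed
  then show ?thesis
    using 1 g by (auto simp: Lp_RI_def trunc_def)
qed

lemma trunc_tendsto:
  assumes "g \<in> Lp_RI L n p"
  shows "(\<lambda>m. trunc n m g x) \<longlonglongrightarrow> g x"
proof (rule tendsto_eventually)
  show "eventually (\<lambda>m. trunc n m g x = g x) sequentially"
  proof (cases "x \<in> RI n")
    case True
    have "eventually (\<lambda>m. cmod (g x) \<le> real m) sequentially"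
      by (rule eventually_sequentiallyI[of "nat \<lceil>cmod (g x)\<rceil>"]) linarith
    then show ?thesis
      using eventually_RI_box[OF True] by eventually_elim (simp add: trunc_def)
  qed (use assms in \<open>simp add: trunc_def Lp_RI_def\<close>)
qed

end

section \<open>The functionals \<open>F_k\<close> on the \<open>L^p\<close> spaces\<close>

locale jones_family = lambda_inf +
  fixes E :: "nat \<Rightarrow> (nat \<Rightarrow> real) \<Rightarrow> complex"
  assumes jones: "is_jones_family L E"
begin

lemma cmod_E_le: "cmod (E k x) \<le> 1"
proof -
  have "jones_shape (E k)" using jones by (simp add: is_jones_family_def)
  then show ?thesis
    unfolding jones_shape_def by (metis less_imp_le norm_zero zero_le_one)
qed

lemma E_integrable: "integrable L (E k)"
  using jones Lp_inf_Lspace[of "E k" 1] by (simp add: is_jones_family_def Lspace_1_iff)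

lemma E_mult_integrable: "f \<in> Lp_inf L p \<Longrightarrow> 1 \<le> p \<Longrightarrow> integrable L (\<lambda>x. E k x * f x)"
  by (rule Lspace_integrable_mult[OF E_integrable cmod_E_le Lp_inf_Lspace])

lemma jones_F_add:
  assumes "f \<in> Lp_inf L p" "g \<in> Lp_inf L p" "1 \<le> p"
  shows "jones_F L E k (\<lambda>x. f x + g x) = jones_F L E k f + jones_F L E k g"
  unfolding jones_F_def distrib_left
  by (intro Bochner_Integration.integral_add E_mult_integrable[OF _ assms(3)] assms)

lemma jones_F_scale:
  "jones_F L E k (\<lambda>x. c * f x) = c * jones_F L E k f"
  unfolding jones_F_def mult.left_commute[of _ c] by (rule integral_mult_right_zero)

lemma jones_F_diff:
  assumes "f \<in> Lp_inf L p" "g \<in> Lp_inf L p" "1 \<le> p"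
  shows "jones_F L E k (\<lambda>x. f x - g x) = jones_F L E k f - jones_F L E k g"
  unfolding jones_F_def right_diff_distrib
  by (intro Bochner_Integration.integral_diff E_mult_integrable[OF _ assms(3)] assms)

lemma jones_F_le: "f \<in> Lp_inf L p \<Longrightarrow> 1 \<le> p \<Longrightarrow> cmod (jones_F L E k f) \<le> Lnorm L p f"
  using jones by (simp add: is_jones_family_def)

lemma jones_F_bounded: "f \<in> Lp_inf L p \<Longrightarrow> 1 \<le> p \<Longrightarrow> bounded (range (\<lambda>k. jones_F L E k f))"
  by (rule bounded_rangeI[OF jones_F_le])

text \<open>The direction from the \<open>F_k\<close> to the functions is where fundamentality
  enters; it makes the embedding of \<open>L^p\<close> injective.\<close>

lemma jones_F_AE_eq_iff:
  assumes "f \<in> Lp_inf L p" "g \<in> Lp_inf L p" "1 \<le> p"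
  shows "(AE x in L. f x = g x) \<longleftrightarrow> (\<forall>k. jones_F L E k f = jones_F L E k g)"
proof
  assume ae: "AE x in L. f x = g x"
  have [measurable]: "f \<in> borel_measurable L" "g \<in> borel_measurable L" "E k \<in> borel_measurable L" for k
    using assms Lp_inf_measurable borel_measurable_integrable[OF E_integrable] by simp_all
  show "\<forall>k. jones_F L E k f = jones_F L E k g"
    unfolding jones_F_def using ae by (intro allI integral_cong_AE) auto
next
  assume "\<forall>k. jones_F L E k f = jones_F L E k g"
  then have "\<forall>k. jones_F L E k (\<lambda>x. f x - g x) = 0"
    by (simp add: jones_F_diff[OF assms])
  then have "AE x in L. f x - g x = 0"
    using jones Lp_inf_diff[OF assms] assms(3) unfolding is_jones_family_def by blast
  then show "AE x in L. f x = g x"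
    by simp
qed

sublocale sd_space L E
proof
  show "(\<lambda>x. 0) \<in> Lp_inf L 1"
    using Lp_RI_Lp_inf[OF Lp_RI_zero[of 1 1]] by simp
qed (auto simp: Lp_inf_add Lp_inf_scale jones_F_scale intro: jones_F_add[of _ 1] jones_F_bounded[of _ 1])

text \<open>A cylinder function \<open>g n\<close> is close to \<open>f\<close> in
  \<open>L^p\<close>, hence in the weighted norm. Its truncations approach it only through the
  \<open>F_k\<close>: each \<open>F_k\<close> converges by domination by \<open>E k * g n\<close>,
  and all values are bounded by the norm of \<open>g n\<close>, so \<open>wnorm_dominated\<close>
  applies. No convergence in norm is used, which covers \<open>p = \<infinity>\<close>.\<close>

lemma trunc_approx:
  assumes f: "f \<in> Lp_inf L p" and p: "1 \<le> p" and q: "1 \<le> q" and e: "e > 0"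
  obtains s where "s \<in> Lp_inf L q" "wnorm (\<lambda>k. F f k - F s k) < e"
proof -
  obtain g where g: "\<And>n. n \<ge> 1 \<Longrightarrow> g n \<in> Lp_RI L n p"
    "\<And>e. e > 0 \<Longrightarrow> \<exists>N\<ge>1. \<forall>n\<ge>N. Lp_le L p e (\<lambda>x. f x - g n x)"
    using Lp_inf_approx[OF f p] by metis
  have "\<exists>N\<ge>1. \<forall>n\<ge>N. Lp_le L p (e / 3) (\<lambda>x. f x - g n x)"
    using e by (intro g(2)) simp
  then obtain n where n: "n \<ge> 1" "Lp_le L p (e / 3) (\<lambda>x. f x - g n x)"
    by blast
  note gn = g(1)[OF n(1)]
  have g_in: "g n \<in> Lp_inf L p"
    by (rule Lp_RI_Lp_inf[OF gn p n(1)])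
  have "cmod (F f k - F (g n) k) \<le> e / 3" for k
  proof -
    have "cmod (F (\<lambda>x. f x - g n x) k) \<le> Lnorm L p (\<lambda>x. f x - g n x)"
      by (rule jones_F_le[OF Lp_inf_diff[OF f g_in p] p])
    also have "\<dots> \<le> e / 3"
      using e by (intro Lnorm_le[OF n(2) p]) simp
    finally show ?thesis
      by (simp add: jones_F_diff[OF f g_in p])
  qed
  then have 1: "wnorm (\<lambda>k. F f k - F (g n) k) \<le> e / 3"
    by (rule wnorm_le)
  define s where "s m = trunc n m (g n)" for m
  \<comment> \<open>Every exponent at once: \<open>p\<close> serves to estimate the functionals,
    \<open>q\<close> is the target space.\<close>
  have s_in: "s m \<in> Lp_inf L r" if "1 \<le> r" for m r
    unfolding s_def by (rule Lp_RI_Lp_inf[OF trunc_Lp_RI[OF gn n(1) that] that n(1)])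
  have "(\<lambda>m. wnorm (\<lambda>k. F (g n) k - F (s m) k)) \<longlonglongrightarrow> 0"
  proof (rule wnorm_dominated)
    fix k m
    have "Lp_le L p (Lnorm L p (g n)) (s m)"
      by (rule Lp_le_mono[OF Lp_le_Lnorm[OF Lp_RI_Lspace[OF gn] p] Lp_inf_measurable[OF s_in[OF p]]])
        (simp add: s_def cmod_trunc_le)
    then have "Lnorm L p (s m) \<le> Lnorm L p (g n)"
      by (rule Lnorm_le[OF _ p Lnorm_nonneg[OF Lp_inf_measurable[OF g_in]]])
    then have "cmod (F (s m) k) \<le> Lnorm L p (g n)"
      using jones_F_le[OF s_in[OF p] p] order_trans by blast
    then show "cmod (F (g n) k - F (s m) k) \<le> Lnorm L p (g n) + Lnorm L p (g n)"
      by (intro order_trans[OF norm_triangle_ineq4 add_mono] jones_F_le[OF g_in p])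
  next
    fix k
    have "(\<lambda>m. F (s m) k) \<longlonglongrightarrow> F (g n) k"
      unfolding jones_F_def
    proof (rule integral_dominated_convergence)
      have [measurable]: "g n \<in> borel_measurable L" "E k \<in> borel_measurable L" "s m \<in> borel_measurable L" for m
        using Lp_inf_measurable[OF g_in] Lp_inf_measurable[OF s_in[OF p]] borel_measurable_integrable[OF E_integrable]
        by simp_all
      show "(\<lambda>x. E k x * g n x) \<in> borel_measurable L" "(\<lambda>x. E k x * s m x) \<in> borel_measurable L" for m
        by measurable
      show "integrable L (\<lambda>x. cmod (E k x * g n x))"
        by (intro integrable_norm E_mult_integrable[OF g_in p])
      show "AE x in L. (\<lambda>m. E k x * s m x) \<longlonglongrightarrow> E k x * g n x"
        unfolding s_def by (intro AE_I2 tendsto_mult tendsto_const trunc_tendsto[OF gn])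
      show "AE x in L. norm (E k x * s m x) \<le> cmod (E k x * g n x)" for m
        by (simp add: norm_mult s_def mult_left_mono cmod_trunc_le)
    qed
    from tendsto_diff[OF tendsto_const[of "F (g n) k"] this]
    show "(\<lambda>m. F (g n) k - F (s m) k) \<longlonglongrightarrow> 0"
      by simp
  qed
  then obtain m where 2: "wnorm (\<lambda>k. F (g n) k - F (s m) k) < e / 3"
    using eventually_happens'[OF sequentially_bot order_tendstoD(2)[of _ 0 sequentially "e/3"]] e by auto
  have "wnorm (\<lambda>k. F f k - F (s m) k) \<le> wnorm (\<lambda>k. F f k - F (g n) k) + wnorm (\<lambda>k. F (g n) k - F (s m) k)"
    by (intro wnorm_triangle3 jones_F_bounded[OF _ p] f g_in s_in[OF p])
  also have "\<dots> < e"
    using 1 2 e by linarith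
  finally show ?thesis
    using that s_in[OF q] by blast
qed

text \<open>\<open>trunc_approx\<close> is used in both directions: from \<open>L^p\<close> to
  \<open>L^1\<close> to find the element of the completion, from \<open>L^1\<close> to
  \<open>L^p\<close> for density.\<close>

theorem Lp_inf_cdc_embedding:
  assumes p: "1 \<le> p"
  shows "cdc_embedding L E (Lp_inf L p) (Lnorm L p) (\<lambda>f g. AE x in L. f x = g x) (jones_F L E)"
proof (rule cdc_embeddingI)
  show "\<exists>f\<in>W. wnorm (\<lambda>k. F f k - jones_F L E k v) < e" if ve: "v \<in> Lp_inf L p" "e > 0" for v e
  proof -
    obtain s where "s \<in> W" "wnorm (\<lambda>k. F v k - F s k) < e"
      by (rule trunc_approx[OF ve(1) p order_refl ve(2)])
    then show ?thesis by (subst wnorm_minus_commute) blast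
  qed
  show "\<exists>v\<in>Lp_inf L p. wnorm (\<lambda>k. F f k - jones_F L E k v) < e" if "f \<in> W" "e > 0" for f e
    by (rule trunc_approx[OF that(1) order_refl p that(2)]) blast
qed (auto simp: Lp_inf_add Lp_inf_scale jones_F_add[OF _ _ p] jones_F_scale jones_F_le jones_F_AE_eq_iff p)

end

subsection \<open>The bidual of \<open>L\<^sup>1\<close>\<close>

lemma dual_space_bounded: "\<phi> \<in> dual_space V N \<Longrightarrow> \<exists>C. \<forall>f\<in>V. cmod (\<phi> f) \<le> C * N f"
  by (simp add: dual_space_def)

text \<open>The constant in \<open>dual_space\<close> carries no sign; for a nonnegative
  \<open>N\<close> it can be raised to \<open>max C 0\<close>.\<close>

lemma dual_space_bound:
  assumes "\<phi> \<in> dual_space V N" "\<And>f. f \<in> V \<Longrightarrow> 0 \<le> N f"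
  obtains C where "C \<ge> 0" "\<And>f. f \<in> V \<Longrightarrow> cmod (\<phi> f) \<le> C * N f"
proof -
  obtain C where C: "\<And>f. f \<in> V \<Longrightarrow> cmod (\<phi> f) \<le> C * N f"
    using dual_space_bounded[OF assms(1)] by blast
  have "cmod (\<phi> f) \<le> max C 0 * N f" if "f \<in> V" for f
    by (rule order_trans[OF C[OF that] mult_right_mono]) (use assms(2) that in auto)
  then show ?thesis using that[of "max C 0"] by auto
qed

text \<open>A real supremum is meaningful only for sets bounded above; here the bound comes from
  membership in the dual.\<close>

lemma dual_norm_upper:
  assumes \<phi>: "\<phi> \<in> dual_space V N" and N: "\<And>f. f \<in> V \<Longrightarrow> 0 \<le> N f" and f: "f \<in> V" "N f \<le> 1"
  shows "cmod (\<phi> f) \<le> dual_norm V N \<phi>"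
proof -
  obtain C where C: "C \<ge> 0" "\<And>f. f \<in> V \<Longrightarrow> cmod (\<phi> f) \<le> C * N f"
    using dual_space_bound[OF \<phi> N] by blast
  have "cmod (\<phi> g) \<le> C" if "g \<in> V" "N g \<le> 1" for g
    using C(2)[OF that(1)] mult_left_mono[OF that(2) C(1)] by simp
  then have "bdd_above ((\<lambda>f. cmod (\<phi> f)) ` {f \<in> V. N f \<le> 1})"
    by (intro bdd_aboveI2[of _ _ C]) simp
  then show ?thesis
    unfolding dual_norm_def using f by (intro cSUP_upper) auto
qed

lemma dual_norm_le:
  assumes "f0 \<in> V" "N f0 \<le> 1" "\<And>f. f \<in> V \<Longrightarrow> N f \<le> 1 \<Longrightarrow> cmod (\<phi> f) \<le> B"
  shows "dual_norm V N \<phi> \<le> B"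
  unfolding dual_norm_def using assms by (intro cSUP_least) auto

lemma dual_norm_nonneg:
  assumes "\<phi> \<in> dual_space V N" "\<And>f. f \<in> V \<Longrightarrow> 0 \<le> N f" "f0 \<in> V" "N f0 \<le> 1"
  shows "0 \<le> dual_norm V N \<phi>"
  using dual_norm_upper[OF assms] norm_ge_zero order_trans by blast

lemma dual_norm_bound:
  assumes \<phi>: "\<phi> \<in> dual_space V N" and N: "\<And>f. f \<in> V \<Longrightarrow> 0 \<le> N f"
    and scale: "\<And>c f. f \<in> V \<Longrightarrow> (\<lambda>x. c * f x) \<in> V" "\<And>c f. f \<in> V \<Longrightarrow> N (\<lambda>x. c * f x) = cmod c * N f"
    and f: "f \<in> V"
  shows "cmod (\<phi> f) \<le> dual_norm V N \<phi> * N f"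
\<comment> \<open>\<open>N\<close> is only a seminorm, so \<open>f\<close> cannot always be
  normalised; where \<open>N f = 0\<close>, the bound forces \<open>\<phi> f = 0\<close>.\<close>
proof (cases "N f = 0")
  case True
  then show ?thesis
    using dual_space_bound[OF \<phi> N] f by (metis mult_zero_right)
next
  case False
  define c where "c = complex_of_real (1 / N f)"
  have "\<phi> (\<lambda>x. c * f x) = c * \<phi> f"
    using \<phi> f by (simp add: dual_space_def)
  moreover have "N (\<lambda>x. c * f x) \<le> 1"
    unfolding scale(2)[OF f] using False N[OF f] by (simp add: c_def norm_divide)
  ultimately have "cmod c * cmod (\<phi> f) \<le> dual_norm V N \<phi>"
    using dual_norm_upper[OF \<phi> N scale(1)[OF f, of c]] by (simp add: norm_mult)
  then show ?thesis
    using False N[OF f] by (simp add: c_def norm_divide field_simps)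
qed

lemma dual_space_add:
  assumes "\<phi> \<in> dual_space V N" "\<psi> \<in> dual_space V N"
  shows "(\<lambda>f. \<phi> f + \<psi> f) \<in> dual_space V N"
proof -
  obtain C D where "\<And>f. f \<in> V \<Longrightarrow> cmod (\<phi> f) \<le> C * N f" "\<And>f. f \<in> V \<Longrightarrow> cmod (\<psi> f) \<le> D * N f"
    using dual_space_bounded[OF assms(1)] dual_space_bounded[OF assms(2)] by blast
  then have "cmod (\<phi> f + \<psi> f) \<le> (C + D) * N f" if "f \<in> V" for f
    using that by (simp add: distrib_right norm_triangle_le add_mono)
  then have "\<exists>C. \<forall>f\<in>V. cmod (\<phi> f + \<psi> f) \<le> C * N f"
    by blast
  then show ?thesis
    using assms unfolding dual_space_def by (simp add: algebra_simps)
qed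

lemma dual_space_scale:
  assumes "\<phi> \<in> dual_space V N"
  shows "(\<lambda>f. c * \<phi> f) \<in> dual_space V N"
proof -
  obtain C where C: "\<And>f. f \<in> V \<Longrightarrow> cmod (\<phi> f) \<le> C * N f"
    using dual_space_bounded[OF assms] by blast
  have "cmod (c * \<phi> f) \<le> (cmod c * C) * N f" if "f \<in> V" for f
    using mult_left_mono[OF C[OF that], of "cmod c"] by (simp add: norm_mult mult.assoc)
  then have "\<exists>C. \<forall>f\<in>V. cmod (c * \<phi> f) \<le> C * N f"
    by blast
  then show ?thesis
    using assms unfolding dual_space_def by (simp add: distrib_left mult.left_commute)
qed

lemma wip_bound:
  assumes "\<And>k. cmod (a k) \<le> A" "\<And>k. cmod (b k) \<le> B"
  shows "cmod (wip a b) \<le> A * B"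
proof -
  have "A \<ge> 0" "B \<ge> 0" using assms norm_ge_zero order_trans by blast+
  then have le: "cmod ((1/2) ^ Suc k * a k * cnj (b k)) \<le> (A * B) * (1/2) ^ Suc k" for k
    using mult_mono[OF assms(1)[of k] assms(2)[of k]]
    by (simp add: norm_mult norm_power norm_divide mult.commute mult.left_commute)
  have "cmod (wip a b) \<le> (\<Sum>k. (A * B) * (1/2) ^ Suc k)"
    unfolding wip_def by (rule norm_suminf_le[OF le summable_half_powers])
  also have "\<dots> = A * B"
    using suminf_mult[OF summable_half_powers[of 1, unfolded mult_1], of "A * B"] suminf_half_powers by simp
  finally show ?thesis .
qed

text \<open>Shifting the index by \<open>K\<close> pulls out the factor \<open>(1/2) ^ K\<close> and
  leaves an inner product of shifted sequences, with the same sup bounds.\<close>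

lemma wip_tail_bound:
  assumes A: "\<And>k. cmod (a k) \<le> A" and B: "\<And>k. cmod (b k) \<le> B"
  shows "cmod (wip a b - (\<Sum>k<K. (1/2) ^ Suc k * a k * cnj (b k))) \<le> (1/2) ^ K * (A * B)"
proof -
  have "summable (\<lambda>k. (1/2) ^ Suc k * a k * cnj (b k))"
    by (intro wip_summable bounded_rangeI[OF A] bounded_rangeI[OF B])
  from suminf_minus_initial_segment[OF this, of K]
  have "wip a b - (\<Sum>k<K. (1/2) ^ Suc k * a k * cnj (b k)) = (\<Sum>k. (1/2) ^ Suc (k + K) * a (k + K) * cnj (b (k + K)))"
    by (simp only: wip_def)
  also have "\<dots> = (\<Sum>k. (1/2) ^ K * ((1/2) ^ Suc k * a (k + K) * cnj (b (k + K))))"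
    by (intro suminf_cong) (simp add: power_add)
  also have "\<dots> = (1/2) ^ K * wip (\<lambda>k. a (k + K)) (\<lambda>k. b (k + K))"
    unfolding wip_def
    by (intro suminf_mult wip_summable bounded_rangeI[of _ A, OF A] bounded_rangeI[of _ B, OF B])
  finally show ?thesis
    using wip_bound[of "\<lambda>k. a (k + K)" A "\<lambda>k. b (k + K)" B] A B
    by (simp add: norm_mult norm_power norm_divide divide_right_mono)
qed

section \<open>Residuals of nearly best approximation\<close>

context sd_space
begin

lemma near_minimiser:
  assumes "\<eta> > 0"
  obtains f where "f \<in> W" "\<And>g. g \<in> W \<Longrightarrow> (wnorm (\<lambda>k. a k - F f k))\<^sup>2 < (wnorm (\<lambda>k. a k - F g k))\<^sup>2 + \<eta>"
proof -
  let ?D = "(\<lambda>f. (wnorm (\<lambda>k. a k - F f k))\<^sup>2) ` W"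
  have bdd: "bdd_below ?D"
    by (intro bdd_belowI2[of _ 0]) simp
  have "?D \<noteq> {}" using L1_zero by blast
  then obtain f where f: "f \<in> W" "(wnorm (\<lambda>k. a k - F f k))\<^sup>2 < Inf ?D + \<eta>"
    using cInf_lessD[of ?D "Inf ?D + \<eta>"] assms by auto
  have "(wnorm (\<lambda>k. a k - F f k))\<^sup>2 < (wnorm (\<lambda>k. a k - F g k))\<^sup>2 + \<eta>" if "g \<in> W" for g
    using f(2) cInf_lower[OF imageI[OF that, of "\<lambda>f. (wnorm (\<lambda>k. a k - F f k))\<^sup>2"] bdd] by linarith
  then show ?thesis using that f(1) by blast
qed

text \<open>Moving \<open>f\<close> by \<open>s * g\<close> can lower the squared distance by less
  than \<eta>. Were the inner product large, a suitable \<open>s\<close> would lower it by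
  more.\<close>

lemma near_orthogonal:
  assumes a: "bounded (range a)" and f: "f \<in> W"
    and min: "\<And>g. g \<in> W \<Longrightarrow> (wnorm (\<lambda>k. a k - F f k))\<^sup>2 < (wnorm (\<lambda>k. a k - F g k))\<^sup>2 + \<eta>"
    and g: "g \<in> W" "wnorm (F g) \<le> R" and R: "R > 0"
  shows "cmod (wip (F g) (\<lambda>k. a k - F f k)) \<le> sqrt \<eta> * R"
proof -
  let ?b = "\<lambda>k. a k - F f k"
  define z where "z = wip (F g) ?b"
  \<comment> \<open>The phase makes \<open>s * z\<close> real and nonnegative, and the modulus
    minimises the quadratic with \<open>wnorm (F g)\<close> replaced by its bound \<open>R\<close>.
    The gain is then at least \<open>(cmod z)\<^sup>2 / R\<^sup>2\<close>; using \<open>R\<close>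
    avoids division by zero.\<close>
  define s where "s = cnj z / complex_of_real (R\<^sup>2)"
  have bb: "bounded (range ?b)"
    by (intro bounded_range_diff a F_bounded f)
  have "F (\<lambda>x. f x + s * g x) k = F f k + s * F g k" for k
    by (simp add: F_add F_scale L1_scale f g)
  then have "(\<lambda>k. a k - F (\<lambda>x. f x + s * g x) k) = (\<lambda>k. ?b k - s * F g k)"
    by (simp add: algebra_simps)
  then have "(wnorm ?b)\<^sup>2 < (wnorm (\<lambda>k. ?b k - s * F g k))\<^sup>2 + \<eta>"
    using min[OF L1_add[OF f L1_scale[OF g(1), of s]]] by simp
  also have "(wnorm (\<lambda>k. ?b k - s * F g k))\<^sup>2 = (wnorm ?b)\<^sup>2 - 2 * Re (s * z) + (cmod s)\<^sup>2 * (wnorm (F g))\<^sup>2"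
    unfolding z_def by (rule wnorm_sq_diff[OF bb F_bounded[OF g(1)]])
  also have "s * z = complex_of_real ((cmod z)\<^sup>2 / R\<^sup>2)"
    unfolding of_real_divide complex_norm_square s_def by simp
  also have "(cmod s)\<^sup>2 * (wnorm (F g))\<^sup>2 \<le> (cmod z)\<^sup>2 / R\<^sup>2"
  proof -
    have "(cmod s)\<^sup>2 = (cmod z)\<^sup>2 / (R\<^sup>2 * R\<^sup>2)"
      unfolding s_def by (simp add: norm_divide norm_mult power_divide power2_eq_square)
    moreover have "(wnorm (F g))\<^sup>2 \<le> R\<^sup>2"
      using g(2) by (intro power_mono wnorm_nonneg F_bounded g(1))
    ultimately have "(cmod s)\<^sup>2 * (wnorm (F g))\<^sup>2 \<le> (cmod z)\<^sup>2 / (R\<^sup>2 * R\<^sup>2) * R\<^sup>2"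
      by (simp only:) (intro mult_left_mono, auto)
    also have "\<dots> = (cmod z)\<^sup>2 / R\<^sup>2"
      using R by (simp add: field_simps power2_eq_square)
    finally show ?thesis .
  qed
  finally have "(cmod z)\<^sup>2 / R\<^sup>2 < \<eta>"
    by simp
  then have "(cmod z)\<^sup>2 \<le> \<eta> * R\<^sup>2"
    using R by (simp add: pos_divide_less_eq)
  then have "sqrt ((cmod z)\<^sup>2) \<le> sqrt (\<eta> * R\<^sup>2)"
    by (rule real_sqrt_le_mono)
  then show ?thesis
    using R by (simp add: z_def real_sqrt_mult)
qed

end

section \<open>Bidual elements acting on series of the \<open>E_k\<close>\<close>

context jones_family
begin

lemma Lnorm_L1_nonneg: "f \<in> W \<Longrightarrow> 0 \<le> Lnorm L 1 f"
  by (simp add: Lnorm_1)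

lemma Lnorm_L1_scale: "Lnorm L 1 (\<lambda>x. c * f x) = cmod c * Lnorm L 1 f"
  by (simp add: Lnorm_1 norm_mult)

lemma Lnorm_L1_zero: "Lnorm L 1 (\<lambda>x. 0) = 0"
  by (simp add: Lnorm_1)

lemma L1_dual_norm_nonneg: "\<phi> \<in> L1_dual L \<Longrightarrow> 0 \<le> L1_dual_norm L \<phi>"
  unfolding L1_dual_def L1_dual_norm_def
  by (rule dual_norm_nonneg[OF _ _ L1_zero]) (simp_all add: Lnorm_L1_nonneg Lnorm_L1_zero)

lemma L1_dual_norm_le:
  assumes "\<And>f. f \<in> W \<Longrightarrow> Lnorm L 1 f \<le> 1 \<Longrightarrow> cmod (\<phi> f) \<le> B"
  shows "L1_dual_norm L \<phi> \<le> B"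
  unfolding L1_dual_norm_def
  by (rule dual_norm_le[OF L1_zero]) (simp_all add: Lnorm_L1_zero assms)

lemma L1_dual_bound: "\<phi> \<in> L1_dual L \<Longrightarrow> f \<in> W \<Longrightarrow> cmod (\<phi> f) \<le> L1_dual_norm L \<phi> * Lnorm L 1 f"
  unfolding L1_dual_def L1_dual_norm_def
  by (rule dual_norm_bound) (simp_all add: Lnorm_L1_nonneg Lnorm_L1_scale L1_scale)

lemma F_le_L1: "f \<in> W \<Longrightarrow> cmod (F f k) \<le> Lnorm L 1 f"
  by (rule jones_F_le) auto

definition E_functional :: "nat \<Rightarrow> ((nat \<Rightarrow> real) \<Rightarrow> complex) \<Rightarrow> complex" where
  "E_functional k f = (if f \<in> W then F f k else 0)"

lemma FA_F_eq: "FA_F L E k \<mu> = \<mu> (E_functional k)"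
  by (simp add: FA_F_def E_functional_def[abs_def])

lemma E_functional_L1_dual: "E_functional k \<in> L1_dual L"
  unfolding L1_dual_def dual_space_def E_functional_def
  by (auto simp: L1_add L1_scale F_add F_scale F_le_L1 intro!: exI[of _ 1])

lemma E_functional_norm_le: "L1_dual_norm L (E_functional k) \<le> 1"
  by (rule L1_dual_norm_le) (simp add: E_functional_def order_trans[OF F_le_L1])

lemma FA_F_le: "\<mu> \<in> FA_measures L \<Longrightarrow> cmod (FA_F L E k \<mu>) \<le> FA_norm L \<mu>"
  unfolding FA_F_eq FA_measures_def FA_norm_def
  by (erule dual_norm_upper) (fact L1_dual_norm_nonneg E_functional_L1_dual E_functional_norm_le)+

lemma FA_measures_add:
  "\<mu> \<in> FA_measures L \<Longrightarrow> \<phi> \<in> L1_dual L \<Longrightarrow> \<psi> \<in> L1_dual L \<Longrightarrow> \<mu> (\<lambda>f. \<phi> f + \<psi> f) = \<mu> \<phi> + \<mu> \<psi>"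
  by (simp add: FA_measures_def dual_space_def)

lemma FA_measures_scale: "\<mu> \<in> FA_measures L \<Longrightarrow> \<phi> \<in> L1_dual L \<Longrightarrow> \<mu> (\<lambda>f. c * \<phi> f) = c * \<mu> \<phi>"
  by (simp add: FA_measures_def dual_space_def)

lemma L1_dual_add: "\<phi> \<in> L1_dual L \<Longrightarrow> \<psi> \<in> L1_dual L \<Longrightarrow> (\<lambda>f. \<phi> f + \<psi> f) \<in> L1_dual L"
  unfolding L1_dual_def by (rule dual_space_add)

lemma L1_dual_scale: "\<phi> \<in> L1_dual L \<Longrightarrow> (\<lambda>f. c * \<phi> f) \<in> L1_dual L"
  unfolding L1_dual_def by (rule dual_space_scale)

lemma L1_dual_zero: "(\<lambda>f. 0) \<in> L1_dual L"
  using L1_dual_scale[OF E_functional_L1_dual, of 0] by simp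

text \<open>Both claims are proved in one induction, since additivity of \<mu> may be used only once
  the partial sum is known to lie in the dual.\<close>

lemma finite_combination:
  fixes K :: nat
  assumes "\<mu> \<in> FA_measures L"
  shows "(\<lambda>f. \<Sum>k<K. c k * E_functional k f) \<in> L1_dual L"
    and "\<mu> (\<lambda>f. \<Sum>k<K. c k * E_functional k f) = (\<Sum>k<K. c k * FA_F L E k \<mu>)"
proof (induction K)
  case 0
  {
    case 1 show ?case by (simp add: L1_dual_zero)
  next
    case 2 show ?case
      using FA_measures_scale[OF assms L1_dual_zero, of 0] by simp
  }
next
  case (Suc K)
  {
    case 1 show ?case
      using L1_dual_add[OF Suc(1) L1_dual_scale[OF E_functional_L1_dual, of "c K" K]] by simp
  next
    case 2 show ?case
      using FA_measures_add[OF assms Suc(1) L1_dual_scale[OF E_functional_L1_dual, of "c K" K]]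
        FA_measures_scale[OF assms E_functional_L1_dual, of "c K" K]
      by (simp add: Suc(2) FA_F_eq)
  }
qed

text \<open>For bounded \<open>b\<close> this is the infinite combination of the functionals
  \<open>E_k\<close> with coefficients \<open>(1/2) ^ Suc k * cnj (b k)\<close>.\<close>

definition wip_functional :: "(nat \<Rightarrow> complex) \<Rightarrow> ((nat \<Rightarrow> real) \<Rightarrow> complex) \<Rightarrow> complex" where
  "wip_functional b f = (if f \<in> W then wip (F f) b else 0)"

lemma wip_functional_L1_dual:
  assumes b: "\<And>k. cmod (b k) \<le> B"
  shows "wip_functional b \<in> L1_dual L"
proof -
  have bb: "bounded (range b)" by (rule bounded_rangeI[OF b])
  have add: "wip (F (\<lambda>x. f x + g x)) b = wip (F f) b + wip (F g) b" if "f \<in> W" "g \<in> W" for f g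
    unfolding wip_def suminf_add[OF wip_summable[OF F_bounded[OF that(1)] bb] wip_summable[OF F_bounded[OF that(2)] bb]]
    by (simp only: F_add[OF that] distrib_left distrib_right)
  have scale: "wip (F (\<lambda>x. c * f x)) b = c * wip (F f) b" if "f \<in> W" for c f
    unfolding wip_def suminf_mult[OF wip_summable[OF F_bounded[OF that] bb], symmetric]
    by (simp only: F_scale[OF that] mult_ac)
  have "cmod (wip (F f) b) \<le> B * Lnorm L 1 f" if "f \<in> W" for f
    using wip_bound[of "F f" "Lnorm L 1 f" b B] F_le_L1[OF that] b by (simp add: mult.commute)
  then show ?thesis
    unfolding L1_dual_def dual_space_def wip_functional_def
    by (auto simp: L1_add L1_scale add scale)
qed

text \<open>Pointwise convergence of functionals would not allow \<mu> to be exchanged with the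
  series. The tails, however, have dual norm at most \<open>B * (1/2) ^ K\<close>, and \<mu> is
  bounded for the dual norm.\<close>

lemma FA_measure_wip_functional:
  assumes \<mu>: "\<mu> \<in> FA_measures L" and b: "\<And>k. cmod (b k) \<le> B"
  shows "\<mu> (wip_functional b) = wip (\<lambda>k. FA_F L E k \<mu>) b"
proof -
  define c where "c k = (1/2) ^ Suc k * cnj (b k)" for k
  obtain C where C: "C \<ge> 0" "\<And>\<phi>. \<phi> \<in> L1_dual L \<Longrightarrow> cmod (\<mu> \<phi>) \<le> C * L1_dual_norm L \<phi>"
    using dual_space_bound[OF \<mu>[unfolded FA_measures_def] L1_dual_norm_nonneg] by blast
  have B: "B \<ge> 0" using b norm_ge_zero order_trans by blast
  have le: "cmod (\<mu> (wip_functional b) - (\<Sum>k<K. c k * FA_F L E k \<mu>)) \<le> C * B * (1/2) ^ K" for K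
  proof -
    let ?\<phi> = "\<lambda>f. \<Sum>k<K. c k * E_functional k f"
    \<comment> \<open>The difference is written with the factor -1 because linearity of \<mu> is
      given for sums and multiples.\<close>
    let ?d = "\<lambda>f. wip_functional b f + (-1) * ?\<phi> f"
    note w = wip_functional_L1_dual[OF b] and s = L1_dual_scale[OF finite_combination(1)[OF \<mu>, of c K], of "-1"]
    have "L1_dual_norm L ?d \<le> B * (1/2) ^ K"
    proof (rule L1_dual_norm_le)
      fix f assume f: "f \<in> W" "Lnorm L 1 f \<le> 1"
      have "?d f = wip (F f) b - (\<Sum>k<K. (1/2) ^ Suc k * F f k * cnj (b k))"
        using f(1) by (simp add: wip_functional_def E_functional_def c_def mult_ac)
      also have "cmod \<dots> \<le> (1/2) ^ K * (1 * B)"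
        using F_le_L1[OF f(1)] f(2) by (intro wip_tail_bound b) (rule order_trans)
      finally show "cmod (?d f) \<le> B * (1/2) ^ K" by (simp add: mult.commute)
    qed
    then have "cmod (\<mu> ?d) \<le> C * (B * (1/2) ^ K)"
      by (rule order_trans[OF C(2)[OF L1_dual_add[OF w s]] mult_left_mono[OF _ C(1)]])
    moreover have "\<mu> ?d = \<mu> (wip_functional b) - (\<Sum>k<K. c k * FA_F L E k \<mu>)"
      unfolding FA_measures_add[OF \<mu> w s] FA_measures_scale[OF \<mu> finite_combination(1)[OF \<mu>]]
        finite_combination(2)[OF \<mu>] by simp
    ultimately show ?thesis by (simp add: mult.assoc)
  qed
  have "(\<lambda>K. \<Sum>k<K. c k * FA_F L E k \<mu>) \<longlonglongrightarrow> \<mu> (wip_functional b)"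
  proof (rule LIM_zero_cancel, rule Lim_null_comparison)
    show "\<forall>\<^sub>F K in sequentially. norm ((\<Sum>k<K. c k * FA_F L E k \<mu>) - \<mu> (wip_functional b)) \<le> C * B * (1/2) ^ K"
      using le by (simp add: norm_minus_commute)
    show "(\<lambda>K. C * B * (1/2) ^ K) \<longlonglongrightarrow> 0"
      by (intro tendsto_mult_right_zero LIMSEQ_realpow_zero) auto
  qed
  moreover have "(\<lambda>K. \<Sum>k<K. (1/2) ^ Suc k * FA_F L E k \<mu> * cnj (b k)) \<longlonglongrightarrow> wip (\<lambda>k. FA_F L E k \<mu>) b"
    unfolding wip_def
    by (intro summable_LIMSEQ wip_summable bounded_rangeI[OF b] bounded_rangeI[OF FA_F_le[OF \<mu>]])
  then have "(\<lambda>K. \<Sum>k<K. c k * FA_F L E k \<mu>) \<longlonglongrightarrow> wip (\<lambda>k. FA_F L E k \<mu>) b"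
    by (simp add: c_def mult_ac)
  ultimately show ?thesis
    by (rule LIMSEQ_unique)
qed

lemma FA_measure_approx:
  assumes \<mu>: "\<mu> \<in> FA_measures L" and e: "e > 0"
  shows "\<exists>f\<in>W. wnorm (\<lambda>k. F f k - FA_F L E k \<mu>) < e"
proof -
  define a where "a k = FA_F L E k \<mu>" for k
  have a: "bounded (range a)"
    unfolding a_def by (rule bounded_rangeI[OF FA_F_le[OF \<mu>]])
  obtain C where C: "C \<ge> 0" "\<And>\<phi>. \<phi> \<in> L1_dual L \<Longrightarrow> cmod (\<mu> \<phi>) \<le> C * L1_dual_norm L \<phi>"
    using dual_space_bound[OF \<mu>[unfolded FA_measures_def] L1_dual_norm_nonneg] by blast
  \<comment> \<open>A bound for \<open>wnorm (F f)\<close> known before \<open>f\<close> is chosen: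
    comparison with the function 0 and \<open>\<eta> \<le> 1\<close> give
    \<open>wnorm b \<le> wnorm a + 1\<close>, and \<open>F f = a - b\<close>.\<close>
  define R where "R = 2 * wnorm a + 1"
  have R: "R > 0" using wnorm_nonneg[OF a] by (simp add: R_def)
  \<comment> \<open>The final estimate is
    \<open>(wnorm b)\<^sup>2 \<le> (C + R) * sqrt \<eta>\<close>, which this choice makes at most
    \<open>e\<^sup>2 / 2\<close>. There is no circularity, as neither \<open>C\<close> nor
    \<open>R\<close> depends on \<eta>.\<close>
  define \<eta> where "\<eta> = min 1 ((e\<^sup>2 / (2 * (C + R)))\<^sup>2)"
  have CR: "C + R > 0" using C(1) R by simp
  have \<eta>: "\<eta> > 0" "\<eta> \<le> 1" "sqrt \<eta> \<le> e\<^sup>2 / (2 * (C + R))"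
  proof -
    show "\<eta> > 0" "\<eta> \<le> 1" using e CR by (auto simp: \<eta>_def)
    have "sqrt \<eta> \<le> sqrt ((e\<^sup>2 / (2 * (C + R)))\<^sup>2)"
      unfolding \<eta>_def by (intro real_sqrt_le_mono) simp
    then show "sqrt \<eta> \<le> e\<^sup>2 / (2 * (C + R))"
      using CR by simp
  qed
  obtain f where f: "f \<in> W"
    and min: "\<And>g. g \<in> W \<Longrightarrow> (wnorm (\<lambda>k. a k - F f k))\<^sup>2 < (wnorm (\<lambda>k. a k - F g k))\<^sup>2 + \<eta>"
    using near_minimiser[OF \<eta>(1), of a] by blast
  define b where "b = (\<lambda>k. a k - F f k)"
  have bb: "bounded (range b)"
    unfolding b_def by (intro bounded_range_diff a F_bounded f)
  then obtain B where B: "\<And>k. cmod (b k) \<le> B"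
    by (metis bounded_range_cmod)
  have orth: "cmod (wip (F g) b) \<le> sqrt \<eta> * r" if "g \<in> W" "wnorm (F g) \<le> r" "r > 0" for g r
    unfolding b_def by (rule near_orthogonal[OF a f min that])
  have "wnorm b \<le> wnorm a + 1"
  proof (rule power2_le_imp_le)
    have "F (\<lambda>x. 0) k = 0" for k
      using F_scale[OF L1_zero, of k 0] by simp
    then have "(wnorm b)\<^sup>2 \<le> (wnorm a)\<^sup>2 + 1"
      using min[OF L1_zero] \<eta>(2) by (simp add: b_def)
    also have "\<dots> \<le> (wnorm a + 1)\<^sup>2"
      using wnorm_nonneg[OF a] by (simp add: power2_sum)
    finally show "(wnorm b)\<^sup>2 \<le> (wnorm a + 1)\<^sup>2" .
  qed (use wnorm_nonneg[OF a] in simp)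
  moreover have "wnorm (F f) \<le> wnorm a + wnorm b"
    using wnorm_triangle[OF a bounded_range_cmult[OF bb, of "-1"]] wnorm_cmult[OF bb, of "-1"]
    by (simp add: b_def)
  ultimately have "cmod (wip (F f) b) \<le> sqrt \<eta> * R"
    by (intro orth f R) (simp add: R_def)
  moreover have "cmod (wip a b) \<le> C * sqrt \<eta>"
  proof -
    \<comment> \<open>Near-orthogonality is uniform over the unit ball of \<open>L^1\<close>, on
      which \<open>wnorm (F g) \<le> 1\<close>; this is precisely a bound on the dual norm.\<close>
    have "L1_dual_norm L (wip_functional b) \<le> sqrt \<eta>"
    proof (rule L1_dual_norm_le)
      fix g assume g: "g \<in> W" "Lnorm L 1 g \<le> 1"
      have "wnorm (F g) \<le> 1"
        using F_le_L1[OF g(1)] g(2) order_trans by (intro wnorm_le) blast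
      then show "cmod (wip_functional b g) \<le> sqrt \<eta>"
        using orth[OF g(1), of 1] g(1) by (simp add: wip_functional_def)
    qed
    then have "cmod (\<mu> (wip_functional b)) \<le> C * sqrt \<eta>"
      by (rule order_trans[OF C(2)[OF wip_functional_L1_dual[OF B]] mult_left_mono[OF _ C(1)]])
    then show ?thesis
      using FA_measure_wip_functional[of \<mu> b B, OF \<mu> B] by (simp add: a_def[abs_def])
  qed
  moreover have "(wnorm b)\<^sup>2 \<le> cmod (wip a b) + cmod (wip (F f) b)"
  proof -
    have "(wnorm b)\<^sup>2 = cmod (wip b b)"
      unfolding wip_self[OF bb] by (simp add: norm_power)
    also have "wip b b = wip a b - wip (F f) b"
      using wip_diff_left[OF a F_bounded[OF f] bb] by (simp add: b_def)
    finally show ?thesis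
      using norm_triangle_ineq4[of "wip a b" "wip (F f) b"] by simp
  qed
  ultimately have "(wnorm b)\<^sup>2 \<le> (C + R) * sqrt \<eta>"
    by (simp add: algebra_simps)
  also have "\<dots> \<le> (C + R) * (e\<^sup>2 / (2 * (C + R)))"
    using CR \<eta>(3) by (intro mult_left_mono) auto
  also have "\<dots> = e\<^sup>2 / 2"
  proof -
    have "x * (y / (2 * x)) = y / 2" if "x > 0" for x y :: real
      using that by simp
    from this[OF CR] show ?thesis .
  qed
  also have "\<dots> < e\<^sup>2" using e by simp
  finally have "wnorm b < e"
    by (rule power2_less_imp_less) (use e in simp)
  then show ?thesis
    using f wnorm_minus_commute[of a "F f"] by (intro bexI[of _ f]) (simp_all add: b_def a_def)
qed

text \<open>The canonical map of \<open>L^1\<close> into its bidual. It preserves every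
  \<open>F_k\<close>, so the image of the bidual contains that of \<open>L^1\<close>, and density
  needs no further approximation.\<close>

definition evaluation :: "((nat \<Rightarrow> real) \<Rightarrow> complex) \<Rightarrow> (((nat \<Rightarrow> real) \<Rightarrow> complex) \<Rightarrow> complex) \<Rightarrow> complex" where
  "evaluation f \<phi> = (if \<phi> \<in> L1_dual L then \<phi> f else 0)"

lemma evaluation_FA_measures:
  assumes "f \<in> W"
  shows "evaluation f \<in> FA_measures L"
  unfolding FA_measures_def dual_space_def evaluation_def
  using L1_dual_bound[OF _ assms]
  by (auto simp: L1_dual_add L1_dual_scale mult.commute intro!: exI[of _ "Lnorm L 1 f"])

lemma FA_F_evaluation: "f \<in> W \<Longrightarrow> FA_F L E k (evaluation f) = F f k"
  by (simp add: FA_F_eq evaluation_def E_functional_L1_dual) (simp add: E_functional_def)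

theorem FA_measures_cdc_embedding:
  "cdc_embedding L E (FA_measures L) (FA_norm L) (FA_eq L E) (FA_F L E)"
proof (rule cdc_embeddingI)
  show "\<exists>\<mu>\<in>FA_measures L. wnorm (\<lambda>k. F f k - FA_F L E k \<mu>) < e" if "f \<in> W" "e > 0" for f e
    using that by (intro bexI[OF _ evaluation_FA_measures]) (simp_all add: FA_F_evaluation, simp add: wnorm_def)
  show "(\<lambda>\<phi>. \<mu> \<phi> + \<nu> \<phi>) \<in> FA_measures L" if "\<mu> \<in> FA_measures L" "\<nu> \<in> FA_measures L" for \<mu> \<nu>
    using that unfolding FA_measures_def by (rule dual_space_add)
  show "(\<lambda>\<phi>. c * \<mu> \<phi>) \<in> FA_measures L" if "\<mu> \<in> FA_measures L" for c \<mu>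
    using that unfolding FA_measures_def by (rule dual_space_scale)
qed (simp_all add: FA_F_le FA_measure_approx FA_eq_def, simp_all add: FA_F_def)

end

theorem theorem3p5:
  fixes L :: "(nat \<Rightarrow> real) measure"
    and E :: "nat \<Rightarrow> (nat \<Rightarrow> real) \<Rightarrow> complex"
    and p :: ennreal
  assumes "is_lambda_inf L"
    and "is_jones_family L E"
    and "1 \<le> p"
  shows "cdc_embedding L E (Lp_inf L p) (Lnorm L p)
           (\<lambda>f g. AE x in L. f x = g x) (jones_F L E)
       \<and> cdc_embedding L E (FA_measures L) (FA_norm L) (FA_eq L E) (FA_F L E)"
proof -
  interpret jones_family L E
    by unfold_locales (fact assms)+
  show ?thesis
    using Lp_inf_cdc_embedding[OF assms(3)] FA_measures_cdc_embedding by blast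
qed

end
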